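(* Consider the system of ODEs $$t_1'=\tfrac{1}{8}\big(t_1^2-t_2^2\big),\qquad t_2'=\tfrac{1}{4}\big(t_1t_2-t_3\big),\qquad t_3'=\tfrac{1}{2}\big(t_1t_3-t_2^3\big).$$ \begin{enumerate} \item A particular solution of this system is $$t_1=P_2(q):=\tfrac{1}{3}\big(E_2(q)+2E_2(q^2)\big),\quad t_2=Q_2(q):=2E_2(q^2)-E_2(q),\quad t_3=R_2(q):=\tfrac{1}{3}\big(4E_4(q^2)-E_4(q)\big),$$ with $Q_2\in \mathscr{M}_2(\Gamma_0(2))$, $R_2\in\mathscr{M}_4(\Gamma_0(2))$ and $P_2\in\widetilde{\mathscr{M}}_2(\Gamma_0(2))$. Furthermore, if $\Delta_2:=\eta^8(q)\eta^8(q^2)$, then $\Delta_2$ is a cusp form of weight $8$ for $\Gamma_0(2)$, $\Delta_2=\frac{1}{256}\big(Q_2^4-R_2^2\big)$, and $\Delta_2'=P_2\Delta_2$. \item $\mathscr{M}(\Gamma_0(2))=\mathbb{C}[Q_2,R_2]$ and $\widetilde{\mathscr{M}}(\Gamma_0(2))=\mathbb{C}[P_2,Q_2,R_2]$. \item The Lie algebra (under the commutator of vector fields) generated by the vector fields on $\mathbb{C}^3$ $$\mathsf{R}_2=\tfrac{1}{8}(t_1^2-t_2^2)\tfrac{\partial}{\partial t_1}+\tfrac{1}{4}(t_1t_2-t_3)\tfrac{\partial}{\partial t_2}+\tfrac{1}{2}(t_1t_3-t_2^3)\tfrac{\partial}{\partial t_3},\quad \mathsf{H}_2=2t_1\tfrac{\partial}{\partial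 t_1}+2t_2\tfrac{\partial}{\partial t_2}+4t_3\tfrac{\partial}{\partial t_3},\quad \mathsf{F}_2=-8\tfrac{\partial}{\partial t_1}$$ is isomorphic to the Lie algebra $\mathfrak{sl}_2(\mathbb{C})$. \end{enumerate}
   Context: Throughout, $\tau\in\mathbb{H}=\{\tau\in\mathbb{C}:\operatorname{Im}\tau>0\}$, $q=e^{2\pi i\tau}$, and $f':=q\frac{\partial f}{\partial q}=\frac{1}{2\pi i}\frac{df}{d\tau}$. Eisenstein series: $E_2(q)=1-24\sum_{k\ge1}\sigma_1(k)q^k$, $E_4(q)=1+240\sum_{k\ge1}\sigma_3(k)q^k$, where $\sigma_j(k)=\sum_{d\mid k}d^j$. The eta function is $\eta(q)=q^{1/24}\prod_{k\ge1}(1-q^k)$. $\Gamma_0(N)=\{\begin{pmatrix}a&b\\c&d\end{pmatrix}\in\mathrm{SL}_2(\mathbb{Z}): c\equiv0 \pmod N\}$. For a finite-index subgroup $\Gamma\subset\mathrm{SL}_2(\mathbb{Z})$, $\mathscr{M}_k(\Gamma)$ denotes the space of (holomorphic) modular forms of weight $k$ on $\Gamma$ (holomorphic on $\mathbb{H}$ and at all cusps, satisfying $(c\tau+d)^{-k}f(\gamma\tau)=f(\tau)$ for $\gamma\in\Gamma$); a cusp form additionally vanishes at all cusps. $\widetilde{\mathscr{M}}_k(\Gamma)$ denotes the space of quasi-modular forms of weight $k$: holomorphic functions $f$ of moderate growth such that for all $\gamma=\begin{pmatrix}a&b\\c&d\end{pmatrix}\in\Gamma$, $(c\tau+d)^{-k}f(\gamma\tau)=\sum_{j=0}^p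 f_j(\tau)\big(\frac{c}{c\tau+d}\big)^j$ with $f_j$ holomorphic of moderate growth and $f_0=f$. $\mathscr{M}(\Gamma)=\bigoplus_{k\ge0}\mathscr{M}_k(\Gamma)$ and $\widetilde{\mathscr{M}}(\Gamma)=\bigoplus_{k\ge0}\widetilde{\mathscr{M}}_k(\Gamma)$ are the graded algebras of modular and quasi-modular forms. *)

theory Defs
  imports
    "HOL-Complex_Analysis.Complex_Analysis"
    "HOL-Library.Function_Algebras"
    "HOL-Library.Poly_Mapping"
begin

section \<open>The upper half plane and holomorphic functions on it\<close>

typedef uhp = "{\<tau>::complex. Im \<tau> > 0}"
  morphisms of_uhp to_uhp
  by (rule exI[of _ \<i>]) simp

text \<open>
  The upper half plane is a type of its own, so that functions on it carry no values outside their
  domain: pointwise operations turn \<^typ>\<open>uhp \<Rightarrow> complex\<close> into a commutative ring, and equality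
  there is equality on the half plane.
\<close>

definition nome :: "uhp \<Rightarrow> complex" where
  "nome \<tau> = exp (2 * of_real pi * \<i> * of_uhp \<tau>)"

definition hol_uhp :: "(uhp \<Rightarrow> complex) \<Rightarrow> bool" where
  "hol_uhp f \<longleftrightarrow> (\<lambda>z. f (to_uhp z)) holomorphic_on {z. Im z > 0}"

text \<open>The derivation \<open>q d/dq\<close> in the coordinate \<open>\<tau>\<close>.\<close>

definition qderiv :: "(uhp \<Rightarrow> complex) \<Rightarrow> uhp \<Rightarrow> complex" where
  "qderiv f \<tau> = 1 / (2 * of_real pi * \<i>) * deriv (\<lambda>z. f (to_uhp z)) (of_uhp \<tau>)"


section \<open>Modular and quasi-modular forms\<close>

definition SL2Z :: "(int^2^2) set" where
  "SL2Z = {A. det A = 1}"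

definition Gamma0 :: "nat \<Rightarrow> (int^2^2) set" where
  "Gamma0 N = {A \<in> SL2Z. int N dvd A $ 2 $ 1}"

definition autfactor :: "int^2^2 \<Rightarrow> uhp \<Rightarrow> complex" where
  "autfactor A \<tau> = of_int (A $ 2 $ 1) * of_uhp \<tau> + of_int (A $ 2 $ 2)"

definition moebius :: "int^2^2 \<Rightarrow> uhp \<Rightarrow> uhp" where
  "moebius A \<tau> =
     to_uhp ((of_int (A $ 1 $ 1) * of_uhp \<tau> + of_int (A $ 1 $ 2)) / autfactor A \<tau>)"

definition slash :: "nat \<Rightarrow> int^2^2 \<Rightarrow> (uhp \<Rightarrow> complex) \<Rightarrow> uhp \<Rightarrow> complex" where
  "slash k A f \<tau> = autfactor A \<tau> powi (- int k) * f (moebius A \<tau>)"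

text \<open>
  \<open>f\<close> is a holomorphic function \<open>g\<close> of the local parameter \<open>exp (2 \<pi> \<i> \<tau> / h)\<close> at
  \<open>\<infinity>\<close>, the point \<open>\<infinity>\<close> (parameter value 0) included.
\<close>

definition expands_at_infinity ::
    "(uhp \<Rightarrow> complex) \<Rightarrow> nat \<Rightarrow> (complex \<Rightarrow> complex) \<Rightarrow> bool" where
  "expands_at_infinity f h g \<longleftrightarrow>
     h > 0 \<and> g holomorphic_on ball 0 1 \<and>
     (\<forall>\<tau>. f \<tau> = g (exp (2 * of_real pi * \<i> * of_uhp \<tau> / of_nat h)))"

definition holomorphic_at_infinity :: "(uhp \<Rightarrow> complex) \<Rightarrow> bool" where
  "holomorphic_at_infinity f \<longleftrightarrow> (\<exists>h g. expands_at_infinity f h g)"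

definition vanishes_at_infinity :: "(uhp \<Rightarrow> complex) \<Rightarrow> bool" where
  "vanishes_at_infinity f \<longleftrightarrow> (\<exists>h g. expands_at_infinity f h g \<and> g 0 = 0)"

text \<open>
  The cusps are the points \<open>A \<infinity>\<close> with \<open>A \<in> SL2Z\<close>; behaviour of \<open>f\<close> at \<open>A \<infinity>\<close>
  is behaviour of \<open>slash k A f\<close> at \<open>\<infinity>\<close>.  In all of the following definitions \<open>\<Gamma>\<close> is
  meant to be a subgroup of finite index in \<open>SL2Z\<close>.
\<close>

definition modular_forms :: "(int^2^2) set \<Rightarrow> nat \<Rightarrow> (uhp \<Rightarrow> complex) set" where
  "modular_forms \<Gamma> k =
     {f. hol_uhp f \<and> (\<forall>A\<in>\<Gamma>. slash k A f = f) \<and>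
         (\<forall>A\<in>SL2Z. holomorphic_at_infinity (slash k A f))}"

definition cusp_forms :: "(int^2^2) set \<Rightarrow> nat \<Rightarrow> (uhp \<Rightarrow> complex) set" where
  "cusp_forms \<Gamma> k =
     {f \<in> modular_forms \<Gamma> k. \<forall>A\<in>SL2Z. vanishes_at_infinity (slash k A f)}"

text \<open>
  Polynomial growth towards the boundary, in terms of \<open>(1 + |\<tau>|\<^sup>2) / Im \<tau>\<close>.  An element of
  \<open>SL2Z\<close> changes this quantity at most by a constant factor, so that the condition treats all
  cusps alike.  For functions invariant under some translation \<open>\<tau> \<mapsto> \<tau> + h\<close> it says that
  \<open>f\<close> is bounded by a power of \<open>Im \<tau> + 1 / Im \<tau>\<close>.
\<close>

definition moderate_growth :: "(uhp \<Rightarrow> complex) \<Rightarrow> bool" where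
  "moderate_growth f \<longleftrightarrow>
     (\<exists>C::real. \<exists>m::nat. \<forall>\<tau>.
        norm (f \<tau>) \<le> C * ((1 + (norm (of_uhp \<tau>))\<^sup>2) / Im (of_uhp \<tau>)) ^ m)"

definition quasi_modular_forms :: "(int^2^2) set \<Rightarrow> nat \<Rightarrow> (uhp \<Rightarrow> complex) set" where
  "quasi_modular_forms \<Gamma> k =
     {f. \<exists>(p::nat) F. F 0 = f \<and> (\<forall>j\<le>p. hol_uhp (F j) \<and> moderate_growth (F j)) \<and>
           (\<forall>A\<in>\<Gamma>. \<forall>\<tau>. slash k A f \<tau> =
              (\<Sum>j\<le>p. F j \<tau> * (of_int (A $ 2 $ 1) / autfactor A \<tau>) ^ j))}"


section \<open>Graded algebras and algebras generated by finitely many elements\<close>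

text \<open>
  The direct sum of a family \<open>V\<close> of spaces of functions consists of the finitely supported
  families \<open>F\<close> with \<open>F k \<in> V k\<close>.  The multiplication of \<^typ>\<open>nat \<Rightarrow>\<^sub>0 'a\<close> is convolution,
  which is the product of the graded algebra; \<open>Poly_Mapping.single k f\<close> is the function \<open>f\<close>
  regarded as a homogeneous element of degree \<open>k\<close>.
\<close>

type_synonym graded = "nat \<Rightarrow>\<^sub>0 (uhp \<Rightarrow> complex)"

definition direct_sum :: "(nat \<Rightarrow> (uhp \<Rightarrow> complex) set) \<Rightarrow> graded set" where
  "direct_sum V = {F. \<forall>k. Poly_Mapping.lookup F k \<in> V k}"

definition modular_algebra :: "(int^2^2) set \<Rightarrow> graded set" where
  "modular_algebra \<Gamma> = direct_sum (modular_forms \<Gamma>)"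

definition quasi_modular_algebra :: "(int^2^2) set \<Rightarrow> graded set" where
  "quasi_modular_algebra \<Gamma> = direct_sum (quasi_modular_forms \<Gamma>)"

text \<open>
  \<^typ>\<open>('v \<Rightarrow>\<^sub>0 nat) \<Rightarrow>\<^sub>0 complex\<close> is the ring of complex polynomials in variables indexed by
  the finite type \<^typ>\<open>'v\<close>.
\<close>

definition mpoly_eval :: "graded^'v \<Rightarrow> (('v \<Rightarrow>\<^sub>0 nat) \<Rightarrow>\<^sub>0 complex) \<Rightarrow> graded" where
  "mpoly_eval x p =
     (\<Sum>m\<in>Poly_Mapping.keys p.
        Poly_Mapping.single 0 (\<lambda>_. Poly_Mapping.lookup p m) *
        (\<Prod>i\<in>UNIV. x $ i ^ Poly_Mapping.lookup m i))"

definition generated_algebra :: "graded^'v \<Rightarrow> graded set" where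
  "generated_algebra x = range (mpoly_eval x)"

definition algebraically_independent :: "graded^'v \<Rightarrow> bool" where
  "algebraically_independent x \<longleftrightarrow> inj (mpoly_eval x)"


section \<open>Eisenstein series, the eta function and the forms of level 2\<close>

definition sigma :: "nat \<Rightarrow> nat \<Rightarrow> nat" where
  "sigma j k = (\<Sum>d | d dvd k. d ^ j)"

definition E2 :: "complex \<Rightarrow> complex" where
  "E2 q = 1 - 24 * suminf (\<lambda>k. of_nat (sigma 1 (Suc k)) * q ^ Suc k)"

definition E4 :: "complex \<Rightarrow> complex" where
  "E4 q = 1 + 240 * suminf (\<lambda>k. of_nat (sigma 3 (Suc k)) * q ^ Suc k)"

text \<open>
  A function of \<open>\<tau>\<close> rather than of \<open>q\<close>, which fixes the branch
  \<open>q\<^bsup>1/24\<^esup> = exp (2 \<pi> \<i> \<tau> / 24)\<close>; replacing \<open>q\<close> by \<open>q\<^sup>2\<close> is replacing \<open>\<tau>\<close> by \<open>2 \<tau>\<close>.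
\<close>

definition eta :: "complex \<Rightarrow> complex" where
  "eta \<tau> = exp (2 * of_real pi * \<i> * \<tau> / 24) *
           prodinf (\<lambda>k. 1 - exp (2 * of_real pi * \<i> * \<tau>) ^ Suc k)"

definition P\<^sub>2 :: "uhp \<Rightarrow> complex" where
  "P\<^sub>2 \<tau> = 1 / 3 * (E2 (nome \<tau>) + 2 * E2 ((nome \<tau>)\<^sup>2))"

definition Q\<^sub>2 :: "uhp \<Rightarrow> complex" where
  "Q\<^sub>2 \<tau> = 2 * E2 ((nome \<tau>)\<^sup>2) - E2 (nome \<tau>)"

definition R\<^sub>2 :: "uhp \<Rightarrow> complex" where
  "R\<^sub>2 \<tau> = 1 / 3 * (4 * E4 ((nome \<tau>)\<^sup>2) - E4 (nome \<tau>))"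

definition \<Delta>\<^sub>2 :: "uhp \<Rightarrow> complex" where
  "\<Delta>\<^sub>2 \<tau> = eta (of_uhp \<tau>) ^ 8 * eta (2 * of_uhp \<tau>) ^ 8"

definition solves_system ::
    "(uhp \<Rightarrow> complex) \<Rightarrow> (uhp \<Rightarrow> complex) \<Rightarrow> (uhp \<Rightarrow> complex) \<Rightarrow> bool" where
  "solves_system t\<^sub>1 t\<^sub>2 t\<^sub>3 \<longleftrightarrow>
     hol_uhp t\<^sub>1 \<and> hol_uhp t\<^sub>2 \<and> hol_uhp t\<^sub>3 \<and>
     (\<forall>\<tau>. qderiv t\<^sub>1 \<tau> = 1 / 8 * ((t\<^sub>1 \<tau>)\<^sup>2 - (t\<^sub>2 \<tau>)\<^sup>2) \<and>
          qderiv t\<^sub>2 \<tau> = 1 / 4 * (t\<^sub>1 \<tau> * t\<^sub>2 \<tau> - t\<^sub>3 \<tau>) \<and>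
          qderiv t\<^sub>3 \<tau> = 1 / 2 * (t\<^sub>1 \<tau> * t\<^sub>3 \<tau> - (t\<^sub>2 \<tau>) ^ 3))"


section \<open>Vector fields on complex 3-space\<close>

text \<open>
  The vector field \<open>\<Sum>i. X\<^sub>i \<partial>/\<partial>t\<^sub>i\<close> is given by its coefficient function \<open>t \<mapsto> (X\<^sub>i t)\<^sub>i\<close>.
\<close>

type_synonym vfield = "complex^3 \<Rightarrow> complex^3"

definition partial_deriv :: "3 \<Rightarrow> (complex^3 \<Rightarrow> complex) \<Rightarrow> complex^3 \<Rightarrow> complex" where
  "partial_deriv j f t = deriv (\<lambda>z. f (\<chi> i. if i = j then z else t $ i)) (t $ j)"

definition vf_apply :: "vfield \<Rightarrow> (complex^3 \<Rightarrow> complex) \<Rightarrow> complex^3 \<Rightarrow> complex" where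
  "vf_apply X f t = (\<Sum>j\<in>UNIV. X t $ j * partial_deriv j f t)"

text \<open>
  The coefficient of \<open>\<partial>/\<partial>t\<^sub>i\<close> in the commutator \<open>X Y - Y X\<close> is its value on the coordinate
  function \<open>t\<^sub>i\<close>, and \<open>Y t\<^sub>i = Y\<^sub>i\<close>.
\<close>

definition vf_bracket :: "vfield \<Rightarrow> vfield \<Rightarrow> vfield" where
  "vf_bracket X Y t = (\<chi> i. vf_apply X (\<lambda>s. Y s $ i) t - vf_apply Y (\<lambda>s. X s $ i) t)"

inductive_set lie_generated :: "vfield set \<Rightarrow> vfield set" for G :: "vfield set" where
  base: "X \<in> G \<Longrightarrow> X \<in> lie_generated G"
| zero: "(\<lambda>t. 0) \<in> lie_generated G"
| add: "X \<in> lie_generated G \<Longrightarrow> Y \<in> lie_generated G \<Longrightarrow> (\<lambda>t. X t + Y t) \<in> lie_generated G"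
| scale: "X \<in> lie_generated G \<Longrightarrow> (\<lambda>t. c *s X t) \<in> lie_generated G"
| bracket: "X \<in> lie_generated G \<Longrightarrow> Y \<in> lie_generated G \<Longrightarrow> vf_bracket X Y \<in> lie_generated G"

definition sl2 :: "(complex^2^2) set" where
  "sl2 = {A. trace A = 0}"

definition isomorphic_to_sl2 :: "vfield set \<Rightarrow> bool" where
  "isomorphic_to_sl2 L \<longleftrightarrow>
     (\<exists>\<phi>. bij_betw \<phi> L sl2 \<and>
       (\<forall>X\<in>L. \<forall>Y\<in>L. \<phi> (\<lambda>t. X t + Y t) = \<phi> X + \<phi> Y) \<and>
       (\<forall>c. \<forall>X\<in>L. \<phi> (\<lambda>t. c *s X t) = (\<chi> i j. c * \<phi> X $ i $ j)) \<and>
       (\<forall>X\<in>L. \<forall>Y\<in>L. \<phi> (vf_bracket X Y) = \<phi> X ** \<phi> Y - \<phi> Y ** \<phi> X))"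

definition vf_R\<^sub>2 :: vfield where
  "vf_R\<^sub>2 t = vector
     [1 / 8 * ((t $ 1)\<^sup>2 - (t $ 2)\<^sup>2),
      1 / 4 * (t $ 1 * t $ 2 - t $ 3),
      1 / 2 * (t $ 1 * t $ 3 - (t $ 2) ^ 3)]"

definition vf_H\<^sub>2 :: vfield where
  "vf_H\<^sub>2 t = vector [2 * t $ 1, 2 * t $ 2, 4 * t $ 3]"

definition vf_F\<^sub>2 :: vfield where
  "vf_F\<^sub>2 t = vector [- 8, 0, 0]"

end

theory Submission
  imports Defs
begin

text \<open>
  A form of weight $2n$ for $\Gamma_0(2)$ is handled through its expansions $F(q)$ at the cusp
  $\infty$ and $G(q^{1/2})$ at the cusp $0$, which are holomorphic on the unit disc and satisfy
  $F(e^{2\pi i(-1/\tau)}) = \tau^{2n} G(e^{\pi i \tau})$. In weight $0$ reduction theory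
  confines the values of $F$ and $G$ to the image of a compact disc, so the maximum principle
  makes them constant. The eta quotient $A = \eta(2\tau)^{16} / \eta(\tau)^8$ has weight $4$, a
  simple zero at $\infty$ and no zero elsewhere; subtracting a multiple of $Q_2^n$ and dividing
  by $A$ therefore lowers the weight by $4$, and all forms are polynomials in $Q_2$ and $A$. In
  particular a form of weight $4$ is determined by two coefficients, which yields $R_2 = Q_2^2 -
  128 A$, $\eta(\tau)^{16} / \eta(2\tau)^8 = Q_2^2 - 64 A$, $5 Q_2^2 = E_4(q) + 4 E_4(q^2)$ and
  Ramanujan's $12 E_2' = E_2^2 - E_4$; the system of differential equations is an algebraic
  consequence of these identities.

  The transformation of $E_2$ and $E_4$ under $\tau \mapsto -1/\tau$ comes from lattice sums and
  the Lipschitz formula (for $E_2$ with Eisenstein's summation), and that of $\eta^8$ follows by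
  logarithmic differentiation. For quasi-modular forms the top coefficient is a modular form of
  lower weight, and a multiple of a power of $P_2$ removes it.
\<close>

section \<open>Power series in $q$ and the Lipschitz formula\<close>

text \<open>Two functions on the disc carry a whole SL_2(Z)-orbit of forms: translation is built
  into the expansions, and inversion is the one relation between F and G. This stands in for the
  valence formula. Dividing by A rather than by Delta2 keeps the descent short: A vanishes only at
  infinity, so the single condition F(0) = 0 permits the division, and the weight falls by 4 instead
  of 8, which leaves weights 0 and 2 as base cases. Quotients and top coefficients can land in
  negative weight, so the weight is an integer from the outset. The form E6 never enters: R2 is
  differentiated as Q2^2 - 128 A, where the logarithmic derivative of A comes from the product, so
  that of Ramanujan's equations only the one for E2 occurs.\<close>

definition qser :: "(nat \<Rightarrow> complex) \<Rightarrow> complex \<Rightarrow> complex" where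
  "qser a w = suminf (\<lambda>n. a n * w ^ n)"

text \<open>The bound carries no constant factor because both families of coefficients in use, n^j
  and sigma_j(n) \<le> n^(j+1), satisfy it as it stands.\<close>

definition polynomially_bounded :: "(nat \<Rightarrow> complex) \<Rightarrow> bool" where
  "polynomially_bounded a \<longleftrightarrow> (\<exists>m. \<forall>n. norm (a n) \<le> real n ^ m)"

abbreviation ex :: "complex \<Rightarrow> complex" where
  "ex z \<equiv> exp (2 * of_real pi * \<i> * z)"

abbreviation sigma_series :: "nat \<Rightarrow> complex \<Rightarrow> complex" where
  "sigma_series j \<equiv> qser (\<lambda>n. of_nat (sigma j n))"

text \<open>For j > 0 this is the polylogarithm of order -j. For j = 0 the term n = 0 counts as 1,
  which makes it 1/(1 - w).\<close>

abbreviation power_series :: "nat \<Rightarrow> complex \<Rightarrow> complex" where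
  "power_series j \<equiv> qser (\<lambda>n. of_nat n ^ j)"

lemma qser_eval_fps: "qser a = eval_fps (Abs_fps a)"
  by (simp add: qser_def eval_fps_def fun_eq_iff)

lemma polynomially_bounded_conv_radius:
  assumes "polynomially_bounded a"
  shows "conv_radius a \<ge> 1"
proof -
  obtain m where m: "\<And>n. norm (a n) \<le> real n ^ m"
    using assms by (auto simp: polynomially_bounded_def)
  have "ereal 1 \<le> conv_radius a"
  proof (rule conv_radius_geI_ex)
    fix r :: real assume r: "0 < r" "ereal r < ereal 1"
    have "conv_radius (\<lambda>n. real n ^ m) = ereal 1"
    proof (rule conv_radius_ratio_limit_nonzero)
      have "(\<lambda>n. (real n / real (Suc n)) ^ m) \<longlonglongrightarrow> 1"
        using tendsto_power[OF LIMSEQ_n_over_Suc_n, of m] by simp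
      thus "(\<lambda>n. norm (real n ^ m) / norm (real (Suc n) ^ m)) \<longlonglongrightarrow> 1"
        by (simp add: power_divide norm_power)
    qed auto
    hence "summable (\<lambda>n. real n ^ m * r ^ n)"
      using r by (intro summable_in_conv_radius) auto
    hence "summable (\<lambda>n. norm (a n * of_real r ^ n))"
      by (rule summable_comparison_test') (use r m in \<open>auto simp: norm_mult norm_power intro!:
          mult_right_mono\<close>)
    thus "\<exists>z. norm z = r \<and> summable (\<lambda>n. a n * z ^ n)"
      using r by (intro exI[of _ "of_real r"]) (auto intro: summable_norm_cancel)
  qed
  thus ?thesis by (simp add: one_ereal_def)
qed

lemma polynomially_bounded_power: "polynomially_bounded (\<lambda>n. of_nat n ^ j)"
  by (auto simp: polynomially_bounded_def norm_power)

lemma sigma_0: "sigma j 0 = 0"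
  by (simp add: sigma_def)

lemma sigma_1: "sigma j 1 = 1"
  by (simp add: sigma_def)

lemma polynomially_bounded_sigma: "polynomially_bounded (\<lambda>n. of_nat (sigma j n))"
proof -
  have "sigma j n \<le> n ^ Suc j" for n
  proof (cases "n = 0")
    case False
    have "{d. d dvd n} \<subseteq> {1..n}"
      using False by (auto intro: dvd_imp_le Suc_leI dvd_pos_nat)
    hence "sigma j n \<le> (\<Sum>d\<in>{1..n}. d ^ j)"
      unfolding sigma_def by (intro sum_mono2) auto
    also have "\<dots> \<le> (\<Sum>d\<in>{1..n}. n ^ j)"
      by (intro sum_mono power_mono) auto
    finally show ?thesis by simp
  qed (simp add: sigma_0)
  thus ?thesis unfolding polynomially_bounded_def
    by (intro exI[of _ "Suc j"]) (metis norm_of_nat of_nat_le_iff of_nat_power)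
qed

context
  fixes a :: "nat \<Rightarrow> complex"
  assumes a: "polynomially_bounded a"
begin

lemma qser_radius: "norm w < 1 \<Longrightarrow> ereal (norm w) < fps_conv_radius (Abs_fps a)"
  using polynomially_bounded_conv_radius[OF a]
    less_le_trans[of "ereal (norm w)" 1 "conv_radius a"]
  by (auto simp: fps_conv_radius_def)

lemma qser_sums: "norm w < 1 \<Longrightarrow> (\<lambda>n. a n * w ^ n) sums qser a w"
  using sums_eval_fps[OF qser_radius] by (simp add: qser_eval_fps)

lemma qser_norm_summable: "norm w < 1 \<Longrightarrow> summable (\<lambda>n. norm (a n * w ^ n))"
  using norm_summable_fps[OF qser_radius] by simp

lemma qser_has_sum: "norm w < 1 \<Longrightarrow> ((\<lambda>n. a n * w ^ n) has_sum qser a w) UNIV"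
  using qser_norm_summable qser_sums by (intro norm_summable_imp_has_sum)

lemma qser_has_field_derivative:
  assumes "norm w < 1"
  shows "(qser a has_field_derivative eval_fps (fps_deriv (Abs_fps a)) w) (at w)"
  using has_field_derivative_eval_fps[OF qser_radius[OF assms]] by (simp add: qser_eval_fps)

lemma qser_holomorphic: "qser a holomorphic_on ball 0 1"
  using qser_has_field_derivative by (intro holomorphic_onI) (auto simp: field_differentiable_def
      intro: has_field_derivative_at_within)

lemma qser_deriv_0: "deriv (qser a) 0 = a 1"
  using DERIV_imp_deriv[OF qser_has_field_derivative[of 0]] by (simp add: eval_fps_at_0)

lemma qser_deriv:
  assumes "norm w < 1"
  shows "w * deriv (qser a) w = qser (\<lambda>n. of_nat n * a n) w"
proof -
  have "ereal (norm w) < fps_conv_radius (fps_deriv (Abs_fps a))"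
    using qser_radius[OF assms] fps_conv_radius_deriv[of "Abs_fps a"] by (rule less_le_trans)
  from sums_eval_fps[OF this] have "(\<lambda>n. of_nat (Suc n) * a (Suc n) * w ^ n) sums deriv (qser a) w"
    by (simp add: DERIV_imp_deriv[OF qser_has_field_derivative[OF assms]])
  hence "(\<lambda>n. w * (of_nat (Suc n) * a (Suc n) * w ^ n)) sums (w * deriv (qser a) w)"
    by (rule sums_mult)
  also have "(\<lambda>n. w * (of_nat (Suc n) * a (Suc n) * w ^ n)) = (\<lambda>n. (of_nat (Suc n) * a (Suc n))
      * w ^ Suc n)"
    by (simp add: mult_ac)
  finally have "(\<lambda>n. (of_nat n * a n) * w ^ n) sums (w * deriv (qser a) w)"
    by (subst (asm) sums_Suc_iff) simp
  thus ?thesis by (simp add: qser_def sums_iff)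
qed

end

lemma qser_at_0: "qser a 0 = a 0"
  by (simp add: qser_eval_fps eval_fps_at_0)

lemma norm_ex: "norm (ex z) = exp (- 2 * pi * Im z)"
  by simp

lemma norm_ex_less: "Im z > 0 \<Longrightarrow> norm (ex z) < 1"
  by simp

lemma qser_ex_has_field_derivative:
  assumes a: "polynomially_bounded a" and z: "Im z > 0"
  shows "((\<lambda>z. qser a (ex z)) has_field_derivative
           2 * of_real pi * \<i> * qser (\<lambda>n. of_nat n * a n) (ex z)) (at z)"
proof -
  have n: "norm (ex z) < 1" using z by simp
  have "((\<lambda>z. qser a (ex z)) has_field_derivative
           deriv (qser a) (ex z) * (ex z * (2 * of_real pi * \<i>))) (at z)"
    using qser_has_field_derivative[OF a n]
    by (auto intro!: DERIV_chain2[of "qser a"] derivative_eq_intros simp: DERIV_imp_deriv)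
  thus ?thesis using qser_deriv[OF a n] by (simp add: mult_ac)
qed

section \<open>Partial fractions of the cotangent and their derivatives\<close>

lemma not_nonpos_Ints: "Im z \<noteq> 0 \<Longrightarrow> z \<notin> \<int>\<^sub>\<le>\<^sub>0"
  by (auto elim!: nonpos_Ints_cases)

text \<open>The $\psi$-reflection formula is the partial fraction expansion of the cotangent, written
  in terms of $e^{2\pi i z}$; the Lipschitz formulas are its derivatives.\<close>

lemma Digamma_reflection:
  assumes z: "Im z > 0"
  shows "Digamma (1 - z) - Digamma z = of_real pi * \<i> * (1 - 2 * power_series 0 (ex z))"
proof -
  define w where "w = exp (\<i> * of_real pi * z)"
  have w2: "ex z = w ^ 2"
    by (simp add: w_def exp_double [symmetric] mult_ac)
  have w0: "w \<noteq> 0" by (simp add: w_def)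
  have n: "norm (w ^ 2) < 1" using z by (simp add: w2 [symmetric])
  hence n1: "w ^ 2 \<noteq> 1" by auto
  have sin: "sin (of_real pi * z) = (w - 1 / w) / (2 * \<i>)"
    unfolding sin_exp_eq by (simp add: w_def exp_minus field_simps)
  have cos: "cos (of_real pi * z) = (w + 1 / w) / 2"
    unfolding cos_exp_eq by (simp add: w_def exp_minus field_simps)
  have s0: "sin (of_real pi * z) \<noteq> 0"
    using n1 w0 unfolding sin by (simp add: field_simps power2_eq_square)
  have nz: "z \<notin> \<int>\<^sub>\<le>\<^sub>0" "1 - z \<notin> \<int>\<^sub>\<le>\<^sub>0"
    using z not_nonpos_Ints[of z] not_nonpos_Ints[of "1 - z"] by auto
  have G: "Gamma u * Gamma (1 - u) = of_real pi / sin (of_real pi * u)" for u :: complex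
    by (rule Gamma_reflection_complex)
  \<comment> \<open>Logarithmic differentiation of Euler's reflection formula gives pi cot(pi z),
    which in terms of w is pi i (w^2 + 1)/(w^2 - 1).\<close>
  have "((\<lambda>u. Gamma u * Gamma (1 - u)) has_field_derivative
           Gamma z * Gamma (1 - z) * (Digamma z - Digamma (1 - z))) (at z)"
    using nz by (auto intro!: derivative_eq_intros simp: algebra_simps)
  moreover have "((\<lambda>u. of_real pi / sin (of_real pi * u)) has_field_derivative
     - (of_real pi ^ 2 * cos (of_real pi * z) / sin (of_real pi * z) ^ 2)) (at z)"
    using s0 by (auto intro!: derivative_eq_intros simp: power2_eq_square)
  ultimately have eq: "of_real pi / sin (of_real pi * z) * (Digamma z - Digamma (1 - z)) =
       - (of_real pi ^ 2 * cos (of_real pi * z) / sin (of_real pi * z) ^ 2)"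
    unfolding G by (rule DERIV_unique)
  have "Digamma (1 - z) - Digamma z = - (sin (of_real pi * z) / of_real pi) *
          (of_real pi / sin (of_real pi * z) * (Digamma z - Digamma (1 - z)))"
    using s0 by (simp add: field_simps)
  also have "\<dots> = of_real pi * cos (of_real pi * z) / sin (of_real pi * z)"
    unfolding eq using s0 by (simp add: power2_eq_square)
  also have "\<dots> = of_real pi * \<i> * (1 - 2 * (1 / (1 - w ^ 2)))"
    using n1 w0 unfolding sin cos by (simp add: divide_simps power2_eq_square) (simp add:
        algebra_simps)
  also have "1 / (1 - w ^ 2) = power_series 0 (ex z)"
    using n by (simp add: qser_def w2 suminf_geometric)
  finally show ?thesis .
qed

lemma qser_power_ex_has_field_derivative:
  assumes "Im z > 0"
  shows "((\<lambda>z. power_series j (ex z)) has_field_derivative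
           2 * of_real pi * \<i> * power_series (Suc j) (ex z)) (at z)"
  using qser_ex_has_field_derivative[OF polynomially_bounded_power[of j] assms] by simp

text \<open>Each derivative brings one factor 2 pi i on the side of the q-series and one sign from
  the inner function 1 - z. The induction starts at j = 1 because the constant pi i in the Digamma
  formula disappears only on differentiation.\<close>

lemma Polygamma_reflection:
  assumes z: "Im z > 0" and j: "j > 0"
  shows "Polygamma j z - (-1) ^ j * Polygamma j (1 - z) =
           (2 * of_real pi * \<i>) ^ Suc j * power_series j (ex z)"
  using j z
proof (induction j arbitrary: z rule: nat_induct_non_zero)
  case 1
  have nz: "z \<notin> \<int>\<^sub>\<le>\<^sub>0" "1 - z \<notin> \<int>\<^sub>\<le>\<^sub>0"
    using 1 not_nonpos_Ints[of z] not_nonpos_Ints[of "1 - z"] by auto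
  have "((\<lambda>u. of_real pi * \<i> * (1 - 2 * power_series 0 (ex u))) has_field_derivative
          of_real pi * \<i> * (- 2 * (2 * of_real pi * \<i> * power_series (Suc 0) (ex z)))) (at z)"
    by (rule derivative_eq_intros qser_power_ex_has_field_derivative[OF 1] refl)+ simp
  hence "((\<lambda>u. Digamma (1 - u) - Digamma u) has_field_derivative
          of_real pi * \<i> * (- 2 * (2 * of_real pi * \<i> * power_series (Suc 0) (ex z)))) (at z)"
    by (rule has_field_derivative_transform_within_open[where S = "{z. Im z > 0}"])
       (use 1 Digamma_reflection in \<open>auto simp: open_halfspace_Im_gt\<close>)
  moreover have "((\<lambda>u. Digamma (1 - u) - Digamma u) has_field_derivative
          (- Polygamma 1 (1 - z) - Polygamma 1 z)) (at z)"
    using nz by (auto intro!: derivative_eq_intros)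
  ultimately have "of_real pi * \<i> * (- 2 * (2 * of_real pi * \<i> * power_series (Suc 0) (ex z))) =
     - Polygamma 1 (1 - z) - Polygamma 1 z"
    by (rule DERIV_unique)
  hence "Polygamma 1 z + Polygamma 1 (1 - z) =
     - (of_real pi * \<i> * (- 2 * (2 * of_real pi * \<i> * power_series (Suc 0) (ex z))))"
    by simp
  also have "\<dots> = (2 * of_real pi * \<i>) ^ Suc 1 * power_series 1 (ex z)"
    by (simp add: algebra_simps)
  finally show ?case by simp
next
  case (Suc j)
  have nz: "z \<notin> \<int>\<^sub>\<le>\<^sub>0" "1 - z \<notin> \<int>\<^sub>\<le>\<^sub>0"
    using Suc.prems not_nonpos_Ints[of z] not_nonpos_Ints[of "1 - z"] by auto
  have "((\<lambda>u. (2 * of_real pi * \<i>) ^ Suc j * power_series j (ex u)) has_field_derivative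
          (2 * of_real pi * \<i>) ^ Suc j * (2 * of_real pi * \<i> * power_series (Suc j) (ex z))) (at z)"
    by (rule DERIV_cmult qser_power_ex_has_field_derivative[OF Suc.prems])+
  hence "((\<lambda>u. Polygamma j u - (-1) ^ j * Polygamma j (1 - u)) has_field_derivative
          (2 * of_real pi * \<i>) ^ Suc j * (2 * of_real pi * \<i> * power_series (Suc j) (ex z))) (at z)"
    by (rule has_field_derivative_transform_within_open[where S = "{z. Im z > 0}"])
       (use Suc in \<open>auto simp: open_halfspace_Im_gt\<close>)
  moreover have "((\<lambda>u. Polygamma j u - (-1) ^ j * Polygamma j (1 - u)) has_field_derivative
          (Polygamma (Suc j) z - (-1) ^ j * (- Polygamma (Suc j) (1 - z)))) (at z)"
    using nz by (auto intro!: derivative_eq_intros)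
  ultimately have "(2 * of_real pi * \<i>) ^ Suc j * (2 * of_real pi * \<i> * power_series (Suc j) (ex z)) =
     Polygamma (Suc j) z - (-1) ^ j * (- Polygamma (Suc j) (1 - z))"
    by (rule DERIV_unique)
  thus ?case by (simp add: mult_ac)
qed

lemma summable_inverse_power_shift:
  assumes z: "z \<noteq> (0::complex)" and "j > 0"
  shows "summable (\<lambda>k. norm (inverse ((z + of_nat k) ^ Suc j)))"
proof (rule summable_comparison_test_ev)
  show "summable (\<lambda>k. 2 ^ Suc j * inverse (real k ^ Suc j))"
    using assms inverse_power_summable[of "Suc j", where ?'a = real] by (intro summable_mult) auto
  show "\<forall>\<^sub>F k in sequentially. norm (norm (inverse ((z + of_nat k) ^ Suc j))) \<le>
      2 ^ Suc j * inverse (real k ^ Suc j)"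
    using eventually_ge_at_top[of "nat \<lceil>2 * norm z\<rceil>"] eventually_gt_at_top[of 0]
  proof eventually_elim
    case (elim k)
    hence "2 * norm z \<le> real k" by linarith
    hence "norm (z + of_nat k) \<ge> real k / 2"
      using norm_diff_ineq[of "of_nat k" z] by (simp add: add_ac)
    hence "(real k / 2) ^ Suc j \<le> norm (z + of_nat k) ^ Suc j"
      by (intro power_mono) auto
    hence "inverse (norm (z + of_nat k) ^ Suc j) \<le> inverse ((real k / 2) ^ Suc j)"
      using elim by (intro le_imp_inverse_le) auto
    thus ?case by (simp add: norm_inverse norm_power norm_divide power_divide field_simps del:
        power_Suc)
  qed
qed

lemma Polygamma_has_sum:
  assumes z: "z \<noteq> (0::complex)" and j: "j > 0"
  shows "((\<lambda>k. inverse ((z + of_nat k) ^ Suc j)) has_sum ((-1) ^ Suc j * Polygamma j z / fact j))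
      UNIV"
  by (intro norm_summable_imp_has_sum summable_inverse_power_shift Polygamma_LIMSEQ assms)

text \<open>The integers n \<ge> 0 give a Polygamma series at z; the substitution n = -k - 1 turns
  the negative ones into a Polygamma series at 1 - z. For odd j the exponent is even, so the change
  of sign in the base is harmless, and the reflection formula adds the two halves.\<close>

theorem Lipschitz_formula:
  assumes z: "Im z > 0" and j: "odd j"
  shows "((\<lambda>n::int. inverse ((z + of_int n) ^ Suc j)) has_sum
           ((2 * of_real pi * \<i>) ^ Suc j / fact j * power_series j (ex z))) UNIV"
proof -
  have j0: "j > 0" using j by (cases j) auto
  have z0: "z \<noteq> 0" "1 - z \<noteq> 0" using z by (auto simp: complex_eq_iff)
  have "((\<lambda>k. inverse ((z + of_nat k) ^ Suc j)) has_sum (Polygamma j z / fact j)) (UNIV :: nat set)"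
    using Polygamma_has_sum[OF z0(1) j0] j by simp
  hence 1: "((\<lambda>n::int. inverse ((z + of_int n) ^ Suc j)) has_sum (Polygamma j z / fact j)) {0..}"
    by (subst (asm) has_sum_reindex_bij_witness[of _ nat int "{0..}"]) auto
  have "((\<lambda>k. inverse ((1 - z + of_nat k) ^ Suc j)) has_sum (Polygamma j (1 - z) / fact j))
      (UNIV :: nat set)"
    using Polygamma_has_sum[OF z0(2) j0] j by simp
  moreover have "(1 - z + of_nat k) ^ Suc j = (z + of_int (- int k - 1)) ^ Suc j" for k
    using power_minus_even[of "Suc j" "1 - z + of_nat k"] j by (simp add: algebra_simps del:
        power_Suc)
  ultimately have 2: "((\<lambda>n::int. inverse ((z + of_int n) ^ Suc j))
      has_sum (Polygamma j (1 - z) / fact j)) {..<0}"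
    by (subst (asm) has_sum_reindex_bij_witness[of _ "\<lambda>n. nat (- n - 1)" "\<lambda>k. - int k - 1"
        "{..<0}"]) auto
  have "((\<lambda>n::int. inverse ((z + of_int n) ^ Suc j)) has_sum
           (Polygamma j z / fact j + Polygamma j (1 - z) / fact j)) ({0..} \<union> {..<0})"
    by (intro has_sum_Un_disjoint 1 2) auto
  also have "{0..} \<union> {..<0::int} = UNIV" by auto
  also have "Polygamma j z / fact j + Polygamma j (1 - z) / fact j =
      (2 * of_real pi * \<i>) ^ Suc j / fact j * power_series j (ex z)"
    using Polygamma_reflection[OF z j0] j by (simp add: add_divide_distrib [symmetric] del: power_Suc)
  finally show ?thesis .
qed

section \<open>Lattice sums and the inversion of $E_2$ and $E_4$\<close>

lemma has_sum_diff_complex: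
  fixes f g :: "'a \<Rightarrow> complex"
  shows "(f has_sum a) A \<Longrightarrow> (g has_sum b) A \<Longrightarrow> ((\<lambda>x. f x - g x) has_sum (a - b)) A"
  using has_sum_add[where f = f and g = "\<lambda>x. - g x" and a = a and b = "- b" and A = A]
  by (simp add: has_sum_uminus)

lemma has_sum_finite_sum:
  fixes f :: "'a \<Rightarrow> 'b \<Rightarrow> complex"
  assumes "finite I" "\<And>i. i \<in> I \<Longrightarrow> (f i has_sum s i) A"
  shows "((\<lambda>x. \<Sum>i\<in>I. f i x) has_sum (\<Sum>i\<in>I. s i)) A"
  using assms by (induction rule: finite_induct) (auto intro!: has_sum_add)

text \<open>The range from 1 - N to N is lopsided on purpose: terms of the shape g(n - 1) - g(n)
  then telescope to the symmetric difference g(-N) - g(N).\<close>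

lemma has_sum_int_LIMSEQ:
  fixes f :: "int \<Rightarrow> complex"
  assumes "(f has_sum S) UNIV"
  shows "(\<lambda>N. \<Sum>n\<in>{1 - int N..int N}. f n) \<longlonglongrightarrow> S"
proof -
  have "filterlim (\<lambda>N. {1 - int N..int N}) (finite_subsets_at_top UNIV) sequentially"
    unfolding filterlim_finite_subsets_at_top
  proof (intro allI impI)
    fix X :: "int set" assume "finite X \<and> X \<subseteq> UNIV"
    hence "bdd_above (abs ` X)"
      by (intro bdd_above_finite) auto
    then obtain B where B: "\<And>x. x \<in> X \<Longrightarrow> \<bar>x\<bar> \<le> B"
      by (auto simp: bdd_above_def)
    show "\<forall>\<^sub>F N in sequentially. finite {1 - int N..int N} \<and> X \<subseteq> {1 - int N..int N} \<and>
        {1 - int N..int N} \<subseteq> UNIV"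
      using eventually_ge_at_top[of "nat (B + 1)"] by eventually_elim (use B in force)
  qed
  with assms show ?thesis
    unfolding has_sum_def by (rule filterlim_compose)
qed

lemma has_sum_int_pos_iff:
  "(f has_sum S) {1::int..} \<longleftrightarrow> ((\<lambda>k::nat. f (int k + 1)) has_sum S) UNIV"
  by (rule has_sum_reindex_bij_witness[of _ "\<lambda>k. int k + 1" "\<lambda>n. nat (n - 1)"]) auto

lemma has_sum_int_even:
  fixes f :: "int \<Rightarrow> complex"
  assumes S: "(f has_sum S) {1..}" and even: "\<And>n. f (- n) = f n"
  shows "(f has_sum (f 0 + 2 * S)) UNIV" "(f has_sum (2 * S)) (- {0})"
proof -
  have "(f has_sum S) {..-1}"
    using S even by (subst has_sum_reindex_bij_witness[of _ uminus uminus "{1..}" f]) auto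
  with S have "(f has_sum (S + S)) ({1..} \<union> {..-1})"
    by (intro has_sum_Un_disjoint) auto
  also have "{1..} \<union> {..-1} = - {0::int}"
    by auto
  finally show *: "(f has_sum (2 * S)) (- {0})"
    by simp
  have "insert 0 (- {0::int}) = UNIV"
    by auto
  with has_sum_insert[OF _ *, of 0] show "(f has_sum (f 0 + 2 * S)) UNIV"
    by simp
qed

lemma has_sum_remove:
  fixes f :: "'a \<Rightarrow> complex"
  assumes "(f has_sum S) UNIV"
  shows "(f has_sum (S - f x)) (- {x})"
proof -
  have "f summable_on (- {x})"
    using has_sum_imp_summable[OF assms] by (rule summable_on_subset_banach) auto
  then obtain T where T: "(f has_sum T) (- {x})"
    by (auto simp: summable_on_def)
  have "insert x (- {x}) = UNIV"
    by auto
  with has_sum_insert[OF _ T, of x] have "(f has_sum (f x + T)) UNIV"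
    by simp
  from has_sum_unique[OF this assms] T show ?thesis
    by auto
qed

text \<open>The imaginary part of the lattice point controls m and thereby n; as one of them is at
  least 1 in absolute value, 1 is controlled as well. The product on the left is what later splits
  the double series into two single ones.\<close>

lemma lattice_norm_bound:
  assumes "Im \<tau> > 0"
  obtains K where "K > 0"
    "\<And>m n :: int. (m, n) \<noteq> (0, 0) \<Longrightarrow>
       real_of_int ((1 + \<bar>m\<bar>) * (1 + \<bar>n\<bar>)) \<le> K * norm (of_int m * \<tau> + of_int n) ^ 2"
proof
  define C where "C = 1 / Im \<tau> + 1 + norm \<tau> / Im \<tau>"
  have C: "C > 0"
    using assms by (auto simp: C_def intro!: add_pos_nonneg)
  show "4 * C ^ 2 > 0" using C by simp
  fix m n :: int assume mn: "(m, n) \<noteq> (0, 0)"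
  define z where "z = of_int m * \<tau> + of_int n"
  have m: "\<bar>m\<bar> * Im \<tau> \<le> norm z"
    using abs_Im_le_cmod[of z] assms by (simp add: z_def abs_mult)
  hence "\<bar>m\<bar> \<le> norm z / Im \<tau>"
    using assms by (simp add: field_simps)
  also have "\<dots> \<le> C * norm z"
    using assms by (simp add: C_def algebra_simps)
  finally have m': "\<bar>m\<bar> \<le> C * norm z" .
  have "\<bar>of_int n\<bar> = norm (z - of_int m * \<tau>)"
    by (simp add: z_def)
  also have "\<dots> \<le> norm z + \<bar>m\<bar> * norm \<tau>"
    using norm_triangle_ineq4[of z "of_int m * \<tau>"] by (simp add: norm_mult)
  also have "\<bar>m\<bar> * norm \<tau> \<le> (norm z / Im \<tau>) * norm \<tau>"
    using m assms by (intro mult_right_mono) (auto simp: field_simps)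
  also have "norm z + norm z / Im \<tau> * norm \<tau> \<le> C * norm z"
    using assms by (simp add: C_def algebra_simps)
  finally have n': "\<bar>n\<bar> \<le> C * norm z" by simp
  from mn have "1 \<le> \<bar>m\<bar> \<or> 1 \<le> \<bar>n\<bar>" by auto
  hence "1 \<le> C * norm z" using m' n' by linarith
  hence "1 + \<bar>real_of_int m\<bar> \<le> 2 * C * norm z" "1 + \<bar>real_of_int n\<bar> \<le> 2 * C * norm z"
    using m' n' by linarith+
  hence "(1 + \<bar>real_of_int m\<bar>) * (1 + \<bar>real_of_int n\<bar>) \<le> (2 * C * norm z) * (2 * C * norm z)"
    by (intro mult_mono) auto
  thus "real_of_int ((1 + \<bar>m\<bar>) * (1 + \<bar>n\<bar>)) \<le> 4 * C ^ 2 * norm (of_int m * \<tau> + of_int n) ^ 2"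
    by (simp add: z_def power2_eq_square mult_ac)
qed

lemma summable_on_int_powr:
  assumes "s < -1"
  shows "(\<lambda>n::int. (1 + \<bar>real_of_int n\<bar>) powr s) summable_on UNIV"
proof -
  have "summable (\<lambda>n. real n powr s)"
    using assms by (simp add: summable_real_powr_iff)
  hence "summable (\<lambda>n. (1 + real n) powr s)"
    by (subst (asm) summable_Suc_iff [symmetric]) (simp add: add_ac)
  hence nat: "(\<lambda>n. (1 + real n) powr s) summable_on UNIV"
    by (intro summable_nonneg_imp_summable_on) auto
  have "(\<lambda>n::int. (1 + \<bar>real_of_int n\<bar>) powr s) summable_on {0..}"
    by (rule summable_on_reindex_bij_witness[of _ int nat, THEN iffD2, OF _ _ _ _ _ nat]) auto
  moreover have "(\<lambda>n::int. (1 + \<bar>real_of_int n\<bar>) powr s) summable_on {..0}"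
    by (rule summable_on_reindex_bij_witness[of _ "\<lambda>n. - int n"
        "\<lambda>n. nat (-n)", THEN iffD2, OF _ _ _ _ _ nat]) auto
  ultimately have "(\<lambda>n::int. (1 + \<bar>real_of_int n\<bar>) powr s) summable_on ({0..} \<union> {..0})"
    by (rule summable_on_union)
  also have "{0..} \<union> {..0} = (UNIV :: int set)" by auto
  finally show ?thesis .
qed

lemma lattice_abs_summable:
  assumes \<tau>: "Im \<tau> > 0" and k: "k \<ge> 3"
  shows "(\<lambda>(m, n). inverse (norm (of_int m * \<tau> + of_int n) ^ k))
      summable_on (UNIV :: (int \<times> int) set)"
proof -
  obtain K where K: "K > 0" "\<And>m n :: int. (m, n) \<noteq> (0, 0) \<Longrightarrow>
       real_of_int ((1 + \<bar>m\<bar>) * (1 + \<bar>n\<bar>)) \<le> K * norm (of_int m * \<tau> + of_int n) ^ 2"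
    using lattice_norm_bound[OF \<tau>] by blast
  \<comment> \<open>Raising the lattice bound to the power -k/2 distributes this exponent to each of
    the two factors, and a single series converges for exponents below -1.\<close>
  define s where "s = - (real k / 2)"
  have s: "s < -1" using k by (simp add: s_def)
  define g where "g = (\<lambda>n::int. (1 + \<bar>real_of_int n\<bar>) powr s)"
  have g: "(g has_sum infsum g UNIV) UNIV"
    using summable_on_int_powr[OF s] by (simp add: g_def)
  have "(\<lambda>(m, n). g m * g n) summable_on (UNIV \<times> UNIV)"
    by (rule summable_on_SigmaI[where g = "\<lambda>m. g m * infsum g UNIV"])
       (use g in \<open>auto simp: g_def intro!: has_sum_cmult_right summable_on_cmult_left
           summable_on_int_powr s\<close>)
  hence *: "(\<lambda>x. K powr (- s) * (case x of (m, n) \<Rightarrow> g m * g n)) summable_on UNIV"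
    by (intro summable_on_cmult_right) simp
  show ?thesis
  proof (rule summable_on_comparison_test[OF *])
    fix x :: "int \<times> int"
    obtain m n where x: "x = (m, n)" by force
    have "inverse (norm (of_int m * \<tau> + of_int n) ^ k) \<le> K powr (- s) * (g m * g n)"
    proof (cases "(m, n) = (0, 0)")
      case True
      thus ?thesis using K k by (simp add: g_def power_0_left)
    next
      case False
      define r where "r = norm (of_int m * \<tau> + of_int n)"
      have le: "(1 + \<bar>real_of_int m\<bar>) * (1 + \<bar>real_of_int n\<bar>) \<le> K * r ^ 2"
        using K(2)[OF False] by (simp add: r_def)
      have "0 < (1 + \<bar>real_of_int m\<bar>) * (1 + \<bar>real_of_int n\<bar>)"
        by (intro mult_pos_pos) auto
      hence "0 < K * r ^ 2" using le by linarith
      hence r: "r > 0" using K(1) by (simp add: r_def zero_less_mult_iff) 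
      have "(K * r ^ 2) powr s \<le> ((1 + \<bar>real_of_int m\<bar>) * (1 + \<bar>real_of_int n\<bar>)) powr s"
        using s le by (intro powr_mono2') (auto intro!: mult_pos_pos)
      also have "\<dots> = g m * g n"
        by (simp add: g_def powr_mult)
      also have "(K * r ^ 2) powr s = K powr s * inverse (r ^ k)"
      proof -
        have "(r ^ 2) powr s = (r powr real 2) powr s"
          using r by (simp only: powr_realpow)
        also have "\<dots> = r powr (- real k)"
          by (simp only: powr_powr) (simp add: s_def)
        also have "\<dots> = inverse (r ^ k)"
          using r by (simp add: powr_minus powr_realpow)
        finally show ?thesis by (simp add: powr_mult)
      qed
      finally have "K powr (-s) * (K powr s * inverse (r ^ k)) \<le> K powr (-s) * (g m * g n)"
        by (intro mult_left_mono) auto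
      moreover have "K powr (-s) * K powr s = 1"
        using K(1) by (simp add: powr_minus)
      hence "K powr (-s) * (K powr s * inverse (r ^ k)) = inverse (r ^ k)"
        by (simp only: mult.assoc [symmetric] mult_1_left)
      ultimately show ?thesis by (simp only: r_def)
    qed
    thus "(case x of (m, n) \<Rightarrow> inverse (norm (of_int m * \<tau> + of_int n) ^ k)) \<le>
        K powr (- s) * (case x of (m, n) \<Rightarrow> g m * g n)"
      by (simp add: x)
  qed auto
qed

section \<open>Lambert series\<close>

text \<open>A pair (m, d) of positive integers is the same as a number N = m d together with a
  divisor d of it; collecting the terms with equal N produces the divisor sums.\<close>

lemma Lambert_pairs_has_sum:
  assumes q: "norm q < 1"
  shows "((\<lambda>(m::nat, d::nat). of_nat d ^ j * (q ^ m) ^ d) has_sum sigma_series j q) ({1..} \<times> {1..})"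
proof -
  define f where "f = (\<lambda>(N::nat, d::nat). of_nat d ^ j * q ^ N)"
  have sum1: "((\<lambda>n. of_nat (sigma j n) * q ^ n) has_sum sigma_series j q) {1..}"
    using qser_has_sum[OF polynomially_bounded_sigma q]
    by (rule has_sum_cong_neutral[THEN iffD1, rotated -1]) (auto simp: sigma_0 not_le)
  have inner: "((\<lambda>d. f (N, d)) has_sum (of_nat (sigma j N) * q ^ N)) {d. d dvd N}" if "N \<in> {1..}"
      for N
    using that by (intro has_sum_finiteI) (auto simp: f_def sigma_def sum_distrib_right)
  have "(\<lambda>x. norm (f x)) summable_on Sigma {1..} (\<lambda>N. {d. d dvd N})"
  proof (rule summable_on_SigmaI)
    show "((\<lambda>d. norm (f (N, d))) has_sum (real (sigma j N) * norm q ^ N)) {d. d dvd N}"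
        if "N \<in> {1..}" for N
      using that by (intro has_sum_finiteI) (auto simp: f_def sigma_def sum_distrib_right
          norm_mult norm_power)
    show "(\<lambda>N. real (sigma j N) * norm q ^ N) summable_on {1..}"
      using qser_norm_summable[OF polynomially_bounded_sigma q]
      by (intro summable_on_subset_banach[OF norm_summable_imp_summable_on[of "\<lambda>N. real (sigma j
          N) * norm q ^ N"]])
         (auto simp: norm_mult norm_power)
  qed auto
  hence "f summable_on Sigma {1..} (\<lambda>N. {d. d dvd N})"
    by (rule abs_summable_summable)
  hence "(f has_sum sigma_series j q) (Sigma {1..} (\<lambda>N. {d. d dvd N}))"
    by (intro has_sum_SigmaI[OF inner sum1]) auto
  also have "?this \<longleftrightarrow> ((\<lambda>(m, d). of_nat d ^ j * (q ^ m) ^ d) has_sum sigma_series j q) ({1..} \<times> {1..})"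
    by (rule has_sum_reindex_bij_witness[of _ "\<lambda>(m, d). (m * d, d)" "\<lambda>(N, d). (N div d, d)"])
       (auto simp: f_def power_mult [symmetric] mult_ac Suc_le_eq intro: dvd_pos_nat elim!: dvdE)
  finally show ?thesis .
qed

lemma Lambert_has_sum:
  assumes q: "norm q < 1" and "j > 0"
  shows "((\<lambda>m::nat. power_series j (q ^ m)) has_sum sigma_series j q) {1..}"
  using Lambert_pairs_has_sum[OF q, of j]
proof (rule has_sum_SigmaD)
  fix m :: nat assume "m \<in> {1..}"
  hence "norm (q ^ m) < 1"
    using q by (simp add: norm_power power_less_one_iff)
  from qser_has_sum[OF polynomially_bounded_power this]
  have "((\<lambda>d. of_nat d ^ j * (q ^ m) ^ d) has_sum power_series j (q ^ m)) {1..}"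
    by (rule has_sum_cong_neutral[THEN iffD1, rotated -1]) (use \<open>j > 0\<close> in \<open>auto simp: not_le\<close>)
  thus "((\<lambda>d. case (m, d) of (m, d) \<Rightarrow> of_nat d ^ j * (q ^ m) ^ d) has_sum power_series j (q ^ m))
      {1..}"
    by simp
qed

text \<open>Summing over m first leaves a geometric series for each d. This is the shape in which
  the series arises as the logarithmic derivative of the Euler product.\<close>

lemma Lambert_swapped_has_sum:
  assumes q: "norm q < 1"
  shows "((\<lambda>d::nat. of_nat d ^ j * (q ^ d / (1 - q ^ d))) has_sum sigma_series j q) {1..}"
proof -
  have "((\<lambda>(d::nat, m::nat). of_nat d ^ j * (q ^ m) ^ d) has_sum sigma_series j q) ({1..} \<times> {1..})"
    using Lambert_pairs_has_sum[OF q, of j] by (subst (asm) has_sum_swap) simp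
  thus ?thesis
  proof (rule has_sum_SigmaD)
    fix d :: nat assume "d \<in> {1..}"
    hence "norm (q ^ d) < 1"
      using q by (simp add: norm_power power_less_one_iff)
    from has_sum_cmult_right[OF has_sum_geometric_from_1[OF this], of "of_nat d ^ j"]
    show "((\<lambda>m. case (d, m) of (d, m) \<Rightarrow> of_nat d ^ j * (q ^ m) ^ d) has_sum (of_nat d ^ j * (q ^ d
        / (1 - q ^ d)))) {1..}"
      by (simp add: power_mult [symmetric] mult.commute)
  qed
qed

lemma E2_conv_qser:
  assumes "norm q < 1"
  shows "E2 q = 1 - 24 * sigma_series 1 q"
proof -
  have "(\<lambda>n. of_nat (sigma 1 (Suc n)) * q ^ Suc n) sums sigma_series 1 q"
    using qser_sums[OF polynomially_bounded_sigma assms] by (subst sums_Suc_iff) (simp add: sigma_0)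
  thus ?thesis
    by (simp add: E2_def sums_iff)
qed

lemma E4_conv_qser:
  assumes "norm q < 1"
  shows "E4 q = 1 + 240 * sigma_series 3 q"
proof -
  have "(\<lambda>n. of_nat (sigma 3 (Suc n)) * q ^ Suc n) sums sigma_series 3 q"
    using qser_sums[OF polynomially_bounded_sigma assms] by (subst sums_Suc_iff) (simp add: sigma_0)
  thus ?thesis
    by (simp add: E4_def sums_iff)
qed

lemma ex_mult_nat: "ex (of_nat m * \<tau>) = ex \<tau> ^ m"
  by (simp add: exp_of_nat_mult [symmetric] mult_ac)

text \<open>The value Z at m = 0 is left free: it stands for the row m = 0 of a lattice sum, to
  which the Lipschitz formula does not apply.\<close>

lemma Lambert_ex_has_sum:
  assumes \<tau>: "Im \<tau> > 0" and j: "j > 0"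
  shows "((\<lambda>m::int. if m = 0 then Z else power_series j (ex (of_int \<bar>m\<bar> * \<tau>))) has_sum
           (Z + 2 * sigma_series j (ex \<tau>))) UNIV" (is "(?f has_sum _) _")
proof -
  have "((\<lambda>m::nat. power_series j (ex \<tau> ^ m)) has_sum sigma_series j (ex \<tau>)) {1..}"
    using Lambert_has_sum[OF norm_ex_less[OF \<tau>] j] .
  also have "?this \<longleftrightarrow> (?f has_sum sigma_series j (ex \<tau>)) {1..}"
    by (rule has_sum_reindex_bij_witness[of _ nat int]) (auto simp flip: ex_mult_nat)
  finally show ?thesis
    using has_sum_int_even(1)[of ?f] by auto
qed

lemma Lipschitz_formula_multiple:
  assumes \<tau>: "Im \<tau> > 0" and m: "m \<noteq> 0" and j: "odd j"
  shows "((\<lambda>n::int. inverse ((of_int m * \<tau> + of_int n) ^ Suc j)) has_sum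
     ((2 * of_real pi * \<i>) ^ Suc j / fact j * power_series j (ex (of_int \<bar>m\<bar> * \<tau>)))) UNIV"
proof -
  have *: "((\<lambda>n::int. inverse ((of_int \<bar>m\<bar> * \<tau> + of_int n) ^ Suc j)) has_sum
     ((2 * of_real pi * \<i>) ^ Suc j / fact j * power_series j (ex (of_int \<bar>m\<bar> * \<tau>)))) UNIV"
    using \<tau> m by (intro Lipschitz_formula j) auto
  show ?thesis
  proof (cases "m > 0")
    case False
    have "(of_int m * \<tau> + of_int n) ^ Suc j = (of_int \<bar>m\<bar> * \<tau> + of_int (- n)) ^ Suc j" for n
      using power_minus_even[of "Suc j" "of_int m * \<tau> + of_int n"]
          j False by (simp add: algebra_simps del: power_Suc)
    with * show ?thesis
      by (subst has_sum_reindex_bij_witness[of _ uminus uminus UNIV]) auto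
  qed (use * in simp)
qed

text \<open>Throughout, the lattice point $(0, 0)$ contributes $0$ because \<open>inverse 0 = 0\<close>.
  The constant $C$ is $90\,\zeta(4)/\pi^4$; that it equals $1$ comes out below, when the constant
  terms of a form of weight $4$ at the two cusps are compared.\<close>

lemma weight_4_Eisenstein_inversion:
  obtains C where "\<And>\<tau>. Im \<tau> > 0 \<Longrightarrow>
    C + 240 * sigma_series 3 (ex (- 1 / \<tau>)) =
    \<tau> ^ 4 * (C + 240 * sigma_series 3 (ex \<tau>))"
proof -
  define f where "f = (\<lambda>\<tau>. \<lambda>(m::int, n::int). inverse ((of_int m * \<tau> + of_int n :: complex) ^ 4))"
  define c where "c = (2 * of_real pi * \<i>) ^ 4 / fact 3"
  define Z where "Z = infsum (\<lambda>n::int. inverse (of_int n ^ 4) :: complex) UNIV"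
  have c0: "c \<noteq> 0" by (simp add: c_def)
  have summable: "f \<tau> summable_on UNIV" if "Im \<tau> > 0" for \<tau>
    by (rule abs_summable_summable) 
       (use lattice_abs_summable[OF that, of 4] in \<open>simp add: f_def case_prod_unfold norm_inverse
           norm_power\<close>)
  have G: "(f \<tau> has_sum (Z + 2 * c * sigma_series 3 (ex \<tau>))) UNIV" if \<tau>: "Im \<tau> > 0" for \<tau>
  proof -
    have "(f \<tau> has_sum (c * (Z / c + 2 * sigma_series 3 (ex \<tau>)))) (UNIV \<times> UNIV)"
    proof (rule has_sum_SigmaI)
      show "((\<lambda>m. c * (if m = 0 then Z / c else power_series 3 (ex (of_int \<bar>m\<bar> * \<tau>)))) has_sum
               (c * (Z / c + 2 * sigma_series 3 (ex \<tau>)))) UNIV"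
        by (intro has_sum_cmult_right Lambert_ex_has_sum \<tau>) auto
      fix m :: int
      have "(\<lambda>n. f \<tau> (0, n)) summable_on UNIV"
        using summable_on_SigmaD1[of "\<lambda>m n. f \<tau> (m, n)" UNIV "\<lambda>_. UNIV" 0] summable[OF \<tau>] by simp
      hence "((\<lambda>n. f \<tau> (0, n)) has_sum Z) UNIV"
        by (simp add: f_def Z_def)
      thus "((\<lambda>n. f \<tau> (m, n)) has_sum (c * (if m = 0 then Z / c else power_series 3 (ex (of_int
          \<bar>m\<bar> * \<tau>))))) UNIV"
        using Lipschitz_formula_multiple[OF \<tau>, of m 3] c0 by (cases "m = 0") (auto simp: f_def c_def)
    qed (use summable[OF \<tau>] in simp)
    thus ?thesis using c0 by (simp add: algebra_simps)
  qed
  have *: "Z + 2 * c * sigma_series 3 (ex (- 1 / \<tau>)) =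
      \<tau> ^ 4 * (Z + 2 * c * sigma_series 3 (ex \<tau>))" if \<tau>: "Im \<tau> > 0" for \<tau>
  proof -
    have [simp]: "\<tau> \<noteq> 0" using \<tau> by auto
    have \<tau>': "Im (- 1 / \<tau>) > 0" using \<tau> by (simp add: Im_divide')
    \<comment> \<open>Inversion divides the lattice by \<tau> and permutes the coordinates by (m, n)
      -> (n, -m).\<close>
    have "f (- 1 / \<tau>) (m, n) = \<tau> ^ 4 * f \<tau> (n, - m)" for m n
    proof -
      have "of_int m * (- 1 / \<tau>) + of_int n = (of_int n * \<tau> + of_int (- m)) / \<tau>"
        by (simp add: field_simps)
      thus ?thesis by (simp only: f_def case_prod_conv) (simp add: power_divide field_simps)
    qed
    hence "(f (- 1 / \<tau>) has_sum (\<tau> ^ 4 * (Z + 2 * c * sigma_series 3 (ex \<tau>)))) UNIV"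
      by (subst has_sum_reindex_bij_witness[where T = UNIV and i = "\<lambda>(n, m). (- m, n)" and j =
          "\<lambda>(m, n). (n, - m)"
           and h = "\<lambda>x. \<tau> ^ 4 * f \<tau> x"])
         (auto intro!: has_sum_cmult_right G \<tau>)
    thus ?thesis
      using G[OF \<tau>'] by (rule has_sum_unique[symmetric])
  qed
  \<comment> \<open>Multiplying by 120/c normalises the coefficient of the divisor series to 240;
    with Z = 2 zeta(4) and c = 8 pi^4/3 the constant is the one announced above.\<close>
  show ?thesis
  proof (rule that[of "120 * Z / c"])
    fix \<tau> :: complex assume "Im \<tau> > 0"
    from arg_cong[OF *[OF this], of "\<lambda>x. 120 / c * x"] c0
    show "120 * Z / c + 240 * sigma_series 3 (ex (- 1 / \<tau>)) =
         \<tau> ^ 4 * (120 * Z / c + 240 * sigma_series 3 (ex \<tau>))"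
      by (simp add: field_simps)
  qed
qed

lemma inverse_shift_LIMSEQ: "(\<lambda>N. inverse (v + of_nat N) :: complex) \<longlonglongrightarrow> 0"
  by (intro filterlim_compose[OF tendsto_inverse_0] tendsto_add_filterlim_at_infinity[OF
      tendsto_const] tendsto_of_nat)

text \<open>Each term equals 1/((w + n - 1)(w + n)) and is dominated by the squares of its two
  factors, which the Lipschitz formula sums. Once absolute convergence is known, the value is the
  limit of the telescoping partial sums.\<close>

lemma telescoping_has_sum_int:
  assumes w: "Im w \<noteq> 0"
  shows "((\<lambda>n::int. inverse (w + of_int n - 1) - inverse (w + of_int n)) has_sum 0) UNIV"
proof -
  have summ: "(\<lambda>n::int. inverse ((v + of_int n) ^ Suc 1)) summable_on UNIV" if "Im v \<noteq> 0" for v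
  proof (cases "Im v > 0")
    case True
    thus ?thesis using Lipschitz_formula[of v 1] by (auto simp: summable_on_def)
  next
    case False
    hence "(\<lambda>n::int. inverse ((- v + of_int n) ^ Suc 1)) summable_on UNIV"
      using that Lipschitz_formula[of "- v" 1] by (auto simp: summable_on_def)
    moreover have "(v + of_int n) ^ Suc 1 = (- v + of_int (- n)) ^ Suc 1" for n :: int
      by (simp add: algebra_simps)
    ultimately show ?thesis
      by (subst summable_on_reindex_bij_witness[of _ uminus uminus UNIV "\<lambda>n. inverse ((- v +
          of_int n) ^ Suc 1)"]) auto
  qed
  have nz: "w + of_int n \<noteq> 0" "w + of_int n - 1 \<noteq> 0" for n :: int
    using w by (auto simp: complex_eq_iff)
  define f where "f = (\<lambda>n::int. inverse (w + of_int n - 1) - inverse (w + of_int n))"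
  have "f summable_on UNIV"
  proof (rule abs_summable_summable, rule Infinite_Sum.abs_summable_on_comparison_test')
    show "(\<lambda>n::int. norm (inverse ((w - 1 + of_int n) ^ Suc 1)) + norm (inverse ((w +
        of_int n) ^ Suc 1))) summable_on UNIV"
      using summ[of w] summ[of "w - 1"] w 
      by (intro summable_on_add) (simp_all only: summable_on_iff_abs_summable_on_complex, simp_all)
    fix n :: int
    define a b where "a = inverse (w + of_int n - 1)" and "b = inverse (w + of_int n)"
    have "f n = a * b"
      using nz[of n] by (simp add: f_def a_def b_def field_simps)
    hence "norm (f n) = norm a * norm b"
      by (simp add: norm_mult)
    also have "\<dots> \<le> norm a ^ 2 + norm b ^ 2"
      using sum_squares_bound[of "norm a" "norm b"] mult_nonneg_nonneg[of "norm a" "norm b"]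
          norm_ge_zero[of a] norm_ge_zero[of b] by linarith
    finally show "norm (f n) \<le> norm (inverse ((w - 1 + of_int n) ^ Suc 1)) + norm (inverse ((w +
        of_int n) ^ Suc 1))"
      by (simp add: a_def b_def norm_inverse norm_mult power2_eq_square diff_add_eq)
  qed
  then obtain S where S: "(f has_sum S) UNIV"
    by (auto simp: summable_on_def)
  have "(\<Sum>n\<in>{1 - int N..int N}. f n) = inverse (w - of_nat N) - inverse (w + of_nat N)" for N
  proof (induction N)
    case (Suc N)
    have "{1 - int (Suc N)..int (Suc N)} = insert (- int N) (insert (int N + 1) {1 - int N..int N})"
      by auto
    thus ?case using Suc by (simp add: f_def algebra_simps)
  qed simp
  moreover have "(\<lambda>N. - inverse (- w + of_nat N) - inverse (w + of_nat N)) \<longlonglongrightarrow> - 0 - 0"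
    by (intro tendsto_diff tendsto_minus inverse_shift_LIMSEQ)
  moreover have "- inverse (- w + of_nat N) = inverse (w - of_nat N)" for N
    by (simp flip: inverse_minus_eq)
  ultimately have "S = 0"
    using has_sum_int_LIMSEQ[OF S] LIMSEQ_unique by auto
  with S show ?thesis by (simp add: f_def)
qed

text \<open>The terms for m and -m agree, and those with m \<ge> 1 form the partial fraction series
  of pi cot(pi s) without its pole 1/s. Their partial sums differ from those of two Digamma series
  only by 1/s and by 1/(s + M), and the latter tends to 0.\<close>

lemma half_lattice_sum:
  assumes s: "Im s > 0"
  assumes D: "((\<lambda>m::int. inverse (of_int m + s) - inverse (of_int m - s)) has_sum D) (- {0})"
  shows "D = 2 * (of_real pi * \<i> * (1 - 2 / (1 - ex s)) - inverse s)"
proof -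
  define f where "f = (\<lambda>m::int. inverse (of_int m + s) - inverse (of_int m - s))"
  have nz: "s + of_nat k \<noteq> 0" "1 - s + of_nat k \<noteq> 0" for k
    using s by (auto simp: complex_eq_iff)
  have "f summable_on {1..}"
    using has_sum_imp_summable[OF D] unfolding f_def by (rule summable_on_subset_banach) auto
  then obtain S where S: "(f has_sum S) {1..}"
    by (auto simp: summable_on_def)
  have "f (- n) = f n" for n
  proof -
    have "- of_int n + s = - (of_int n - s)" "- of_int n - s = - (of_int n + s)" by simp_all
    thus ?thesis unfolding f_def of_int_minus by (simp only: inverse_minus_eq) simp
  qed
  from has_sum_int_even(2)[OF S this] D have D2: "D = 2 * S"
    by (auto simp: f_def dest: has_sum_unique)
  have "(\<lambda>k. f (int k + 1)) sums S"
    using S by (simp add: has_sum_int_pos_iff has_sum_imp_sums)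
  hence 1: "(\<lambda>M. \<Sum>k<M. f (int k + 1)) \<longlonglongrightarrow> S"
    by (simp add: sums_def)
  have "s \<noteq> 0" "1 - s \<noteq> 0" using nz[of 0] by auto
  from tendsto_diff[OF Digamma_LIMSEQ[OF this(2)] Digamma_LIMSEQ[OF this(1)]]
  have "(\<lambda>M. (\<Sum>k<M. inverse (s + of_nat k)) - (\<Sum>k<M. inverse (1 - s + of_nat k)))
      \<longlonglongrightarrow> Digamma (1 - s) - Digamma s"
    by (simp add: algebra_simps)
  from tendsto_add[OF tendsto_diff[OF this tendsto_const[of "inverse s"]]
      inverse_shift_LIMSEQ[of s]] have "(\<lambda>M. (\<Sum>k<M. inverse (s + of_nat k))
      - (\<Sum>k<M. inverse (1 - s + of_nat k)) - inverse s + inverse (s + of_nat M))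
     \<longlonglongrightarrow> Digamma (1 - s) - Digamma s - inverse s + 0" .
  moreover have "(\<Sum>k<M. f (int k + 1)) = 
      (\<Sum>k<M. inverse (s + of_nat k)) - (\<Sum>k<M. inverse (1 - s + of_nat k)) - inverse s +
          inverse (s + of_nat M)" for M
    by (induction M) (simp_all add: f_def algebra_simps)
  ultimately have "S = Digamma (1 - s) - Digamma s - inverse s"
    using 1 LIMSEQ_unique by auto
  moreover have "power_series 0 (ex s) = 1 / (1 - ex s)"
    using s by (simp add: qser_def suminf_geometric)
  ultimately show ?thesis
    using D2 Digamma_reflection[OF s] by simp
qed

lemma infsum_inverse_squares_int: "((\<lambda>n::int. inverse (of_int n ^ 2) :: complex) has_sum (of_real
    pi ^ 2 / 3)) UNIV"
proof -
  have "(\<lambda>n. of_real (1 / (real n + 1) ^ 2) :: complex) sums of_real (pi ^ 2 / 6)"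
    using inverse_squares_sums by (simp only: sums_of_real_iff of_nat_power of_nat_add of_nat_1)
  moreover have "summable (\<lambda>n. norm (of_real (1 / (real n + 1) ^ 2) :: complex))"
    using sums_summable[OF inverse_squares_sums] by (simp add: norm_divide norm_power add_ac del:
        of_real_add)
  ultimately have "((\<lambda>n. of_real (1 / (real n + 1) ^ 2) :: complex) has_sum of_real (pi ^ 2 / 6))
      UNIV"
    by (intro norm_summable_imp_has_sum)
  also have "(\<lambda>n. of_real (1 / (real n + 1) ^ 2) :: complex) = (\<lambda>k. inverse (of_int (int k + 1) ^ 2))"
    by (simp add: fun_eq_iff divide_inverse)
  finally have "((\<lambda>n::int. inverse (of_int n ^ 2) :: complex) has_sum of_real (pi ^ 2 / 6)) {1..}"
    by (simp only: has_sum_int_pos_iff)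
  from has_sum_int_even(1)[OF this] show ?thesis by simp
qed

text \<open>Eisenstein's summation: subtracting the terms \<open>t m n\<close>, which telescope in \<open>n\<close>, makes the
  double series of $(m\tau + n)^{-2}$ absolutely convergent.  Summed first over \<open>m\<close>, they leave the
  limit of a cotangent, which is the non-modular term of $E_2$.\<close>

theorem E2_inversion:
  assumes \<tau>: "Im \<tau> > 0"
  shows "E2 (ex (- 1 / \<tau>)) = \<tau> ^ 2 * E2 (ex \<tau>) + 6 * \<tau> / (of_real pi * \<i>)"
proof -
  define \<tau>' where "\<tau>' = - 1 / \<tau>"
  have [simp]: "\<tau> \<noteq> 0" using \<tau> by auto
  have \<tau>': "Im \<tau>' > 0" using \<tau> by (simp add: Im_divide' \<tau>'_def)
  define S where "S = sigma_series 1"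
  define c where "c = (2 * of_real pi * \<i>) ^ 2"
  define Z :: complex where "Z = of_real pi ^ 2 / 3"
  have c0: "c \<noteq> 0" by (simp add: c_def)
  define t where "t = (\<lambda>m n::int. inverse (of_int m * \<tau> + of_int n - 1) - inverse (of_int m * \<tau> +
      of_int n))"
  define a where "a = (\<lambda>(m, n::int). inverse ((of_int m * \<tau> + of_int n) ^ 2) - t m n)"
  define L where "L = (\<lambda>m::int. power_series 1 (ex (of_int \<bar>m\<bar> * \<tau>)))"
  define L' where "L' = (\<lambda>m::int. power_series 1 (ex (of_int \<bar>m\<bar> * \<tau>')))"
  have nz: "of_int m * \<tau> + of_int n \<noteq> 0" "of_int m * \<tau> + of_int n - 1 \<noteq> 0" if "m \<noteq> 0" for m n :: int
    using that \<tau> by (auto simp: complex_eq_iff)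
  have summable: "a summable_on ((- {0}) \<times> UNIV)"
  proof (rule abs_summable_summable, rule Infinite_Sum.abs_summable_on_comparison_test')
    \<comment> \<open>With z = m \<tau> + n the subtraction leaves -1/(z^2 (z - 1)), which decays
      cubically. For m \<noteq> 0 the distance of z from 1 is at least Im \<tau>, so 1 + 1/Im \<tau>
      bounds |z| / |z - 1|.\<close>
    show "(\<lambda>x. (1 + 1 / Im \<tau>) * (case x of (m, n) \<Rightarrow> inverse (norm (of_int m * \<tau> + of_int n) ^ 3)))
        summable_on ((- {0}) \<times> (UNIV :: int set))"
      by (intro summable_on_cmult_right summable_on_subset_banach[OF lattice_abs_summable[OF \<tau>]]) auto
    fix x :: "int \<times> int" assume x: "x \<in> (- {0}) \<times> UNIV"
    obtain m n where [simp]: "x = (m, n)" by force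
    define z where "z = of_int m * \<tau> + of_int n"
    have m: "m \<noteq> 0" using x by auto
    have z: "z \<noteq> 0" "z - 1 \<noteq> 0" using nz[OF m, of n] by (auto simp: z_def)
    have "Im \<tau> \<le> \<bar>of_int m * Im \<tau>\<bar>"
      using \<tau> m mult_right_mono[of 1 "\<bar>of_int m\<bar>" "Im \<tau>"] by (simp add: abs_mult)
    also have "\<dots> \<le> norm (z - 1)"
      using abs_Im_le_cmod[of "z - 1"] by (simp add: z_def)
    finally have le: "Im \<tau> \<le> norm (z - 1)" .
    have "norm z \<le> norm (z - 1) + 1"
      using norm_triangle_ineq[of "z - 1" 1] by simp
    also have "\<dots> \<le> (1 + 1 / Im \<tau>) * norm (z - 1)"
      using le \<tau> by (simp add: field_simps)
    finally have "1 / norm (z - 1) \<le> (1 + 1 / Im \<tau>) / norm z"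
      using z by (simp add: field_simps)
    hence "norm z ^ 2 / norm z ^ 2 / norm z ^ 2 * (1 / norm (z - 1)) \<le>
        norm z ^ 2 / norm z ^ 2 / norm z ^ 2 * ((1 + 1 / Im \<tau>) / norm z)"
      by (intro mult_left_mono) auto
    moreover have "a x = - (1 / (z ^ 2 * (z - 1)))"
      using z by (simp add: a_def t_def z_def [symmetric] divide_simps power2_eq_square)
    hence "norm (a x) = 1 / (norm z ^ 2 * norm (z - 1))"
      by (simp add: norm_divide norm_mult norm_power)
    ultimately have "norm (a x) \<le> (1 + 1 / Im \<tau>) * inverse (norm z ^ 3)"
      using z by (simp add: divide_inverse power2_eq_square power3_eq_cube algebra_simps)
    thus "norm (a x) \<le> (1 + 1 / Im \<tau>) * (case x of (m, n) \<Rightarrow> inverse (norm (of_int m * \<tau> +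
        of_int n) ^ 3))"
      by (simp add: z_def)
  qed
  have row: "((\<lambda>n. a (m, n)) has_sum (c * L m)) UNIV" if "m \<noteq> 0" for m
  proof -
    have "((\<lambda>n. t m n) has_sum 0) UNIV"
      using telescoping_has_sum_int[of "of_int m * \<tau>"] that \<tau> by (simp add: t_def)
    from has_sum_diff_complex[OF Lipschitz_formula_multiple[OF \<tau> that, of 1] this] show ?thesis
      by (simp add: a_def c_def L_def power2_eq_square)
  qed
  have "((\<lambda>m. c * (if m = 0 then 0 else L m)) has_sum (c * (0 + 2 * S (ex \<tau>)))) UNIV"
    unfolding L_def S_def by (intro has_sum_cmult_right Lambert_ex_has_sum \<tau>) auto
  from has_sum_remove[OF this, of 0]
  have rows: "((\<lambda>m. c * (if m = 0 then 0 else L m)) has_sum (2 * c * S (ex \<tau>))) (- {0})"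
    by (simp add: mult_ac)
  have total: "(a has_sum (2 * c * S (ex \<tau>))) ((- {0}) \<times> UNIV)"
    by (rule has_sum_SigmaI[OF _ rows summable]) (use row in auto)
  hence total': "((\<lambda>(n, m). a (m, n)) has_sum (2 * c * S (ex \<tau>))) (UNIV \<times> (- {0}))"
    by (subst (asm) has_sum_swap) simp
  \<comment> \<open>\<open>b n\<close> is the column sum of the squares over m \<noteq> 0: writing m
    \<tau> + n = -\<tau> (n \<tau>' - m) turns the column into a row of the lattice for \<tau>',
    from which the entry m = 0 is removed.\<close>
  define b where "b = (\<lambda>n::int. inverse (\<tau> ^ 2) * (if n = 0 then Z else c * L' n) - inverse
      (of_int n ^ 2))"
  have square: "((\<lambda>m::int. inverse ((of_int m * \<tau> + of_int n) ^ 2)) has_sum b n) (- {0})" for n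
  proof -
    have eq: "inverse ((of_int m * \<tau> + of_int n) ^ 2) = inverse (\<tau> ^ 2) * inverse ((of_int n * \<tau>'
        + of_int (- m)) ^ 2)" for m :: int
    proof -
      have "of_int m * \<tau> + of_int n = - \<tau> * (of_int n * \<tau>' + of_int (- m))"
        by (simp add: \<tau>'_def field_simps)
      thus ?thesis by (simp only: power_mult_distrib inverse_mult_distrib power2_minus)
    qed
    have "((\<lambda>m::int. inverse ((of_int n * \<tau>' + of_int m) ^ 2)) has_sum (if n =
        0 then Z else c * L' n)) UNIV"
    proof (cases "n = 0")
      case True
      thus ?thesis using infsum_inverse_squares_int by (simp add: Z_def)
    next
      case False
      thus ?thesis using Lipschitz_formula_multiple[OF \<tau>' False, of 1] 
        by (simp add: c_def L'_def power2_eq_square)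
    qed
    hence "((\<lambda>m::int. inverse ((of_int m * \<tau> + of_int n) ^ 2)) has_sum (inverse (\<tau> ^ 2) * (if n =
        0 then Z else c * L' n))) UNIV"
      unfolding eq by (subst has_sum_reindex_bij_witness[where T = UNIV and i = uminus and j = uminus 
           and h = "\<lambda>m. inverse (\<tau> ^ 2) * inverse ((of_int n * \<tau>' + of_int m) ^ 2)"])
         (auto intro!: has_sum_cmult_right)
    from has_sum_remove[OF this, of 0] show ?thesis by (simp add: b_def)
  qed
  have b: "(b has_sum (inverse (\<tau> ^ 2) * (Z + 2 * c * S (ex \<tau>')) - Z)) UNIV"
  proof -
    have "((\<lambda>n. c * (if n = 0 then Z / c else L' n)) has_sum (c * (Z / c + 2 * S (ex \<tau>')))) UNIV"
      unfolding L'_def S_def by (intro has_sum_cmult_right Lambert_ex_has_sum \<tau>') auto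
    also have "(\<lambda>n. c * (if n = 0 then Z / c else L' n)) = (\<lambda>n. if n = 0 then Z else c * L' n)"
      using c0 by auto
    also have "c * (Z / c + 2 * S (ex \<tau>')) = Z + 2 * c * S (ex \<tau>')"
      using c0 by (simp add: field_simps)
    finally show ?thesis
      unfolding b_def Z_def by (intro has_sum_diff_complex has_sum_cmult_right
          infsum_inverse_squares_int)
  qed
  have col_summable: "(\<lambda>m. a (m, n)) summable_on (- {0})" for n
    using summable_on_SigmaD1[of "\<lambda>n m. a (m, n)" UNIV "\<lambda>_. - {0}" n]
        has_sum_imp_summable[OF total'] by simp
  \<comment> \<open>\<open>d n\<close> is the sum of column n of the telescoping terms, obtained as
    the difference between the column of squares and the column of \<open>a\<close>.\<close>
  define d where "d = (\<lambda>n. b n - infsum (\<lambda>m. a (m, n)) (- {0}))"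
  have t: "((\<lambda>m. t m n) has_sum d n) (- {0})" for n
    using has_sum_diff_complex[OF square[of n] has_sum_infsum[OF col_summable[of n]]]
        by (simp add: d_def a_def)
  have "((\<lambda>n. infsum (\<lambda>m. a (m, n)) (- {0})) has_sum (2 * c * S (ex \<tau>))) UNIV"
    by (rule has_sum_SigmaD[OF total']) (use col_summable in auto)
  from has_sum_diff_complex[OF b this]
  have "(d has_sum (inverse (\<tau> ^ 2) * (Z + 2 * c * S (ex \<tau>')) - Z - 2 * c * S (ex \<tau>))) UNIV"
    by (simp add: d_def)
  from has_sum_int_LIMSEQ[OF this]
  have lim1: "(\<lambda>N. \<Sum>n\<in>{1 - int N..int N}. d n) \<longlonglongrightarrow> inverse (\<tau> ^ 2) * (Z + 2 * c * S (ex \<tau>'))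
      - Z - 2 * c * S (ex \<tau>)" .
  \<comment> \<open>A finite block of columns may be summed over n first. There it telescopes to
    1/(m \<tau> - N) - 1/(m \<tau> + N), which is 1/\<tau> times a term of the cotangent series at s
    = N \<tau>'.\<close>
  have D: "(\<Sum>n\<in>{1 - int N..int N}. d n) = inverse \<tau> * (2 * (of_real pi * \<i> * (1 - 2 / (1 - ex \<tau>' ^
      N)) - inverse (of_nat N * \<tau>')))" if N: "N > 0" for N
  proof -
    have "((\<lambda>m. \<Sum>n\<in>{1 - int N..int N}. t m n) has_sum (\<Sum>n\<in>{1 - int N..int N}. d n)) (- {0})"
      by (intro has_sum_finite_sum t) auto
    moreover have "(\<Sum>n\<in>{1 - int N..int N}. t m n) = 
           inverse \<tau> * (inverse (of_int m + of_nat N * \<tau>') - inverse (of_int m - of_nat N * \<tau>'))"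
               for m
    proof -
      have "(\<Sum>n\<in>{1 - int N..int N}. t m n) = inverse (of_int m * \<tau> - of_nat N) - inverse (of_int m
          * \<tau> + of_nat N)"
      proof (induction N)
        case (Suc N)
        have "{1 - int (Suc N)..int (Suc N)} = insert (- int N) (insert (int N +
            1) {1 - int N..int N})"
          by auto
        thus ?case using Suc by (simp add: t_def algebra_simps)
      qed simp
      also have "of_int m * \<tau> - of_nat N = \<tau> * (of_int m + of_nat N * \<tau>')"
        by (simp add: \<tau>'_def field_simps)
      also have "of_int m * \<tau> + of_nat N = \<tau> * (of_int m - of_nat N * \<tau>')"
        by (simp add: \<tau>'_def field_simps)
      finally show ?thesis by (simp only: inverse_mult_distrib) (simp only: right_diff_distrib)
    qed
    ultimately have "((\<lambda>m. inverse \<tau> * (inverse (of_int m + of_nat N * \<tau>') - inverse (of_int m -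
        of_nat N * \<tau>'))) has_sum (\<Sum>n\<in>{1 - int N..int N}. d n)) (- {0})"
      by simp
    from has_sum_cmult_right[OF this, of \<tau>]
    have "((\<lambda>m. inverse (of_int m + of_nat N * \<tau>') - inverse (of_int m - of_nat N * \<tau>'))
        has_sum (\<tau> * (\<Sum>n\<in>{1 - int N..int N}. d n))) (- {0})"
      by (simp add: mult.assoc [symmetric])
    from half_lattice_sum[OF _ this] N \<tau>' have "\<tau> * (\<Sum>n\<in>{1 - int N..int N}. d n) =
        2 * (of_real pi * \<i> * (1 - 2 / (1 - ex (of_nat N * \<tau>'))) - inverse (of_nat N * \<tau>'))"
      by simp
    hence "inverse \<tau> * (\<tau> * (\<Sum>n\<in>{1 - int N..int N}. d n)) = inverse \<tau> * (2 * (of_real pi * \<i> * (1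
        - 2 / (1 - ex \<tau>' ^ N)) - inverse (of_nat N * \<tau>')))"
      by (simp only: ex_mult_nat)
    thus ?thesis by (simp only: mult.assoc [symmetric]) simp
  qed
  \<comment> \<open>As \<open>ex \<tau>' ^ N\<close> tends to 0, the cotangent tends to -i: the
    columns of the telescoping terms add up to -2 pi i/\<tau>, although each of their rows adds up
    to 0.\<close>
  have "(\<lambda>N. inverse \<tau> * (2 * (of_real pi * \<i> * (1 - 2 / (1 - ex \<tau>' ^ N))
      - inverse \<tau>' * inverse (of_nat N))))
          \<longlonglongrightarrow> inverse \<tau> * (2 * (of_real pi * \<i> * (1 - 2 / (1 - 0)) - inverse \<tau>' * 0))"
    using norm_ex_less[OF \<tau>'] by (intro tendsto_intros LIMSEQ_power_zero lim_inverse_n) auto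
  moreover have "\<forall>\<^sub>F N in sequentially. inverse \<tau> * (2 * (of_real pi * \<i> * (1 - 2 / (1 - ex \<tau>' ^
      N)) - inverse \<tau>' * inverse (of_nat N))) = (\<Sum>n\<in>{1 - int N..int N}. d n)"
    using eventually_gt_at_top[of 0] by eventually_elim (simp add: D mult_ac)
  ultimately have "(\<lambda>N. \<Sum>n\<in>{1 - int N..int N}. d n) \<longlonglongrightarrow> inverse \<tau> * (2 * (of_real pi * \<i> * (1 - 2 /
      (1 - 0)) - inverse \<tau>' * 0))"
    by (rule Lim_transform_eventually)
  from LIMSEQ_unique[OF lim1 this]
  have main: "inverse (\<tau> ^ 2) * (Z + 2 * c * S (ex \<tau>')) - Z - 2 * c * S (ex \<tau>) =
      - (2 * of_real pi * \<i> / \<tau>)"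
    by (simp add: field_simps)
  \<comment> \<open>Here Z = 2 zeta(2) = pi^2/3 and c = -4 pi^2, so the bracket is pi^2/3 times 1 -
    24 S.\<close>
  have E: "E2 q = 3 / of_real pi ^ 2 * (Z + 2 * c * S q)" if "norm q < 1" for q
  proof -
    have "E2 q = 1 - 24 * S q"
      using E2_conv_qser[OF that] by (simp add: S_def)
    thus ?thesis by (simp add: Z_def c_def power_mult_distrib distrib_left diff_divide_distrib)
  qed
  have "Z + 2 * c * S (ex \<tau>') = \<tau> ^ 2 * (inverse (\<tau> ^ 2) * (Z + 2 * c * S (ex \<tau>')))"
    by simp
  also have "inverse (\<tau> ^ 2) * (Z + 2 * c * S (ex \<tau>')) = Z +
      2 * c * S (ex \<tau>) - 2 * of_real pi * \<i> / \<tau>"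
    using main by (simp add: algebra_simps)
  also have "\<tau> ^ 2 * \<dots> = \<tau> ^ 2 * (Z + 2 * c * S (ex \<tau>)) - 2 * of_real pi * \<i> * \<tau>"
    by (simp add: power2_eq_square algebra_simps)
  finally have "E2 (ex \<tau>') = \<tau> ^ 2 * E2 (ex \<tau>) - 3 / of_real pi ^ 2 * (2 * of_real pi * \<i> * \<tau>)"
    using E[OF norm_ex_less[OF \<tau>]] E[OF norm_ex_less[OF \<tau>']]
        by (simp only: right_diff_distrib) (simp add: mult_ac)
  also have "3 / of_real pi ^ 2 * (2 * of_real pi * \<i> * \<tau>) = - (6 * \<tau> / (of_real pi * \<i>))"
    by (simp add: field_simps power2_eq_square)
  finally show ?thesis by (simp add: \<tau>'_def)
qed

section \<open>The inversion of the eta function\<close>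

definition Euler_product :: "complex \<Rightarrow> complex" where
  "Euler_product w = prodinf (\<lambda>k. 1 - w ^ Suc k)"

lemma one_minus_power_nonzero: "norm (w::complex) < 1 \<Longrightarrow> n > 0 \<Longrightarrow> 1 - w ^ n \<noteq> 0"
  using power_less_one_iff[of "norm w" n] by (auto simp flip: norm_power)

lemma Euler_product_convergent:
  fixes w :: complex
  assumes "norm w < 1"
  shows "convergent_prod (\<lambda>k. 1 - w ^ Suc k)"
proof -
  have "summable (\<lambda>k. norm w ^ Suc k)"
    using assms by (subst summable_Suc_iff) (simp add: summable_geometric)
  hence "summable (\<lambda>k. norm (1 - w ^ Suc k - 1))"
    by (simp add: norm_power norm_mult)
  thus ?thesis
    by (intro abs_convergent_prod_imp_convergent_prod) (simp only: abs_convergent_prod_conv_summable)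
qed

lemma Euler_product_nonzero: "norm w < 1 \<Longrightarrow> Euler_product w \<noteq> 0"
  unfolding Euler_product_def
  by (intro prodinf_nonzero Euler_product_convergent one_minus_power_nonzero) auto

lemma Euler_product_0: "Euler_product 0 = 1"
  by (simp add: Euler_product_def)

lemma Euler_product_uniform_limit:
  assumes "r < 1"
  shows "uniform_limit (cball 0 r) (\<lambda>n w. \<Prod>k<n. 1 - w ^ Suc k) Euler_product sequentially"
proof -
  have "uniformly_convergent_on (cball 0 r) (\<lambda>n w. \<Prod>k<n. 1 - w ^ Suc k :: complex)"
  proof (rule uniformly_convergent_on_prod')
    show "uniformly_convergent_on (cball 0 r) (\<lambda>N w. \<Sum>n<N. norm (1 - w ^ Suc n - 1 :: complex))"
    proof (cases "r \<ge> 0")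
      case True
      show ?thesis
      proof (rule Weierstrass_m_test')
        show "summable (\<lambda>n. r ^ Suc n)"
          using assms True by (subst summable_Suc_iff) (simp add: summable_geometric)
        show "norm (norm (1 - w ^ Suc n - 1)) \<le> r ^ Suc n" if "w \<in> cball 0 r" for n and w :: complex
          using power_mono[of "norm w" r "Suc n"] that by (simp add: norm_power norm_mult)
      qed
    qed (auto simp: uniformly_convergent_on_def)
  qed (auto intro!: continuous_intros)
  then obtain P where P: "uniform_limit (cball 0 r) (\<lambda>n w. \<Prod>k<n. 1 - w ^ Suc k :: complex) P
      sequentially"
    by (auto simp: uniformly_convergent_on_def)
  have eq: "P w = Euler_product w" if "w \<in> cball 0 r" for w
  proof -
    have "norm w < 1" using that assms by auto
    hence "(\<lambda>n. \<Prod>k<n. 1 - w ^ Suc k) \<longlonglongrightarrow> Euler_product w"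
      using Euler_product_convergent[of w] 
      by (auto simp: Euler_product_def convergent_prod_has_prod_iff intro!: has_prod_imp_tendsto')
    thus ?thesis
      using tendsto_uniform_limitI[OF P that] LIMSEQ_unique by blast
  qed
  show ?thesis
    using P eq by (simp add: uniform_limit_iff)
qed

lemma Euler_product_holomorphic: "Euler_product holomorphic_on ball 0 1"
proof (rule holomorphic_uniform_sequence)
  fix x :: complex assume x: "x \<in> ball 0 1"
  define d where "d = (1 - norm x) / 2"
  have "d > 0" using x by (simp add: d_def)
  have *: "norm y \<le> norm x + d" if "dist x y \<le> d" for y
    using that norm_triangle_ineq2[of y x] by (simp add: dist_norm norm_minus_commute)
  have lt: "norm x + d < 1" using x by (simp add: d_def field_simps)
  have "cball x d \<subseteq> cball 0 (norm x + d)" using * by auto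
  moreover from this have "cball x d \<subseteq> ball 0 1" using lt by auto
  ultimately show "\<exists>d>0. cball x d \<subseteq> ball 0 1 \<and>
      uniform_limit (cball x d) (\<lambda>n w. \<Prod>k<n. 1 - w ^ Suc k) Euler_product sequentially"
    using \<open>d > 0\<close> uniform_limit_on_subset[OF Euler_product_uniform_limit[OF lt]] by blast
qed (auto intro!: holomorphic_intros)

text \<open>Termwise logarithmic differentiation, justified by uniform convergence on discs of
  radius below 1, gives the Lambert series of -k w^k/(1 - w^k).\<close>

lemma Euler_product_deriv:
  assumes w: "norm w < 1"
  shows "w * deriv Euler_product w = - Euler_product w * sigma_series 1 w"
proof -
  obtain r where r: "norm w < r" "r < 1" using w dense by blast
  have d: "deriv (\<lambda>u. 1 - u ^ Suc k) w = - (of_nat (Suc k) * w ^ k)" for k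
    by (rule DERIV_imp_deriv, rule DERIV_cong[OF DERIV_diff[OF DERIV_const DERIV_power[OF
        DERIV_ident]]]) simp
  have "(\<lambda>k. deriv (\<lambda>u. 1 - u ^ Suc k) w / (1 - w ^ Suc k)) sums (deriv Euler_product w /
      Euler_product w)"
  proof (rule logderiv_prodinf_complex_uniform_limit)
    show "uniform_limit (ball 0 r) (\<lambda>n w. \<Prod>k<n. 1 - w ^ Suc k) Euler_product sequentially"
      by (rule uniform_limit_on_subset[OF Euler_product_uniform_limit[OF r(2)]]) auto
  qed (use r w in \<open>auto intro!: holomorphic_intros simp: Euler_product_nonzero\<close>)
  hence "(\<lambda>k. - w * (deriv (\<lambda>u. 1 - u ^ Suc k) w / (1 - w ^ Suc k)))
      sums (- w * (deriv Euler_product w / Euler_product w))"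
    by (rule sums_mult)
  moreover have "- w * (deriv (\<lambda>u. 1 - u ^ Suc k) w / (1 - w ^ Suc k)) =
      of_nat (Suc k) ^ 1 * (w ^ Suc k / (1 - w ^ Suc k))" for k
    unfolding d by (simp add: mult_ac)
  ultimately have 1: "(\<lambda>k. of_nat (Suc k) ^ 1 * (w ^ Suc k / (1 - w ^ Suc k)))
      sums (- w * (deriv Euler_product w / Euler_product w))"
    by (simp only:)
  have "((\<lambda>k. of_nat (Suc k) ^ 1 * (w ^ Suc k / (1 - w ^ Suc k))) has_sum sigma_series 1 w) UNIV"
    by (subst has_sum_reindex_bij_witness[where j = Suc and i = "\<lambda>n. n - 1" and T = "{1..}"
          and h = "\<lambda>d. of_nat d ^ 1 * (w ^ d / (1 - w ^ d))" and s' = "sigma_series 1 w"])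
       (use Lambert_swapped_has_sum[OF w, of 1] in auto)
  hence "sigma_series 1 w = - w * (deriv Euler_product w / Euler_product w)"
    using 1 has_sum_imp_sums sums_unique2 by blast
  thus ?thesis using Euler_product_nonzero[OF w] by (simp add: field_simps)
qed

text \<open>The formula for w times the derivative says nothing about the derivative itself at w =
  0; there both sides are differentiated once more.\<close>

lemma Euler_product_deriv_0: "deriv Euler_product 0 = - 1"
proof -
  have hol: "deriv Euler_product holomorphic_on ball 0 1"
    by (intro holomorphic_deriv Euler_product_holomorphic) auto
  have "((\<lambda>w. w * deriv Euler_product w) has_field_derivative (1 * deriv Euler_product 0 +
      deriv (deriv Euler_product) 0 * 0)) (at 0)"
    by (intro DERIV_mult DERIV_ident holomorphic_derivI[OF hol]) auto
  hence "((\<lambda>w. w * deriv Euler_product w) has_field_derivative deriv Euler_product 0) (at 0)"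
    by simp
  hence "((\<lambda>w. - Euler_product w * sigma_series 1 w) has_field_derivative deriv Euler_product 0)
      (at 0)"
    by (rule has_field_derivative_transform_within_open[where S =
        "ball 0 1"]) (auto simp: Euler_product_deriv)
  moreover have "((\<lambda>w. - Euler_product w * sigma_series 1 w) has_field_derivative
      (- Euler_product 0 * deriv (sigma_series 1) 0 + (- deriv Euler_product 0) * sigma_series 1
          0)) (at 0)"
    by (intro DERIV_mult' DERIV_minus holomorphic_derivI[OF Euler_product_holomorphic] 
          holomorphic_derivI[OF qser_holomorphic[OF polynomially_bounded_sigma]]) auto
  ultimately have "deriv Euler_product 0 = - Euler_product 0 * deriv (sigma_series 1) 0 +
      (- deriv Euler_product 0) * sigma_series 1 0"
    by (rule DERIV_unique)
  thus ?thesis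
    by (simp add: Euler_product_0 qser_at_0 sigma_0 qser_deriv_0[OF polynomially_bounded_sigma]
        sigma_1[unfolded One_nat_def])
qed

lemma eta_conv_Euler_product: "eta \<tau> = exp (2 * of_real pi * \<i> * \<tau> / 24) * Euler_product (ex \<tau>)"
  by (simp add: eta_def Euler_product_def)

lemma eta_nonzero: "Im \<tau> > 0 \<Longrightarrow> eta \<tau> \<noteq> 0"
  by (simp add: eta_conv_Euler_product Euler_product_nonzero)

lemma eta_has_field_derivative:
  assumes \<tau>: "Im \<tau> > 0"
  shows "(eta has_field_derivative 2 * of_real pi * \<i> / 24 * E2 (ex \<tau>) * eta \<tau>) (at \<tau>)"
proof -
  have n: "norm (ex \<tau>) < 1" using \<tau> by simp
  have "(Euler_product has_field_derivative deriv Euler_product (ex \<tau>)) (at (ex \<tau>))"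
    using n by (intro holomorphic_derivI[OF Euler_product_holomorphic]) auto
  hence "(eta has_field_derivative 2 * of_real pi * \<i> / 24 * exp (2 * of_real pi * \<i> * \<tau> / 24) *
      Euler_product (ex \<tau>) +
      exp (2 * of_real pi * \<i> * \<tau> / 24) * (deriv Euler_product (ex \<tau>) * (2 * of_real pi * \<i> * ex
          \<tau>))) (at \<tau>)"
    unfolding eta_conv_Euler_product[abs_def]
    by (auto intro!: derivative_eq_intros DERIV_chain2[where f = Euler_product] simp: mult_ac)
  also have "deriv Euler_product (ex \<tau>) * (2 * of_real pi * \<i> * ex \<tau>) =
      2 * of_real pi * \<i> * (ex \<tau> * deriv Euler_product (ex \<tau>))"
    by (simp only: mult_ac)
  also have "2 * of_real pi * \<i> / 24 * exp (2 * of_real pi * \<i> * \<tau> / 24) * Euler_product (ex \<tau>) +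
      exp (2 * of_real pi * \<i> * \<tau> / 24) * (2 * of_real pi * \<i> * (ex \<tau> * deriv Euler_product (ex \<tau>))) =
      2 * of_real pi * \<i> / 24 * E2 (ex \<tau>) * eta \<tau>"
    unfolding Euler_product_deriv[OF n] E2_conv_qser[OF n] eta_conv_Euler_product by (simp add:
        algebra_simps)
  finally show ?thesis .
qed

text \<open>The logarithmic derivative of eta is 2 pi i E2/24, so the non-modular term of E2
  contributes 4/\<tau> for the eighth power, exactly the logarithmic derivative of \<tau>^4. The
  quotient of both sides is therefore constant, and its value is read off at the fixed point i. The
  eighth power avoids the square root of \<tau>.\<close>

lemma eta_power_8_inversion:
  assumes \<tau>: "Im \<tau> > 0"
  shows "eta (- 1 / \<tau>) ^ 8 = \<tau> ^ 4 * eta \<tau> ^ 8"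
proof -
  define f where "f = (\<lambda>\<tau>. eta (- 1 / \<tau>) ^ 8 / (\<tau> ^ 4 * eta \<tau> ^ 8))"
  have "(f has_field_derivative 0) (at z)" if z: "Im z > 0" for z
  proof -
    have z0: "z \<noteq> 0" using z by auto
    hence z': "Im (- 1 / z) > 0" using z by (simp add: Im_divide')
    define u where "u = eta z"
    define v where "v = eta (- 1 / z)"
    define p where "p = 2 * of_real pi * \<i> / 24 * E2 (ex z)"
    have u0: "u \<noteq> 0" using z by (simp add: u_def eta_nonzero)
    have E: "2 * of_real pi * \<i> / 24 * E2 (ex (- 1 / z)) = z ^ 2 * p + z / 2"
      unfolding E2_inversion[OF z] p_def by (simp add: field_simps)
    have v: "(eta has_field_derivative (z ^ 2 * p + z / 2) * v) (at (- 1 / z))"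
      using eta_has_field_derivative[OF z'] unfolding E v_def .
    have u: "(eta has_field_derivative p * u) (at z)"
      using eta_has_field_derivative[OF z] by (simp add: u_def p_def)
    have "((\<lambda>z. - 1 / z) has_field_derivative 1 / z ^ 2) (at z)"
      using z0 by (auto intro!: derivative_eq_intros simp: power2_eq_square)
    from DERIV_chain2[OF v this]
    have v': "((\<lambda>z. eta (- 1 / z)) has_field_derivative ((z ^ 2 * p + z / 2) * v * (1 / z ^ 2)))
        (at z)" .
    have 1: "((\<lambda>z. eta (- 1 / z) ^ 8) has_field_derivative (8 * p + 4 / z) * v ^ 8) (at z)"
      by (rule DERIV_cong[OF DERIV_power[OF v', of 8]]) (use z0 in \<open>simp add: v_def
          eval_nat_numeral field_simps\<close>)
    have "((\<lambda>z. eta z ^ 8) has_field_derivative 8 * p * u ^ 8) (at z)"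
      by (rule DERIV_cong[OF DERIV_power[OF u, of 8]]) (simp add: u_def eval_nat_numeral)
    moreover have "((\<lambda>z. z ^ 4) has_field_derivative 4 / z * z ^ 4) (at z)"
      by (rule DERIV_cong[OF DERIV_power[OF DERIV_ident, of 4]]) (use z0 in \<open>simp add:
          eval_nat_numeral\<close>)
    ultimately have 2: "((\<lambda>z. z ^ 4 * eta z ^ 8) has_field_derivative (8 * p +
        4 / z) * (z ^ 4 * u ^ 8)) (at z)"
      by (intro DERIV_cong[OF DERIV_mult[of "\<lambda>z. z ^ 4" "4 / z * z ^ 4" z UNIV "\<lambda>z. eta z ^ 8"
          "8 * p * u ^ 8"]])
         (simp_all add: u_def ring_distribs mult_ac)
    show ?thesis
      unfolding f_def by (rule DERIV_cong[OF DERIV_divide[OF 1 2]]) (use z0 u0 in \<open>simp_all add: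
          u_def v_def mult_ac\<close>)
  qed
  hence "\<exists>c. \<forall>z\<in>{z. Im z > 0}. f z = c"
    by (intro has_field_derivative_zero_constant convex_halfspace_Im_gt) (auto intro:
        has_field_derivative_at_within)
  hence "f \<tau> = f \<i>" using \<tau> by auto
  also have "f \<i> = 1" using eta_nonzero[of \<i>] by (simp add: f_def)
  finally show ?thesis
    using eta_nonzero[OF \<tau>] \<tau> by (auto simp: f_def)
qed

section \<open>Forms for $\Gamma_0(2)$ and their expansions\<close>

text \<open>A form of weight $2n$ for $\Gamma_0(2)$ is encoded by its expansions at the two cusps:
  $f(\tau) = F(q)$ at $\infty$ and $\tau^{-2n} f(-1/\tau) = G(q^{1/2})$ at $0$.\<close>

definition level2 :: "int \<Rightarrow> (complex \<Rightarrow> complex) \<Rightarrow> (complex \<Rightarrow> complex) \<Rightarrow> bool" where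
  "level2 n F G \<longleftrightarrow> F holomorphic_on ball 0 1 \<and> G holomorphic_on ball 0 1 \<and>
     (\<forall>\<tau>. Im \<tau> > 0 \<longrightarrow> F (ex (- 1 / \<tau>)) = (\<tau> ^ 2) powi n * G (ex (\<tau> / 2)))"

lemma level2D:
  assumes "level2 n F G"
  shows "F holomorphic_on ball 0 1" "G holomorphic_on ball 0 1"
    "\<And>\<tau>. Im \<tau> > 0 \<Longrightarrow> F (ex (- 1 / \<tau>)) = (\<tau> ^ 2) powi n * G (ex (\<tau> / 2))"
  using assms by (auto simp: level2_def)

lemma level2_mult:
  assumes "level2 m F G" "level2 n F' G'"
  shows "level2 (m + n) (\<lambda>w. F w * F' w) (\<lambda>w. G w * G' w)"
  unfolding level2_def
proof (intro conjI allI impI)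
  fix \<tau> :: complex assume \<tau>: "Im \<tau> > 0"
  hence "\<tau> ^ 2 \<noteq> 0" by auto
  thus "F (ex (- 1 / \<tau>)) * F' (ex (- 1 / \<tau>)) = (\<tau> ^ 2) powi (m + n) * (G (ex (\<tau> / 2))
      * G' (ex (\<tau> / 2)))"
    unfolding level2D(3)[OF assms(1) \<tau>] level2D(3)[OF assms(2) \<tau>] by (simp add: power_int_add)
qed (intro holomorphic_intros level2D[OF assms(1)] level2D[OF assms(2)])+

lemma level2_add:
  "level2 n F G \<Longrightarrow> level2 n F' G' \<Longrightarrow> level2 n (\<lambda>w. F w + F' w) (\<lambda>w. G w + G' w)"
  by (auto simp: level2_def distrib_left intro!: holomorphic_intros)

lemma level2_const: "level2 0 (\<lambda>_. c) (\<lambda>_. c)"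
  by (auto simp: level2_def)

lemma level2_cmult: "level2 n F G \<Longrightarrow> level2 n (\<lambda>w. c * F w) (\<lambda>w. c * G w)"
  using level2_mult[OF level2_const] by fastforce

lemma level2_diff:
  "level2 n F G \<Longrightarrow> level2 n F' G' \<Longrightarrow> level2 n (\<lambda>w. F w - F' w) (\<lambda>w. G w - G' w)"
  by (auto simp: level2_def right_diff_distrib intro!: holomorphic_intros)

lemma level2_power: "level2 n F G \<Longrightarrow> level2 (int k * n) (\<lambda>w. F w ^ k) (\<lambda>w. G w ^ k)"
proof (induction k)
  case 0
  thus ?case using level2_const[of 1] by simp
next
  case (Suc k)
  have "int (Suc k) * n = n + int k * n" by (simp add: algebra_simps)
  thus ?case using level2_mult[OF Suc.prems Suc.IH[OF Suc.prems]] by simp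
qed

lemma Im_inversion: "Im \<tau> > 0 \<Longrightarrow> Im (- 1 / \<tau>) > 0"
  by (cases "\<tau> = 0") (auto simp: Im_divide')

lemma ex_onto_punctured_ball:
  assumes "z \<in> ball 0 1" "z \<noteq> 0"
  obtains \<tau> where "Im \<tau> > 0" "ex \<tau> = z"
proof
  have "ln (norm z) < 0" using assms by (auto simp: ln_less_zero_iff)
  thus "Im (Ln z / (2 * of_real pi * \<i>)) > 0"
    using assms by (simp add: Im_divide' divide_neg_pos zero_less_mult_iff mult_less_0_iff)
  show "ex (Ln z / (2 * of_real pi * \<i>)) = z" using assms by simp
qed

lemma level2_inversion':
  assumes "level2 n F G" "Im \<tau> > 0"
  shows "G (ex (- 1 / (2 * \<tau>))) = (\<tau> ^ 2) powi n * F (ex \<tau>)"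
proof -
  have \<tau>: "\<tau> \<noteq> 0" using assms by auto
  have "F (ex (- 1 / (- 1 / \<tau>))) = ((- 1 / \<tau>) ^ 2) powi n * G (ex ((- 1 / \<tau>) / 2))"
    using Im_inversion[OF assms(2)] by (intro level2D(3)[OF assms(1)])
  moreover have "- 1 / (- 1 / \<tau>) = \<tau>" "(- 1 / \<tau>) / 2 = - 1 / (2 * \<tau>)" "(- 1 / \<tau>) ^ 2 =
      inverse (\<tau> ^ 2)"
    using \<tau> by (simp_all add: power2_eq_square field_simps)
  ultimately have "F (ex \<tau>) = inverse (\<tau> ^ 2) powi n * G (ex (- 1 / (2 * \<tau>)))"
    by (simp only:)
  thus ?thesis using \<tau> by (simp add: power_int_inverse)
qed

text \<open>The half plane covers only the punctured disc, so identities obtained through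
  \<open>ex\<close> reach the point 0, which is the cusp, by continuity.\<close>

lemma ball_eq_at_0:
  fixes F G :: "complex \<Rightarrow> complex"
  assumes "F holomorphic_on ball 0 1" "G holomorphic_on ball 0 1"
    and eq: "\<And>z. z \<in> ball 0 1 - {0} \<Longrightarrow> F z = G z" and z: "z \<in> ball 0 1"
  shows "F z = G z"
proof (cases "z = 0")
  case True
  have "isCont F 0" "isCont G 0"
    using assms by (auto intro!: continuous_on_interior holomorphic_on_imp_continuous_on)
  hence "F \<midarrow>0\<rightarrow> F 0" "G \<midarrow>0\<rightarrow> G 0" by (auto simp: isCont_def)
  moreover have "\<forall>\<^sub>F z in at 0. z \<in> ball 0 1 - {0 :: complex}"
    by (intro eventually_at_in_open) auto
  hence "\<forall>\<^sub>F z in at 0. G z = F z"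
    by eventually_elim (use eq in auto)
  ultimately have "F \<midarrow>0\<rightarrow> G 0" "F \<midarrow>0\<rightarrow> F 0"
    using Lim_transform_eventually[of G "G 0" "at 0" F] by auto
  thus ?thesis using True LIM_unique by blast
qed (use assms in auto)

text \<open>By inversion the values of G on the punctured disc are values of F up to the automorphy
  factor.\<close>

lemma level2_unique:
  assumes "level2 n F G" "level2 n F' G'" "\<And>z. z \<in> ball 0 1 \<Longrightarrow> F z = F' z" "z \<in> ball 0 1"
  shows "G z = G' z"
proof (rule ball_eq_at_0[OF level2D(2)[OF assms(1)] level2D(2)[OF assms(2)] _ assms(4)])
  fix z :: complex assume "z \<in> ball 0 1 - {0}"
  then obtain u where u: "Im u > 0" "ex u = z"
    using ex_onto_punctured_ball[of z] by auto
  define \<tau> where "\<tau> = - 1 / (2 * u)"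
  have \<tau>: "Im \<tau> > 0" using Im_inversion[of "2 * u"] u by (simp add: \<tau>_def)
  have u': "u = - 1 / (2 * \<tau>)" using u(1) by (auto simp: \<tau>_def field_simps)
  have z: "z = ex (- 1 / (2 * \<tau>))"
    using u(2) by (subst u' [symmetric]) (rule sym)
  show "G z = G' z"
    unfolding z level2_inversion'[OF assms(1) \<tau>] level2_inversion'[OF assms(2) \<tau>]
    using assms(3)[of "ex \<tau>"] \<tau> by simp
qed

section \<open>Conjugates of a form under SL_2(Z)\<close>

lemma ex_add_int: "ex (\<tau> + of_int k) = ex \<tau>"
  using exp_plus_2pin[of "2 * of_real pi * \<i> * \<tau>" k] by (simp add: algebra_simps)

lemma ex_half_add_int: "ex ((\<tau> + of_int k) / 2) = (if even k then ex (\<tau> / 2) else - ex (\<tau> / 2))"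
proof -
  have "ex ((\<tau> + of_int k) / 2) = ex (\<tau> / 2) * exp (of_int k * (of_real pi * \<i>))"
    by (simp add: exp_add [symmetric] algebra_simps add_divide_distrib)
  also have "exp (of_int k * (of_real pi * \<i>)) = (- 1) powi k"
    by (simp add: exp_power_int [symmetric])
  finally show ?thesis by (auto simp: power_int_minus_left)
qed

lemma ex_half_square: "ex (\<tau> / 2) ^ 2 = ex \<tau>"
  by (simp add: mult_ac flip: exp_of_nat_mult)

text \<open>The three conjugates of a form under $SL_2(\mathbb{Z})$, selected by the parities of
  the bottom row $(c, d)$, in terms of $q^{1/2}$.\<close>

definition conjugate :: "(complex \<Rightarrow> complex) \<Rightarrow> (complex \<Rightarrow> complex) \<Rightarrow> int \<Rightarrow> int \<Rightarrow> complex \<Rightarrow>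
    complex" where
  "conjugate F G c d w = (if even c then F (w ^ 2) else if even d then G w else G (- w))"

text \<open>Two of the parity cases are the defining relation and its inverse. For c and r odd, put
  u = -1/t + 1; then -1/u = -1/(t - 1) - 1, which is the relation S T S = T^-1 S T^-1, so that both
  sides become the same value of F.\<close>

lemma conjugate_inversion:
  assumes l: "level2 n F G" and t: "Im t > 0" and cr: "odd c \<or> odd r"
  shows "conjugate F G r (- c) (ex ((- 1 / t) / 2)) = (t ^ 2) powi n * conjugate F G c r (ex (t / 2))"
proof -
  have t0: "t \<noteq> 0" using t by auto
  have half: "(- 1 / t) / 2 = - 1 / (2 * t)" by simp
  consider "even r" "odd c" | "odd r" "even c" | "odd r" "odd c" using cr by auto
  thus ?thesis
  proof cases
    case 1
    thus ?thesis using level2D(3)[OF l t] ex_half_square[of "- 1 / t"] by (simp add: conjugate_def)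
  next
    case 2
    thus ?thesis using level2_inversion'[OF l t] ex_half_square[of t]
        by (simp add: conjugate_def half)
  next
    case 3
    define u where "u = - 1 / t + 1"
    have u: "Im u > 0" using Im_inversion[OF t] by (simp add: u_def)
    have t1: "Im (t - 1) > 0" using t by simp
    have u0: "u \<noteq> 0" and t10: "t - 1 \<noteq> 0" using u t1 by auto
    have eq: "- 1 / u = - 1 / (t - 1) + of_int (- 1)"
      using t0 t10 u0 by (simp add: u_def field_simps)
    have "- ex ((- 1 / t) / 2) = ex (u / 2)"
      using ex_half_add_int[of "- 1 / t" 1] by (simp add: u_def)
    hence "conjugate F G r (- c) (ex ((- 1 / t) / 2)) = G (ex (u / 2))"
      using 3 by (simp add: conjugate_def)
    moreover have "F (ex (- 1 / u)) = (u ^ 2) powi n * G (ex (u / 2))"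
      by (rule level2D(3)[OF l u])
    moreover have "F (ex (- 1 / u)) = ((t - 1) ^ 2) powi n * G (ex ((t - 1) / 2))"
      unfolding eq ex_add_int by (rule level2D(3)[OF l t1])
    moreover have "ex ((t - 1) / 2) = - ex (t / 2)"
      using ex_half_add_int[of t "- 1"] by simp
    moreover have "(t - 1) ^ 2 = t ^ 2 * u ^ 2"
      using t0 by (simp add: u_def field_simps power2_eq_square)
    ultimately show ?thesis
      using u0 3 by (simp add: conjugate_def power_int_mult_distrib)
  qed
qed

text \<open>Euclid's algorithm on the bottom row: with d = k c + r, translating by k and inverting
  replaces (c, d) by (r, -c), and |r| < |c|. The automorphy factor enters only through its square,
  so the sign of the matrix does not matter.\<close>

theorem level2_conjugate:
  assumes l: "level2 n F G" and "Im \<tau> > 0" and "a * d - b * c = 1"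
  shows "F (ex ((of_int a * \<tau> + of_int b) / (of_int c * \<tau> + of_int d))) =
           ((of_int c * \<tau> + of_int d) ^ 2) powi n * conjugate F G c d (ex (\<tau> / 2))"
  using assms(2,3)
proof (induction "nat \<bar>c\<bar>" arbitrary: a b c d \<tau> rule: less_induct)
  case less
  show ?case
  proof (cases "c = 0")
    case True
    hence "a * d = 1" using less.prems by simp
    hence "a = d \<and> d = 1 \<or> a = d \<and> d = - 1"
      using zmult_eq_1_iff by auto
    hence "(of_int a * \<tau> + of_int b) / (of_int c * \<tau> + of_int d) = \<tau> + of_int (b * d)"
      and d: "(of_int c * \<tau> + of_int d) ^ 2 = (1 :: complex)"
      using True by auto
    hence "F (ex ((of_int a * \<tau> + of_int b) / (of_int c * \<tau> + of_int d))) = F (ex \<tau>)"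
      by (simp only: ex_add_int)
    thus ?thesis unfolding d using True ex_half_square[of \<tau>] by (simp add: conjugate_def)
  next
    case False
    define k r where "k = d div c" and "r = d mod c"
    have d: "d = k * c + r" by (simp add: k_def r_def)
    define b' where "b' = b - k * a"
    define t where "t = \<tau> + of_int k"
    have t: "Im t > 0" using less.prems by (simp add: t_def)
    have t0: "t \<noteq> 0" using t by auto
    have "\<bar>r\<bar> < \<bar>c\<bar>"
      using False abs_mod_less by (simp add: r_def)
    hence "F (ex ((of_int b' * (- 1 / t) + of_int (- a)) / (of_int r * (- 1 / t) + of_int (- c)))) =
           ((of_int r * (- 1 / t) + of_int (- c)) ^ 2) powi n * conjugate F G r (- c) (ex ((- 1 /
               t) / 2))"
      using less.prems(2) by (intro less.hyps Im_inversion t) (auto simp: b'_def d algebra_simps)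
    also have den: "of_int r * (- 1 / t) + of_int (- c) = - (of_int c * \<tau> + of_int d) / t"
      using t0 by (simp add: d t_def field_simps)
    also have "of_int b' * (- 1 / t) + of_int (- a) = - (of_int a * \<tau> + of_int b) / t"
      using t0 by (simp add: b'_def t_def field_simps)
    also have "- (of_int a * \<tau> + of_int b) / t / (- (of_int c * \<tau> + of_int d) / t) = 
        (of_int a * \<tau> + of_int b) / (of_int c * \<tau> + of_int d)"
    proof -
      have "- x / t / (- y / t) = x / y" for x y :: complex
        using t0 by simp
      thus ?thesis .
    qed
    also have "conjugate F G r (- c) (ex ((- 1 / t) / 2)) = (t ^ 2) powi n * conjugate F G c r (ex
        (t / 2))"
    proof (rule conjugate_inversion[OF l t])
      have "\<not> (even c \<and> even d)"
      proof
        assume "even c \<and> even d"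
        hence "even (a * d - b * c)" by simp
        thus False using less.prems by simp
      qed
      thus "odd c \<or> odd r" by (auto simp: d)
    qed
    also have "conjugate F G c r (ex (t / 2)) = conjugate F G c d (ex (\<tau> / 2))"
      unfolding t_def ex_half_add_int by (auto simp: conjugate_def d)
    also have "((- (of_int c * \<tau> + of_int d) / t) ^ 2) powi n * ((t ^ 2) powi n * conjugate F G c
        d (ex (\<tau> / 2))) =
      ((of_int c * \<tau> + of_int d) ^ 2) powi n * conjugate F G c d (ex (\<tau> / 2))"
    proof -
      have "((- y / t) ^ 2) powi n * ((t ^ 2) powi n * z) = (y ^ 2) powi n * z" for y z :: complex
        using t0 by (simp add: power_divide power_int_divide_distrib)
      thus ?thesis .
    qed
    finally show ?thesis .
  qed
qed

section \<open>Reduction theory and forms of weight 0\<close>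

lemma Im_SL2:
  assumes "Im \<tau> > 0" "a * d - b * c = (1::int)"
  shows "Im ((of_int a * \<tau> + of_int b) / (of_int c * \<tau> + of_int d)) = Im \<tau> / norm (of_int c * \<tau> +
      of_int d) ^ 2"
    "of_int c * \<tau> + of_int d \<noteq> 0"
proof -
  have "real_of_int (a * d - b * c) = 1" using assms by simp
  hence det: "real_of_int a * real_of_int d - real_of_int b * real_of_int c = 1" by simp
  have "Im \<tau> = Im \<tau> * (real_of_int a * real_of_int d - real_of_int b * real_of_int c)"
      using det by simp
  thus "Im ((of_int a * \<tau> + of_int b) / (of_int c * \<tau> + of_int d)) = Im \<tau> / norm (of_int c * \<tau> +
      of_int d) ^ 2"
    by (simp add: Im_divide' algebra_simps)
  show "of_int c * \<tau> + of_int d \<noteq> 0"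
  proof
    assume eq: "of_int c * \<tau> + of_int d = 0"
    hence "Im (of_int c * \<tau> + of_int d) = 0" by simp
    hence "c = 0" using assms by simp
    thus False using eq assms(2) by simp
  qed
qed

text \<open>Dirichlet approximation of $\mathrm{Re}\,\tau$ replaces the fundamental domain.\<close>

lemma exists_SL2_large_Im:
  assumes \<tau>: "Im \<tau> > 0"
  obtains a b c d :: int where "a * d - b * c = 1"
    "Im ((of_int a * \<tau> + of_int b) / (of_int c * \<tau> + of_int d)) \<ge> 1 / 5"
proof (cases "Im \<tau> \<ge> 1 / 5")
  case True
  thus ?thesis using that[of 1 1 0 0] by simp
next
  case False
  define y where "y = Im \<tau>"
  have y: "0 < y" "y < 1 / 5" using \<tau> False by (auto simp: y_def)
  \<comment> \<open>With N about 1/sqrt y the real part of k \<tau> - h is at most s and its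
    imaginary part k y is at most s + y \<le> 2 s. Hence |k \<tau> - h|^2 \<le> 5 y, the origin of
    1/5; coprimality of h and k completes (k, -h) to a matrix.\<close>
  define s where "s = sqrt y"
  have s: "s > 0" "s < 1" "s * s = y" using y by (auto simp: s_def real_sqrt_lt_1_iff)
  define N where "N = nat \<lceil>1 / s\<rceil>"
  have N: "1 / s \<le> real N" "real N \<le> 1 / s + 1" using s(1) by (auto simp: N_def)
  have "real N > 0" using N s(1) by (meson less_le_trans zero_less_divide_1_iff)
  hence "N > 0" by simp
  then obtain h k where hk: "coprime h k" "0 < k" "k \<le> int N" "\<bar>of_int k * Re \<tau> - of_int h\<bar> < 1 / N"
    using Dirichlet_approx_coprime by blast
  obtain u v where "u * h + v * k = gcd h k" using bezout_int by blast
  hence uv: "(- u) * (- h) - (- v) * k = 1" using hk by simp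
  have "1 \<le> N * s" using N s by (simp add: field_simps)
  have "norm (of_int k * \<tau> + of_int (- h)) ^ 2 = (of_int k * Re \<tau> - of_int h) ^ 2 +
      (of_int k * y) ^ 2"
    by (simp add: cmod_power2 y_def)
  also have "(of_int k * Re \<tau> - of_int h) ^ 2 \<le> (1 / N) ^ 2"
    using hk(4) by (intro abs_le_square_iff[THEN iffD1]) auto
  also have "\<dots> \<le> s ^ 2"
    using \<open>1 \<le> N * s\<close> \<open>N > 0\<close> s by (intro power_mono) (auto simp: field_simps)
  also have "(of_int k * y) ^ 2 \<le> (2 * s) ^ 2"
  proof (rule power_mono)
    have "of_int k * y \<le> real N * y" using hk(3) y by (intro mult_right_mono) auto
    also have "\<dots> \<le> (1 / s + 1) * y" using N y by (intro mult_right_mono) auto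
    also have "\<dots> = s + y" using s by (simp add: field_simps flip: s(3))
    also have "y \<le> s" using s mult_left_mono[of s 1 s] by simp
    finally show "of_int k * y \<le> 2 * s" by simp
  qed (use hk y in auto)
  also have "s ^ 2 + (2 * s) ^ 2 = 5 * y" using s by (simp add: power2_eq_square)
  finally have "norm (of_int k * \<tau> + of_int (- h)) ^ 2 \<le> 5 * y" by simp
  moreover have "norm (of_int k * \<tau> + of_int (- h)) > 0" using Im_SL2(2)[OF \<tau> uv] by simp
  ultimately have "1 / 5 \<le> Im \<tau> / norm (of_int k * \<tau> + of_int (- h)) ^ 2"
    by (simp add: y_def field_simps)
  thus ?thesis using that[OF uv] Im_SL2(1)[OF \<tau> uv] by simp
qed

text \<open>The largest modulus in the compact set K is attained by F or G at a point of modulus at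
  most \<rho>, in the interior of the disc. All values of both functions lie in K, so whichever
  attains it is constant; if that is G, inversion hands the constant on to F.\<close>

theorem level2_weight_0_constant:
  assumes l: "level2 0 F G"
  obtains c where "\<And>z. z \<in> ball 0 1 \<Longrightarrow> F z = c"
proof -
  note hol = level2D(1,2)[OF l]
  \<comment> \<open>This is the modulus of q^(1/2) at height 1/5.\<close>
  define \<rho> where "\<rho> = exp (- (pi / 5))"
  have \<rho>: "0 < \<rho>" "\<rho> < 1" by (simp_all add: \<rho>_def)
  define K where "K = F ` cball 0 \<rho> \<union> G ` cball 0 \<rho>"
  have F_K: "F (ex \<tau>) \<in> K" if \<tau>: "Im \<tau> > 0" for \<tau>
  proof -
    obtain a b c d :: int where abcd: "a * d - b * c = 1"
      "Im ((of_int a * \<tau> + of_int b) / (of_int c * \<tau> + of_int d)) \<ge> 1 / 5"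
      by (rule exists_SL2_large_Im[OF \<tau>])
    define t where "t = (of_int a * \<tau> + of_int b) / (of_int c * \<tau> + of_int d)"
    have t: "Im t \<ge> 1 / 5" using abcd by (simp add: t_def)
    have nz: "of_int c * \<tau> + of_int d \<noteq> 0" using Im_SL2(2)[OF \<tau> abcd(1)] .
    have det: "d * a - (- b) * (- c) = 1" using abcd(1) by (simp add: algebra_simps)
    have nz': "of_int (- c) * t + of_int a \<noteq> 0" using Im_SL2(2)[of t, OF _ det] t by auto
    have "t * (of_int c * \<tau> + of_int d) = of_int a * \<tau> + of_int b"
      using nz by (simp add: t_def)
    hence "\<tau> * (of_int (- c) * t + of_int a) = of_int d * t + of_int (- b)"
      by (simp add: algebra_simps)
    hence "\<tau> = (of_int d * t + of_int (- b)) / (of_int (- c) * t + of_int a)"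
      by (subst nonzero_eq_divide_eq[OF nz'])
    with level2_conjugate[OF l _ det, of t] t have "F (ex \<tau>) = conjugate F G (- c) a (ex (t / 2))"
      by simp
    moreover have "norm (ex (t / 2)) \<le> \<rho>"
      using t pi_gt_zero mult_left_mono[of "1 / 5" "Im t" pi] by (simp add: \<rho>_def)
    moreover have "conjugate F G (- c) a z \<in> K" if "norm z \<le> \<rho>" for z
    proof -
      have "norm z * norm z \<le> \<rho> * 1"
        using that \<rho> by (intro mult_mono) auto
      thus ?thesis
        using that unfolding K_def conjugate_def by (auto simp: power2_eq_square norm_mult)
    qed
    ultimately show ?thesis by metis
  qed
  have F_in: "F z \<in> K" if "z \<in> ball 0 1" for z
  proof (cases "z = 0")
    case True
    thus ?thesis using \<rho> by (auto simp: K_def)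
  qed (use F_K ex_onto_punctured_ball[OF that] in blast)
  have G_in: "G z \<in> K" if z: "z \<in> ball 0 1" for z
  proof (cases "z = 0")
    case True
    thus ?thesis using \<rho> by (auto simp: K_def)
  next
    case False
    then obtain u where u: "Im u > 0" "ex u = z" using ex_onto_punctured_ball[OF z] by blast
    have "Im (2 * u) > 0" using u by simp
    from level2D(3)[OF l this] F_K[OF Im_inversion[OF this]] u show ?thesis by simp
  qed
  have "compact K"
    unfolding K_def using \<rho> hol by (intro compact_Un compact_continuous_image)
      (auto intro!: holomorphic_on_imp_continuous_on elim!: holomorphic_on_subset)
  moreover have "K \<noteq> {}" using \<rho> by (auto simp: K_def)
  ultimately obtain v where v: "v \<in> K" "\<And>u. u \<in> K \<Longrightarrow> norm u \<le> norm v"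
    using continuous_attains_sup[of K norm] continuous_on_norm_id by blast
  have const: "H constant_on ball 0 1"
    if "H holomorphic_on ball 0 1" "v = H w" "norm w \<le> \<rho>" "\<And>z. z \<in> ball 0 1 \<Longrightarrow> H z \<in> K" for H w
    by (rule maximum_modulus_principle[where U = "ball 0 1" and \<xi> = w]) (use that \<rho> v in auto)
  from v(1) consider "F constant_on ball 0 1" | "G constant_on ball 0 1"
    using const[OF hol(1) _ _ F_in] const[OF hol(2) _ _ G_in] by (auto simp: K_def)
  thus ?thesis
  proof cases
    case 1
    thus ?thesis using that by (auto simp: constant_on_def)
  next
    case 2
    then obtain c where c: "\<And>z. z \<in> ball 0 1 \<Longrightarrow> G z = c" by (auto simp: constant_on_def)
    have "F z = c" if "z \<in> ball 0 1" for z
    proof (rule ball_eq_at_0[OF hol(1) _ _ that, of "\<lambda>_. c"])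
      fix z :: complex assume "z \<in> ball 0 1 - {0}"
      then obtain \<tau> where \<tau>: "Im \<tau> > 0" "ex \<tau> = z" using ex_onto_punctured_ball[of z] by auto
      have "Im (- 1 / (2 * \<tau>)) > 0" using Im_inversion[of "2 * \<tau>"] \<tau> by simp
      from norm_ex_less[OF this] have "G (ex (- 1 / (2 * \<tau>))) = c"
        by (intro c) (simp only: mem_ball_0)
      with level2_inversion'[OF l \<tau>(1)] show "F z = c"
        using \<tau>(2) by (simp only: power_int_0_right mult_1_left)
    qed auto
    thus ?thesis using that by blast
  qed
qed

section \<open>The ring of forms\<close>

lemma holomorphic_on_ball_square:
  assumes "f holomorphic_on ball 0 1"
  shows "(\<lambda>w. f (w ^ 2)) holomorphic_on ball 0 (1::real)"
  by (rule holomorphic_on_compose_gen[OF _ assms, of "\<lambda>w. w ^ 2", unfolded o_def])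
     (auto intro!: holomorphic_intros simp: norm_power power_less_one_iff)

lemma DERIV_square_at_0:
  assumes "(f has_field_derivative D) (at (0::complex))"
  shows "((\<lambda>w. f (w ^ 2)) has_field_derivative 0) (at 0)"
proof -
  have f: "(f has_field_derivative D) (at (0 ^ 2))" using assms by simp
  have "((\<lambda>w. w ^ 2) has_field_derivative 0) (at (0::complex))"
    by (auto intro!: derivative_eq_intros)
  from DERIV_chain2[where f = f and g = "\<lambda>w. w ^ 2" and x = 0, OF f this] show ?thesis
    by simp
qed

lemma E2_holomorphic: "E2 holomorphic_on ball 0 1"
proof -
  have "(\<lambda>q. 1 - 24 * sigma_series 1 q) holomorphic_on ball 0 1"
    by (intro holomorphic_intros qser_holomorphic polynomially_bounded_sigma)
  thus ?thesis by (rule holomorphic_transform) (simp add: E2_conv_qser)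
qed

lemma E4_holomorphic: "E4 holomorphic_on ball 0 1"
proof -
  have "(\<lambda>q. 1 + 240 * sigma_series 3 q) holomorphic_on ball 0 1"
    by (intro holomorphic_intros qser_holomorphic polynomially_bounded_sigma)
  thus ?thesis by (rule holomorphic_transform) (simp add: E4_conv_qser)
qed

lemma E2_0: "E2 0 = 1" and E4_0: "E4 0 = 1"
  by (simp_all add: E2_def E4_def)

lemma qser_sigma_DERIV_0: "(sigma_series j has_field_derivative 1) (at 0)"
  using holomorphic_derivI[OF qser_holomorphic[OF polynomially_bounded_sigma], of 0 j UNIV]
        qser_deriv_0[OF polynomially_bounded_sigma, of j] sigma_1[of j] by simp

lemma E2_DERIV_0: "(E2 has_field_derivative - 24) (at 0)"
proof -
  have "((\<lambda>q. 1 - 24 * sigma_series 1 q) has_field_derivative - 24) (at 0)"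
    by (rule derivative_eq_intros qser_sigma_DERIV_0 refl | simp)+
  thus ?thesis
    by (rule has_field_derivative_transform_within_open[where S =
        "ball 0 1"]) (auto simp: E2_conv_qser)
qed

lemma E4_DERIV_0: "(E4 has_field_derivative 240) (at 0)"
proof -
  have "((\<lambda>q. 1 + 240 * sigma_series 3 q) has_field_derivative 240) (at 0)"
    by (rule derivative_eq_intros qser_sigma_DERIV_0 refl | simp)+
  thus ?thesis
    by (rule has_field_derivative_transform_within_open[where S =
        "ball 0 1"]) (auto simp: E4_conv_qser)
qed

definition Q_exp :: "complex \<Rightarrow> complex" where "Q_exp w = 2 * E2 (w ^ 2) - E2 w"
text \<open>The expansion of Q2 at the cusp 0, in the variable q^(1/2).\<close>

definition Q_exp0 :: "complex \<Rightarrow> complex" where "Q_exp0 w = E2 w / 2 - E2 (w ^ 2)"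
text \<open>\<open>A_exp\<close> is eta(2 \<tau>)^16/eta(\<tau>)^8 and \<open>B_exp\<close> is
  eta(\<tau>)^16/eta(2 \<tau>)^8, with the powers of q collected: (2*16 - 8)/24 = 1 for the former
  and (16 - 2*8)/24 = 0 for the latter. Up to constants, inversion exchanges them.\<close>

definition A_exp :: "complex \<Rightarrow> complex" where "A_exp w = w * Euler_product (w ^ 2) ^ 16 /
    Euler_product w ^ 8"
definition B_exp :: "complex \<Rightarrow> complex" where "B_exp w = Euler_product w ^ 16 / Euler_product (w ^
    2) ^ 8"

lemma norm_square_less_one: "norm (w::complex) < 1 \<Longrightarrow> norm (w ^ 2) < 1"
  by (simp add: norm_power power_less_one_iff)

lemma A_exp_holomorphic: "A_exp holomorphic_on ball 0 1"
  unfolding A_exp_def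
  by (intro holomorphic_intros holomorphic_on_ball_square Euler_product_holomorphic) (auto simp:
      Euler_product_nonzero)

lemma B_exp_holomorphic: "B_exp holomorphic_on ball 0 1"
  unfolding B_exp_def
  by (intro holomorphic_intros holomorphic_on_ball_square Euler_product_holomorphic)
     (auto simp: Euler_product_nonzero norm_square_less_one)

lemma A_exp_0: "A_exp 0 = 0" and B_exp_0: "B_exp 0 = 1"
  by (simp_all add: A_exp_def B_exp_def Euler_product_0)

lemma A_exp_nonzero: "norm w < 1 \<Longrightarrow> w \<noteq> 0 \<Longrightarrow> A_exp w \<noteq> 0"
  and B_exp_nonzero: "norm w < 1 \<Longrightarrow> B_exp w \<noteq> 0"
  by (simp_all add: A_exp_def B_exp_def Euler_product_nonzero norm_square_less_one)

lemma Euler_product_DERIV_0: "(Euler_product has_field_derivative - 1) (at 0)"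
  using holomorphic_derivI[OF Euler_product_holomorphic, of 0 UNIV]
      by (simp add: Euler_product_deriv_0)

lemma A_exp_DERIV_0: "(A_exp has_field_derivative 1) (at 0)"
  unfolding A_exp_def[abs_def]
  by (rule derivative_eq_intros Euler_product_DERIV_0 DERIV_square_at_0 refl | simp add:
      Euler_product_0)+

lemma B_exp_DERIV_0: "(B_exp has_field_derivative - 16) (at 0)"
  unfolding B_exp_def[abs_def]
  by (rule derivative_eq_intros Euler_product_DERIV_0 DERIV_square_at_0 refl | simp add:
      Euler_product_0)+

lemma Q_exp_0: "Q_exp 0 = 1" and Q_exp0_0: "Q_exp0 0 = - 1 / 2"
  by (simp_all add: Q_exp_def Q_exp0_def E2_0)

lemma Q_exp_DERIV_0: "(Q_exp has_field_derivative 24) (at 0)"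
  unfolding Q_exp_def[abs_def]
  by (rule derivative_eq_intros E2_DERIV_0 DERIV_square_at_0 refl | simp)+

lemma ex_double: "ex (2 * \<tau>) = ex \<tau> ^ 2"
  by (simp add: mult_ac flip: exp_of_nat_mult)

lemma eta_double_exp: "exp (2 * of_real pi * \<i> * (2 * \<tau>) / 24) =
    exp (2 * of_real pi * \<i> * \<tau> / 24) ^ 2"
  "ex \<tau> = exp (2 * of_real pi * \<i> * \<tau> / 24) ^ 24"
  by (simp_all add: mult_ac flip: exp_of_nat_mult)

lemma A_exp_ex:
  assumes "Im \<tau> > 0"
  shows "A_exp (ex \<tau>) = (eta (2 * \<tau>) ^ 8) ^ 2 / eta \<tau> ^ 8"
proof -
  define e where "e = exp (2 * of_real pi * \<i> * \<tau> / 24)"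
  have "e \<noteq> 0" by (simp add: e_def)
  moreover have "Euler_product (ex \<tau>) \<noteq> 0" using assms by (intro Euler_product_nonzero) simp
  ultimately have "e ^ 24 * Euler_product (ex \<tau> ^ 2) ^ 16 / Euler_product (ex \<tau>) ^ 8 =
       ((e ^ 2 * Euler_product (ex \<tau> ^ 2)) ^ 8) ^ 2 / (e * Euler_product (ex \<tau>)) ^ 8"
    by (simp add: power_mult_distrib field_simps flip: power_mult power_add)
  thus ?thesis
    unfolding A_exp_def eta_conv_Euler_product eta_double_exp(1) ex_double e_def
        eta_double_exp(2)[symmetric] .
qed

lemma B_exp_ex:
  assumes "Im \<tau> > 0"
  shows "B_exp (ex \<tau>) = (eta \<tau> ^ 8) ^ 2 / eta (2 * \<tau>) ^ 8"
proof -
  define e where "e = exp (2 * of_real pi * \<i> * \<tau> / 24)"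
  have "e \<noteq> 0" by (simp add: e_def)
  moreover have "Euler_product (ex \<tau> ^ 2) \<noteq> 0"
    using assms by (intro Euler_product_nonzero norm_square_less_one) simp
  ultimately have "Euler_product (ex \<tau>) ^ 16 / Euler_product (ex \<tau> ^ 2) ^ 8 =
       ((e * Euler_product (ex \<tau>)) ^ 8) ^ 2 / (e ^ 2 * Euler_product (ex \<tau> ^ 2)) ^ 8"
    by (simp add: power_mult_distrib field_simps flip: power_mult power_add)
  thus ?thesis
    unfolding B_exp_def eta_conv_Euler_product eta_double_exp(1) ex_double e_def .
qed

lemma eta_half_inversion:
  assumes "Im \<tau> > 0"
  shows "eta (2 * (- 1 / \<tau>)) ^ 8 = \<tau> ^ 4 / 16 * eta (\<tau> / 2) ^ 8"
proof -
  have "2 * (- 1 / \<tau>) = - 1 / (\<tau> / 2)" by simp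
  thus ?thesis
    using eta_power_8_inversion[of "\<tau> / 2"] assms by (simp add: power_divide del:
        divide_divide_eq_right)
qed

text \<open>The constant 256 is the square of the 16 in the inversion of eta(2 \<tau>)^8; for B that
  factor stands once in the denominator and gives 16.\<close>

lemma level2_A: "level2 2 A_exp (\<lambda>w. B_exp w / 256)"
  unfolding level2_def
proof (intro conjI allI impI)
  fix \<tau> :: complex assume \<tau>: "Im \<tau> > 0"
  have "\<tau> \<noteq> 0" "eta \<tau> \<noteq> 0" using \<tau> eta_nonzero by auto
  thus "A_exp (ex (- 1 / \<tau>)) = (\<tau> ^ 2) powi 2 * (B_exp (ex (\<tau> / 2)) / 256)"
    unfolding A_exp_ex[OF Im_inversion[OF \<tau>]] eta_half_inversion[OF \<tau>] eta_power_8_inversion[OF \<tau>]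
    using B_exp_ex[of "\<tau> / 2"] \<tau> by (simp add: field_simps flip: power_mult power_add)
qed (auto intro!: holomorphic_intros A_exp_holomorphic B_exp_holomorphic)

lemma level2_B: "level2 2 B_exp (\<lambda>w. 16 * A_exp w)"
  unfolding level2_def
proof (intro conjI allI impI)
  fix \<tau> :: complex assume \<tau>: "Im \<tau> > 0"
  have "\<tau> \<noteq> 0" "eta (\<tau> / 2) \<noteq> 0" using \<tau> eta_nonzero[of "\<tau> / 2"] by auto
  thus "B_exp (ex (- 1 / \<tau>)) = (\<tau> ^ 2) powi 2 * (16 * A_exp (ex (\<tau> / 2)))"
    unfolding B_exp_ex[OF Im_inversion[OF \<tau>]] eta_half_inversion[OF \<tau>] eta_power_8_inversion[OF \<tau>]
    using A_exp_ex[of "\<tau> / 2"] \<tau> by (simp add: field_simps flip: power_mult power_add)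
qed (auto intro!: holomorphic_intros A_exp_holomorphic B_exp_holomorphic)

lemma E2_half_inversion:
  assumes "Im \<tau> > 0"
  shows "E2 (ex (- 1 / \<tau>) ^ 2) = \<tau> ^ 2 / 4 * E2 (ex (\<tau> / 2)) + 3 * \<tau> / (of_real pi * \<i>)"
proof -
  have "- 1 / (\<tau> / 2) = 2 * (- 1 / \<tau>)"
    by simp
  hence "ex (- 1 / \<tau>) ^ 2 = ex (- 1 / (\<tau> / 2))"
    by (simp only: ex_double)
  thus ?thesis
    using E2_inversion[of "\<tau> / 2"] assms by (simp add: power_divide del: divide_divide_eq_right)
qed

text \<open>The non-modular term of E2(q^2) is half that of E2(q), so it cancels in 2 E2(q^2) -
  E2(q).\<close>

lemma level2_Q: "level2 1 Q_exp Q_exp0"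
  unfolding level2_def
proof (intro conjI allI impI)
  fix \<tau> :: complex assume \<tau>: "Im \<tau> > 0"
  show "Q_exp (ex (- 1 / \<tau>)) = (\<tau> ^ 2) powi 1 * Q_exp0 (ex (\<tau> / 2))"
    unfolding Q_exp_def E2_half_inversion[OF \<tau>] E2_inversion[OF \<tau>] Q_exp0_def ex_half_square
    by (simp add: algebra_simps)
qed (unfold Q_exp_def Q_exp0_def, (intro holomorphic_intros holomorphic_on_ball_square
    E2_holomorphic; simp)+)

section \<open>Descent through division by A\<close>

text \<open>At infinity the simple zero of A is cancelled by that of F; at the cusp 0 the expansion
  of A is B/256, which has no zero on the disc. Hence both expansions of the quotient are
  holomorphic.\<close>

lemma level2_divide_A:
  assumes l: "level2 n F G" and F0: "F 0 = 0"
  obtains F' G' where "level2 (n - 2) F' G'" "\<And>z. z \<in> ball 0 1 \<Longrightarrow> F z = A_exp z * F' z"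
proof -
  define H where "H = (\<lambda>z. if z = 0 then deriv F 0 else (F z - F 0) / (z - 0))"
  have H: "H holomorphic_on ball 0 1"
    unfolding H_def by (rule pole_lemma[OF level2D(1)[OF l]]) auto
  have FH: "F z = z * H z" for z by (simp add: H_def F0)
  define F' where "F' = (\<lambda>z. H z * Euler_product z ^ 8 / Euler_product (z ^ 2) ^ 16)"
  have F': "F z = A_exp z * F' z" if "z \<in> ball 0 1" for z
    using that by (simp add: FH[of z] A_exp_def F'_def Euler_product_nonzero norm_square_less_one)
  have "level2 (n - 2) F' (\<lambda>z. 256 * G z / B_exp z)"
    unfolding level2_def
  proof (intro conjI allI impI)
    fix \<tau> :: complex assume \<tau>: "Im \<tau> > 0"
    define z where "z = ex (- 1 / \<tau>)"
    have z: "z \<in> ball 0 1" using norm_ex_less[OF Im_inversion[OF \<tau>]] by (simp only: z_def mem_ball_0)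
    have "A_exp z \<noteq> 0" using z by (intro A_exp_nonzero) (auto simp: z_def)
    hence "F' z = F z / A_exp z" using F'[OF z] by simp
    also have "\<dots> = (\<tau> ^ 2) powi n * G (ex (\<tau> / 2)) / ((\<tau> ^ 2) powi 2 * (B_exp (ex (\<tau> / 2)) / 256))"
      unfolding z_def level2D(3)[OF l \<tau>] level2D(3)[OF level2_A \<tau>] ..
    also have "\<dots> = (\<tau> ^ 2) powi (n - 2) * (256 * G (ex (\<tau> / 2)) / B_exp (ex (\<tau> / 2)))"
      using \<tau> by (subst power_int_diff) auto
    finally show "F' (ex (- 1 / \<tau>)) = (\<tau> ^ 2) powi (n - 2) * (256 * G (ex (\<tau> / 2))
        / B_exp (ex (\<tau> / 2)))"
      by (simp only: z_def)
  next
    show "F' holomorphic_on ball 0 1"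
      unfolding F'_def by (intro holomorphic_intros holomorphic_on_ball_square
          Euler_product_holomorphic H)
        (auto simp: Euler_product_nonzero norm_square_less_one)
    show "(\<lambda>z. 256 * G z / B_exp z) holomorphic_on ball 0 1"
      by (intro holomorphic_intros level2D[OF l] B_exp_holomorphic) (auto simp: B_exp_nonzero)
  qed
  thus ?thesis using that F' by blast
qed

lemma level2_DERIV_0: "level2 n F G \<Longrightarrow> (F has_field_derivative deriv F 0) (at 0)"
  by (rule holomorphic_derivI[OF level2D(1)]) auto

text \<open>The quotient by A has weight 0 and is a constant c; since A = q + ..., this c is the
  derivative of F at 0.\<close>

lemma level2_weight_4_double_zero:
  assumes "level2 2 F G" "F 0 = 0" "deriv F 0 = 0" "z \<in> ball 0 1"
  shows "F z = 0"
proof -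
  obtain F' G' where F': "level2 0 F' G'" "\<And>z. z \<in> ball 0 1 \<Longrightarrow> F z = A_exp z * F' z"
    using level2_divide_A[OF assms(1,2)] by auto
  from F'(1) obtain c where "\<And>z. z \<in> ball 0 1 \<Longrightarrow> F' z = c"
    by (rule level2_weight_0_constant) blast
  hence F: "\<And>z. z \<in> ball 0 1 \<Longrightarrow> F z = A_exp z * c" using F' by simp
  have "((\<lambda>z. A_exp z * c) has_field_derivative c) (at 0)"
    using DERIV_cmult_right[OF A_exp_DERIV_0, of c] by simp
  hence "(F has_field_derivative c) (at 0)"
    by (rule has_field_derivative_transform_within_open[where S = "ball 0 1"]) (auto simp: F)
  hence "c = 0" using assms(3) DERIV_imp_deriv by blast
  thus ?thesis using F[OF assms(4)] by simp
qed

text \<open>Squaring leads to weight 4 and turns the zero at infinity into a double one.\<close>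

lemma level2_weight_2_cusp:
  assumes l: "level2 1 F G" and F0: "F 0 = 0" and z: "z \<in> ball 0 1"
  shows "F z = 0"
proof -
  have l2: "level2 2 (\<lambda>z. F z ^ 2) (\<lambda>z. G z ^ 2)"
    using level2_power[OF l, of 2] by simp
  have "((\<lambda>z. F z ^ 2) has_field_derivative 0) (at 0)"
    using DERIV_power[OF level2_DERIV_0[OF l], of 2] F0 by simp
  hence "F z ^ 2 = 0"
    by (intro level2_weight_4_double_zero[OF l2 _ DERIV_imp_deriv z]) (use F0 in simp)
  thus ?thesis by simp
qed

text \<open>The square makes the weight divisible by 4, so that a power of A brings it to 0. The
  resulting constant is 0 because A vanishes at infinity, and A has no other zero.\<close>

lemma level2_negative_weight:
  assumes l: "level2 n F G" and n: "n < 0" and z: "z \<in> ball 0 1"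
  shows "F z = 0"
proof -
  define m where "m = nat (- n)"
  have "int m * 2 + 2 * n = 0" "m > 0" using n by (auto simp: m_def)
  with level2_mult[OF level2_power[OF level2_A, of m] level2_power[OF l, of 2]]
  have "level2 0 (\<lambda>z. A_exp z ^ m * F z ^ 2) (\<lambda>z. (B_exp z / 256) ^ m * G z ^ 2)"
    by simp
  then obtain c where c: "\<And>z. z \<in> ball 0 1 \<Longrightarrow> A_exp z ^ m * F z ^ 2 = c"
    by (rule level2_weight_0_constant) blast
  have "c = 0" using c[of 0] \<open>m > 0\<close> by (simp add: A_exp_0 power_0_left)
  show ?thesis
  proof (rule ball_eq_at_0[OF level2D(1)[OF l] _ _ z])
    show "F z = 0" if "z \<in> ball 0 1 - {0}" for z
      using c[of z] that \<open>c = 0\<close> A_exp_nonzero[of z] by auto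
  qed auto
qed

theorem level2_decompose:
  assumes l: "level2 (int n) F G"
  obtains (0) c where "n = 0" "\<And>z. z \<in> ball 0 1 \<Longrightarrow> F z = c"
    | (1) c where "n = 1" "\<And>z. z \<in> ball 0 1 \<Longrightarrow> F z = c * Q_exp z"
    | (2) m c F' G' where "n = m + 2" "level2 (int m) F' G'"
       "\<And>z. z \<in> ball 0 1 \<Longrightarrow> F z = c * Q_exp z ^ n + A_exp z * F' z"
proof -
  have "level2 (int n) (\<lambda>w. Q_exp w ^ n) (\<lambda>w. Q_exp0 w ^ n)"
    using level2_power[OF level2_Q, of n] by simp
  note d = level2_diff[OF l level2_cmult[OF this, of "F 0"]]
  have d0: "F 0 - F 0 * Q_exp 0 ^ n = 0" by (simp add: Q_exp_0)
  consider "n = 0" | "n = 1" | m where "n = m + 2"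
    by (metis One_nat_def Suc_eq_plus1 add_2_eq_Suc' not0_implies_Suc)
  thus ?thesis
  proof cases
    assume n: "n = 0"
    with l have "level2 0 F G" by simp
    then obtain c where "\<And>z. z \<in> ball 0 1 \<Longrightarrow> F z = c" by (rule level2_weight_0_constant) blast
    with n show ?thesis by (rule 0)
  next
    assume n: "n = 1"
    show ?thesis
    proof (rule 1[OF n])
      fix z :: complex assume z: "z \<in> ball 0 1"
      have "level2 1 (\<lambda>w. F w - F 0 * Q_exp w ^ n) (\<lambda>w. G w - F 0 * Q_exp0 w ^ n)"
        using d n by simp
      hence "F z - F 0 * Q_exp z ^ n = 0"
        using d0 z by (rule level2_weight_2_cusp)
      thus "F z = F 0 * Q_exp z" by (simp add: n)
    qed
  next
    fix m assume n: "n = m + 2"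
    from level2_divide_A[OF d d0] obtain F' G' where F': "level2 (int n - 2) F' G'"
      "\<And>z. z \<in> ball 0 1 \<Longrightarrow> F z - F 0 * Q_exp z ^ n = A_exp z * F' z" by blast
    show ?thesis
    proof (rule 2[OF n])
      show "level2 (int m) F' G'" using F'(1) by (simp add: n)
      show "F z = F 0 * Q_exp z ^ n + A_exp z * F' z" if "z \<in> ball 0 1" for z
        using F'(2)[OF that] by (simp add: algebra_simps)
    qed
  qed
qed

text \<open>Q2^2 = 1 + 48 q + ... and A = q + ..., so the right-hand side is the combination with
  the constant term and the first coefficient of F; the difference has a double zero. The formula
  for G follows since F determines G, and it gives access to the constant term at the other
  cusp.\<close>

lemma level2_weight_4:
  assumes l: "level2 2 F G" and D: "(F has_field_derivative D) (at 0)" and z: "z \<in> ball 0 1"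
  shows "F z = F 0 * Q_exp z ^ 2 + (D - 48 * F 0) * A_exp z"
    "G z = F 0 * Q_exp0 z ^ 2 + (D - 48 * F 0) * (B_exp z / 256)"
proof -
  have "level2 2 (\<lambda>z. Q_exp z ^ 2) (\<lambda>z. Q_exp0 z ^ 2)"
    using level2_power[OF level2_Q, of 2] by simp
  hence l': "level2 2 (\<lambda>z. F 0 * Q_exp z ^ 2 + (D - 48 * F 0) * A_exp z) (\<lambda>z. F 0 * Q_exp0 z ^ 2 +
      (D - 48 * F 0) * (B_exp z / 256))"
    by (intro level2_add level2_cmult level2_A)
  note d = level2_diff[OF l this]
  have "((\<lambda>z. F z - (F 0 * Q_exp z ^ 2 + (D - 48 * F 0) * A_exp z)) has_field_derivative 0) (at 0)"
    by (rule derivative_eq_intros D Q_exp_DERIV_0 A_exp_DERIV_0 refl | simp add: Q_exp_0)+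
  hence eq: "F z = F 0 * Q_exp z ^ 2 + (D - 48 * F 0) * A_exp z" if "z \<in> ball 0 1" for z
    using level2_weight_4_double_zero[OF d _ _ that] by (simp add: Q_exp_0 A_exp_0 DERIV_imp_deriv)
  show "F z = F 0 * Q_exp z ^ 2 + (D - 48 * F 0) * A_exp z" by (rule eq[OF z])
  show "G z = F 0 * Q_exp0 z ^ 2 + (D - 48 * F 0) * (B_exp z / 256)"
    by (rule level2_unique[OF l l' eq z])
qed

section \<open>Ramanujan's equation for E2 and the inversion of E4\<close>

text \<open>The derivative of the inversion formula of E2. After multiplication by 12 its two
  non-modular terms are those of E2^2, so that 12 E2' - E2^2 transforms with weight 4.\<close>

lemma E2_theta_inversion:
  assumes \<tau>: "Im \<tau> > 0"
  defines "\<theta> \<equiv> \<lambda>w. w * deriv E2 w"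
  shows "\<theta> (ex (- 1 / \<tau>)) = \<tau> ^ 4 * \<theta> (ex \<tau>) + \<tau> ^ 3 * E2 (ex \<tau>) / (of_real pi * \<i>) +
      3 * \<tau> ^ 2 / (of_real pi * \<i>) ^ 2"
proof -
  have chain: "((\<lambda>u. E2 (ex u)) has_field_derivative 2 * of_real pi * \<i> * \<theta> (ex v)) (at v)"
      if "Im v > 0" for v
  proof -
    have "ex v \<in> ball 0 1" using norm_ex_less[OF that] by (simp only: mem_ball_0)
    hence E: "(E2 has_field_derivative deriv E2 (ex v)) (at (ex v))"
      by (intro holomorphic_derivI[OF E2_holomorphic]) auto
    have "(ex has_field_derivative ex v * (2 * of_real pi * \<i>)) (at v)"
      by (auto intro!: derivative_eq_intros)
    from DERIV_chain2[where f = E2 and g = ex and x = v, OF E this]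
    show ?thesis by (simp add: \<theta>_def mult_ac)
  qed
  have [simp]: "\<tau> \<noteq> 0" using \<tau> by auto
  have "((\<lambda>z. - 1 / z) has_field_derivative 1 / \<tau> ^ 2) (at \<tau>)"
    by (auto intro!: derivative_eq_intros simp: power2_eq_square)
  from DERIV_chain2[OF chain[OF Im_inversion[OF \<tau>]] this]
  have 1: "((\<lambda>u. E2 (ex (- 1 / u))) has_field_derivative 2 * of_real pi * \<i> * \<theta> (ex (- 1 / \<tau>))
      * (1 / \<tau> ^ 2)) (at \<tau>)" .
  have "((\<lambda>u. u ^ 2 * E2 (ex u) + 6 * u / (of_real pi * \<i>)) has_field_derivative
      2 * \<tau> * E2 (ex \<tau>) + (2 * of_real pi * \<i> * \<theta> (ex \<tau>)) * \<tau> ^ 2 + 6 / (of_real pi * \<i>)) (at \<tau>)"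
    by (rule derivative_eq_intros chain[OF \<tau>] refl | simp)+
  hence "((\<lambda>u. E2 (ex (- 1 / u))) has_field_derivative
      2 * \<tau> * E2 (ex \<tau>) + (2 * of_real pi * \<i> * \<theta> (ex \<tau>)) * \<tau> ^ 2 + 6 / (of_real pi * \<i>)) (at \<tau>)"
    by (rule has_field_derivative_transform_within_open[where S = "{u. Im u > 0}"])
       (use \<tau> E2_inversion in \<open>auto simp: open_halfspace_Im_gt\<close>)
  from DERIV_unique[OF 1 this] 
  have "2 * of_real pi * \<i> * \<theta> (ex (- 1 / \<tau>)) * (1 / \<tau> ^ 2) = 2 * \<tau> * E2 (ex \<tau>) +
      (2 * of_real pi * \<i> * \<theta> (ex \<tau>)) * \<tau> ^ 2 + 6 / (of_real pi * \<i>)" .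
  hence "\<tau> ^ 2 / (2 * of_real pi * \<i>) * (2 * of_real pi * \<i> * \<theta> (ex (- 1 / \<tau>)) * (1 / \<tau> ^ 2)) =
     \<tau> ^ 2 / (2 * of_real pi * \<i>) * (2 * \<tau> * E2 (ex \<tau>) + (2 * of_real pi * \<i> * \<theta> (ex \<tau>)) * \<tau> ^ 2 +
         6 / (of_real pi * \<i>))"
    by (rule arg_cong)
  also have "\<tau> ^ 2 / (2 * of_real pi * \<i>) * (2 * of_real pi * \<i> * \<theta> (ex (- 1 / \<tau>)) * (1 / \<tau> ^ 2))
      = \<theta> (ex (- 1 / \<tau>))"
    by (simp add: field_simps)
  also have "\<tau> ^ 2 / (2 * of_real pi * \<i>) * (2 * \<tau> * E2 (ex \<tau>) + (2 * of_real pi * \<i> * \<theta> (ex \<tau>))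
      * \<tau> ^ 2 + 6 / (of_real pi * \<i>)) =
      \<tau> ^ 4 * \<theta> (ex \<tau>) + \<tau> ^ 3 * E2 (ex \<tau>) / (of_real pi * \<i>) + 3 * \<tau> ^ 2 / (of_real pi * \<i>) ^ 2"
    by (simp add: field_simps power2_eq_square power3_eq_cube power4_eq_xxxx)
  finally show ?thesis .
qed

lemma level2_level1:
  assumes "F holomorphic_on ball 0 1" "\<And>\<tau>. Im \<tau> > 0 \<Longrightarrow> F (ex (- 1 / \<tau>)) = \<tau> ^ (2 * n) * F (ex \<tau>)"
  shows "level2 (int n) F (\<lambda>w. F (w ^ 2))"
  unfolding level2_def ex_half_square using assms holomorphic_on_ball_square[OF assms(1)]
  by (simp add: power_mult)

text \<open>The form F has constant term C - 1 and first coefficient -288 + 48 + 240 = 0, so F = (C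
  - 1)(Q2^2 - 48 A). As a form of level 1 it has the same constant term at both cusps, whereas the
  right-hand side has (C - 1)(1/4 - 48/256) = (C - 1)/16 at the cusp 0. This forces C = 1, which
  settles both the constant term of E4 and the vanishing of F.\<close>

theorem Ramanujan_E2_and_E4_inversion:
  shows Ramanujan_E2: "z \<in> ball 0 1 \<Longrightarrow> 12 * (z * deriv E2 z) = E2 z ^ 2 - E4 z"
    and E4_inversion: "Im \<tau> > 0 \<Longrightarrow> E4 (ex (- 1 / \<tau>)) = \<tau> ^ 4 * E4 (ex \<tau>)"
proof -
  define S where "S = sigma_series 3"
  obtain C where C: "\<And>\<tau>. Im \<tau> > 0 \<Longrightarrow> C + 240 * S (ex (- 1 / \<tau>)) = \<tau> ^ 4 * (C + 240 * S (ex \<tau>))"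
    unfolding S_def by (rule weight_4_Eisenstein_inversion) blast
  define F where "F = (\<lambda>w. 12 * (w * deriv E2 w) - E2 w ^ 2 + (C + 240 * S w))"
  have S_hol: "S holomorphic_on ball 0 1"
    unfolding S_def by (intro qser_holomorphic polynomially_bounded_sigma)
  have E2'_hol: "deriv E2 holomorphic_on ball 0 1"
    by (intro holomorphic_deriv E2_holomorphic) auto
  have l: "level2 (int 2) F (\<lambda>w. F (w ^ 2))"
  proof (rule level2_level1)
    show "F holomorphic_on ball 0 1"
      unfolding F_def by (intro holomorphic_intros S_hol E2'_hol E2_holomorphic)
    fix \<tau> :: complex assume \<tau>: "Im \<tau> > 0"
    show "F (ex (- 1 / \<tau>)) = \<tau> ^ (2 * 2) * F (ex \<tau>)"
      unfolding F_def E2_theta_inversion[OF \<tau>] E2_inversion[OF \<tau>] C[OF \<tau>]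
      by (simp add: field_simps power2_eq_square power3_eq_cube power4_eq_xxxx)
  qed
  have E2'_0: "deriv E2 0 = - 24" by (rule DERIV_imp_deriv[OF E2_DERIV_0])
  have "(deriv E2 has_field_derivative deriv (deriv E2) 0) (at 0)"
    by (rule holomorphic_derivI[OF E2'_hol]) auto
  hence D: "(F has_field_derivative 0) (at 0)"
    unfolding F_def S_def
    by (auto intro!: derivative_eq_intros qser_sigma_DERIV_0 E2_DERIV_0 simp: E2_0 E2'_0)
  have F0: "F 0 = C - 1" by (simp add: F_def S_def E2_0 qser_at_0 sigma_0)
  have "F (0 ^ 2) = F 0 * Q_exp0 0 ^ 2 + (0 - 48 * F 0) * (B_exp 0 / 256)"
    by (rule level2_weight_4(2)[OF _ D, of "\<lambda>w. F (w ^ 2)" 0]) (use l in auto)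
  hence "(C - 1) * 240 = 0" by (simp add: F0 Q_exp0_0 B_exp_0 power2_eq_square field_simps)
  hence "C = 1" by simp
  hence E4: "C + 240 * S z = E4 z" if "norm z < 1" for z
    using E4_conv_qser[OF that] by (simp add: S_def)
  show "12 * (z * deriv E2 z) = E2 z ^ 2 - E4 z" if "z \<in> ball 0 1"
  proof -
    have "level2 2 F (\<lambda>w. F (w ^ 2))" using l by simp
    from level2_weight_4(1)[OF this D that] have "F z = 0" by (simp add: F0 \<open>C = 1\<close>)
    moreover have "E4 z = C + 240 * S z" using E4[of z] that by simp
    ultimately show ?thesis by (simp only: F_def) (simp add: algebra_simps)
  qed
  show "E4 (ex (- 1 / \<tau>)) = \<tau> ^ 4 * E4 (ex \<tau>)" if \<tau>: "Im \<tau> > 0"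
    using C[OF \<tau>] E4[OF norm_ex_less[OF \<tau>]] E4[OF norm_ex_less[OF Im_inversion[OF \<tau>]]] by (simp only:)
qed

lemma E4_half_inversion:
  assumes "Im \<tau> > 0"
  shows "E4 (ex (- 1 / \<tau>) ^ 2) = \<tau> ^ 4 / 16 * E4 (ex (\<tau> / 2))"
proof -
  have "- 1 / (\<tau> / 2) = 2 * (- 1 / \<tau>)"
    by simp
  hence "ex (- 1 / \<tau>) ^ 2 = ex (- 1 / (\<tau> / 2))"
    by (simp only: ex_double)
  thus ?thesis
    using E4_inversion[of "\<tau> / 2"] assms by (simp add: power_divide del: divide_divide_eq_right)
qed

lemma level2_E4: "level2 2 E4 (\<lambda>w. E4 (w ^ 2))"
  using level2_level1[OF E4_holomorphic, of 2] E4_inversion by simp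

lemma level2_E4_square: "level2 2 (\<lambda>w. E4 (w ^ 2)) (\<lambda>w. E4 w / 16)"
  unfolding level2_def using E4_half_inversion
  by (auto intro!: holomorphic_intros E4_holomorphic holomorphic_on_ball_square simp flip: power_mult)

section \<open>Identities between forms of weight 4\<close>

definition R_exp :: "complex \<Rightarrow> complex" where "R_exp w = 1 / 3 * (4 * E4 (w ^ 2) - E4 w)"
definition R_exp0 :: "complex \<Rightarrow> complex" where "R_exp0 w = 1 / 3 * (4 * (E4 w / 16) - E4 (w ^ 2))"

lemma level2_R: "level2 2 R_exp R_exp0"
  unfolding R_exp_def[abs_def] R_exp0_def[abs_def]
  by (intro level2_cmult level2_diff level2_E4 level2_E4_square)

lemma E4_square_DERIV_0: "((\<lambda>w. E4 (w ^ 2)) has_field_derivative 0) (at 0)"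
  by (rule DERIV_square_at_0[OF E4_DERIV_0])

lemma R_exp_eq:
  assumes "z \<in> ball 0 1"
  shows "R_exp z = Q_exp z ^ 2 - 128 * A_exp z"
proof -
  \<comment> \<open>The first coefficient is -240/3 = -80, and -80 - 48 = -128.\<close>
  have "(R_exp has_field_derivative - 80) (at 0)"
    unfolding R_exp_def[abs_def] by (rule derivative_eq_intros E4_DERIV_0 E4_square_DERIV_0 refl |
        simp)+
  from level2_weight_4(1)[OF level2_R this assms] show ?thesis by (simp add: R_exp_def E4_0)
qed

text \<open>E4(q) = Q2^2 + 192 A and E4(q^2) = Q2^2 - 48 A, so A drops out when the second is taken
  four times.\<close>

lemma Q_exp_square_eq:
  assumes "z \<in> ball 0 1"
  shows "5 * Q_exp z ^ 2 = E4 z + 4 * E4 (z ^ 2)"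
  using level2_weight_4(1)[OF level2_E4 E4_DERIV_0 assms] level2_weight_4(1)[OF level2_E4_square
      E4_square_DERIV_0 assms]
  by (simp add: E4_0)

lemma B_exp_eq:
  assumes "z \<in> ball 0 1"
  shows "B_exp z = Q_exp z ^ 2 - 64 * A_exp z"
  using level2_weight_4(1)[OF level2_B B_exp_DERIV_0 assms] by (simp add: B_exp_0)

section \<open>Periodic functions and the differential equations\<close>

text \<open>In the variable w = \<open>ex z\<close> growth like a power of Im z is growth like a
  power of log(1/|w|), so w F(w) tends to 0 and the singularity at w = 0 is removable. A bound on a
  vertical strip is enough because the principal logarithm chooses a representative there.\<close>

theorem periodic_expansion:
  fixes f :: "complex \<Rightarrow> complex"
  assumes hol: "f holomorphic_on {z. Im z > 0}"
    and per: "\<And>z. Im z > 0 \<Longrightarrow> f (z + 1) = f z"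
    and growth: "\<And>z. Im z \<ge> 1 \<Longrightarrow> \<bar>Re z\<bar> \<le> 1 \<Longrightarrow> norm (f z) \<le> C * Im z ^ m"
  shows "\<exists>F. F holomorphic_on ball 0 1 \<and> (\<forall>z. Im z > 0 \<longrightarrow> f z = F (ex z))"
proof -
  have per_nat: "f (z + of_nat k) = f z" if "Im z > 0" for z k
    using that per[of "z + of_nat k" for k] by (induction k) (auto simp: add_ac)
  have per_int: "f (z + of_int k) = f z" if "Im z > 0" for z k
    using per_nat[of z "nat k"] per_nat[of "z + of_int k" "nat (- k)"] that by (cases "k \<ge> 0") auto
  define F where "F = (\<lambda>w. f (Ln w / (2 * of_real pi * \<i>)))"
  have F: "F w = f z" if "ex z = w" "Im z > 0" for z w
  proof -
    have w: "w \<in> ball 0 1" "w \<noteq> 0" using that by auto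
    have "exp (Ln w) = exp (2 * of_real pi * \<i> * z)" using w that by simp
    then obtain k :: int where "Ln w = 2 * of_real pi * \<i> * z + of_int (2 * k) * of_real pi * \<i>"
      by (auto simp: exp_eq)
    hence "Ln w / (2 * of_real pi * \<i>) = z + of_int k"
      by (simp add: field_simps)
    thus ?thesis using per_int[OF that(2)] by (simp add: F_def)
  qed
  have F_hol: "F holomorphic_on (ball 0 1 - {0})"
  proof (rule holomorphic_onI)
    fix w :: complex assume w: "w \<in> ball 0 1 - {0}"
    define S where "S = (ball 0 1 - {0}) \<inter> {u. u / w \<in> - \<real>\<^sub>\<le>\<^sub>0}"
    have "open {u. u / w \<in> - \<real>\<^sub>\<le>\<^sub>0}"
      using w by (intro open_vimage[unfolded vimage_def]) (auto intro!: continuous_intros)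
    hence S: "open S" "w \<in> S" using w by (auto simp: S_def)
    \<comment> \<open>A branch of the logarithm cut opposite to w, which is holomorphic near w even
      when w lies on the negative real axis; by periodicity it yields the same F.\<close>
    define L where "L = (\<lambda>u. (Ln (u / w) + Ln w) / (2 * of_real pi * \<i>))"
    have exL: "ex (L u) = u" if "u \<in> S" for u
      using that w by (auto simp: L_def S_def exp_add)
    have ImL: "Im (L u) > 0" if "u \<in> S" for u
    proof -
      have "norm (ex (L u)) < 1" using that by (simp only: exL) (auto simp: S_def)
      thus ?thesis by (simp add: zero_less_mult_iff)
    qed
    have "(\<lambda>u. f (L u)) holomorphic_on S"
    proof (rule holomorphic_on_compose_gen[OF _ hol, unfolded o_def])
      show "L holomorphic_on S"
        unfolding L_def using w by (intro holomorphic_intros) (auto simp: S_def)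
    qed (use ImL in auto)
    hence "F holomorphic_on S"
      by (rule holomorphic_transform) (use F exL ImL in metis)
    thus "F field_differentiable at w within (ball 0 1 - {0})"
      using S by (meson holomorphic_on_imp_differentiable_at field_differentiable_at_within)
  qed
  have "((\<lambda>w. (w - 0) * F w) \<longlongrightarrow> 0) (at 0)"
  proof (rule Lim_null_comparison)
    \<comment> \<open>\<open>y w\<close> is the imaginary part of the point of the half plane above
      w, so |w| = exp(-2 pi y).\<close>
    define y where "y = (\<lambda>w::complex. 1 / (2 * pi) * (- ln (norm w)))"
    have "filterlim (norm :: complex \<Rightarrow> real) (at_right 0) (at 0)"
      using tendsto_norm_zero[OF tendsto_ident_at[of "0::complex" UNIV]]
          by (auto simp: filterlim_at eventually_at_filter)
    hence "filterlim (\<lambda>w::complex. - ln (norm w)) at_top (at 0)"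
      by (auto simp: filterlim_uminus_at_top intro: filterlim_compose[OF ln_at_0])
    hence lim: "filterlim y at_top (at 0)"
      unfolding y_def by (intro filterlim_tendsto_pos_mult_at_top[OF tendsto_const]) auto
    have "((\<lambda>w. C * (y w ^ m / exp (y w))) \<longlongrightarrow> C * 0) (at 0)"
      by (intro tendsto_mult tendsto_const filterlim_compose[OF tendsto_power_div_exp_0 lim])
    thus "((\<lambda>w. C * (y w ^ m / exp (y w))) \<longlongrightarrow> 0) (at 0)" by simp
    show "\<forall>\<^sub>F w in at 0. norm ((w - 0) * F w) \<le> C * (y w ^ m / exp (y w))"
    proof -
      have "\<forall>\<^sub>F w in at 0. w \<in> ball 0 1 - {0 :: complex}"
        by (intro eventually_at_in_open) auto
      moreover have "\<forall>\<^sub>F w in at 0. y w \<ge> 1"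
        using lim by (auto simp: filterlim_at_top)
      ultimately show ?thesis
      proof eventually_elim
        case (elim w)
        define z where "z = Ln w / (2 * of_real pi * \<i>)"
        have z_eq: "z = of_real (1 / (2 * pi)) * (- \<i> * Ln w)"
          by (simp add: z_def field_simps)
        have z: "Im z = y w"
          unfolding z_eq using elim by (simp add: y_def)
        have "\<bar>Re z\<bar> = \<bar>Im (Ln w)\<bar> / (2 * pi)"
          unfolding z_eq by (simp add: abs_mult)
        also have "\<dots> \<le> 1"
          using elim Im_Ln_le_pi[of w] mpi_less_Im_Ln[of w] by (simp add: abs_le_iff)
        finally have z': "\<bar>Re z\<bar> \<le> 1" .
        have "norm w = exp (- 2 * pi * y w)" using elim by (simp add: y_def)
        also have "\<dots> \<le> exp (- y w)"
          using elim pi_gt3 mult_right_mono[of 1 "2 * pi" "y w"] by simp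
        finally have "norm w \<le> 1 / exp (y w)" by (simp add: exp_minus divide_inverse)
        moreover have "norm (F w) \<le> C * y w ^ m"
          using growth[of z] z z' elim by (simp add: F_def z_def)
        ultimately have "norm w * norm (F w) \<le> 1 / exp (y w) * (C * y w ^ m)"
          by (intro mult_mono) auto
        thus ?case by (simp add: norm_mult mult_ac)
      qed
    qed
  qed
  with holomorphic_on_extend_lim[OF F_hol] obtain g where g: "g holomorphic_on ball 0 1"
      "\<And>z. z \<in> ball 0 1 - {0} \<Longrightarrow> g z = F z"
    by auto
  show ?thesis
  proof (intro exI[of _ g] conjI allI impI g(1))
    fix z :: complex assume z: "Im z > 0"
    hence "ex z \<in> ball 0 1 - {0}" by simp
    thus "f z = g (ex z)" using g(2) F[OF refl z] by metis
  qed
qed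

text \<open>Conjugating translation by 2 with S gives the element (1, 0; -2, 1) of Gamma0(2), so the
  transform of f at the cusp 0 has period 2 and g(2z) has period 1; doubling z is also why the strip
  has half-width 2. Allowing polynomial growth makes the result applicable to modular forms and to
  top coefficients of quasi-modular forms alike.\<close>

theorem level2_from_invariance:
  fixes f :: "complex \<Rightarrow> complex"
  assumes hol: "f holomorphic_on {z. Im z > 0}"
    and inv: "\<And>a b c d z. a * d - b * c = 1 \<Longrightarrow> even c \<Longrightarrow> Im z > 0 \<Longrightarrow>
       f ((of_int a * z + of_int b) / (of_int c * z + of_int d)) = ((of_int c * z +
           of_int d) ^ 2) powi n * f z"
    and growth: "\<And>z. Im z \<ge> 1 \<Longrightarrow> \<bar>Re z\<bar> \<le> 2 \<Longrightarrow> norm (f z) \<le> C * Im z ^ m"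
    and growth': "\<And>z. Im z \<ge> 1 \<Longrightarrow> \<bar>Re z\<bar> \<le> 2 \<Longrightarrow> norm (f (- 1 / z) / (z ^ 2) powi n) \<le> C' * Im z ^ m'"
  shows "\<exists>F G. level2 n F G \<and> (\<forall>z. Im z > 0 \<longrightarrow> f z = F (ex z))"
proof -
  have "f (z + 1) = f z" if "Im z > 0" for z
    using inv[of 1 1 1 0 z] that by simp
  moreover have "norm (f z) \<le> C * Im z ^ m" if "Im z \<ge> 1" "\<bar>Re z\<bar> \<le> 1" for z
    using growth that by simp
  ultimately have "\<exists>F. F holomorphic_on ball 0 1 \<and> (\<forall>z. Im z > 0 \<longrightarrow> f z = F (ex z))"
    by (rule periodic_expansion[OF hol])
  then obtain F where F: "F holomorphic_on ball 0 1" "\<And>z. Im z > 0 \<Longrightarrow> f z = F (ex z)"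
    by blast
  define g where "g = (\<lambda>z. f (- 1 / z) / (z ^ 2) powi n)"
  have g_per: "g (z + 2) = g z" if z: "Im z > 0" for z
  proof -
    have z0: "z \<noteq> 0" "z + 2 \<noteq> 0" using z by (auto simp: complex_eq_iff)
    have "f ((of_int 1 * (- 1 / z) + of_int 0) / (of_int (- 2) * (- 1 / z) + of_int 1)) =
       ((of_int (- 2) * (- 1 / z) + of_int 1) ^ 2) powi n * f (- 1 / z)"
      by (rule inv) (use Im_inversion[OF z] in auto)
    also have "of_int (- 2) * (- 1 / z) + of_int 1 = (z + 2) / z"
      using z0 by (simp add: field_simps)
    also have "(of_int 1 * (- 1 / z) + of_int 0) / ((z + 2) / z) = - 1 / (z + 2)"
      using z0 by (simp add: field_simps)
    finally show ?thesis
      using z0 by (simp add: g_def power_divide power_int_divide_distrib)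
  qed
  have nz: "z \<noteq> 0" if "Im z > 0" for z using that by auto
  have "g holomorphic_on {z. Im z > 0}"
    unfolding g_def using nz Im_inversion
    by (intro holomorphic_intros holomorphic_on_compose_gen[OF _ hol, unfolded o_def]) auto
  hence "(\<lambda>z. g (2 * z)) holomorphic_on {z. Im z > 0}"
    by (rule holomorphic_on_compose_gen[rotated, unfolded o_def]) (auto intro!: holomorphic_intros)
  moreover have "g (2 * (z + 1)) = g (2 * z)" if "Im z > 0" for z
    using g_per[of "2 * z"] that by (simp add: algebra_simps)
  moreover have "norm (g (2 * z)) \<le> (C' * 2 ^ m') * Im z ^ m'" if "Im z \<ge> 1" "\<bar>Re z\<bar> \<le> 1" for z
    using growth'[of "2 * z"] that by (simp add: g_def power_mult_distrib mult_ac)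
  ultimately have "\<exists>G. G holomorphic_on ball 0 1 \<and> (\<forall>z. Im z > 0 \<longrightarrow> g (2 * z) = G (ex z))"
    by (rule periodic_expansion)
  then obtain G where G: "G holomorphic_on ball 0 1" "\<And>z. Im z > 0 \<Longrightarrow> g (2 * z) = G (ex z)"
    by blast
  have "F (ex (- 1 / z)) = (z ^ 2) powi n * G (ex (z / 2))" if z: "Im z > 0" for z
  proof -
    have "f (- 1 / z) / (z ^ 2) powi n = G (ex (z / 2))"
      using G(2)[of "z / 2"] z by (simp add: g_def)
    hence "f (- 1 / z) = (z ^ 2) powi n * G (ex (z / 2))"
      using nz[OF z] by (simp add: field_simps)
    thus ?thesis
      using F(2)[OF Im_inversion[OF z]] by (simp only:)
  qed
  hence "level2 n F G"
    using F G by (simp add: level2_def)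
  thus ?thesis using F by blast
qed

section \<open>Expansions as functions on the upper half plane\<close>

lemma Im_of_uhp: "Im (of_uhp \<tau>) > 0"
  using of_uhp[of \<tau>] by simp

lemma of_uhp_to_uhp: "Im z > 0 \<Longrightarrow> of_uhp (to_uhp z) = z"
  by (simp add: to_uhp_inverse)

lemma norm_nome_less: "norm (nome \<tau>) < 1"
  unfolding nome_def by (rule norm_ex_less[OF Im_of_uhp])

lemma nome_in_ball: "nome \<tau> \<in> ball 0 1"
  using norm_nome_less by simp

lemma nome_to_uhp: "Im z > 0 \<Longrightarrow> nome (to_uhp z) = ex z"
  by (simp add: nome_def of_uhp_to_uhp)

lemma hol_uhp_nome:
  assumes "F holomorphic_on ball 0 1"
  shows "hol_uhp (\<lambda>\<tau>. F (nome \<tau>))"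
proof -
  have "(\<lambda>z. F (ex z)) holomorphic_on {z. Im z > 0}"
    by (rule holomorphic_on_compose_gen[OF _ assms, unfolded o_def]) (auto intro!: holomorphic_intros)
  thus ?thesis
    unfolding hol_uhp_def by (rule holomorphic_transform) (simp add: nome_to_uhp)
qed

lemma DERIV_ex_compose:
  assumes "(F has_field_derivative D) (at (ex z))"
  shows "((\<lambda>z. F (ex z)) has_field_derivative (2 * of_real pi * \<i>) * (ex z * D)) (at z)"
proof -
  have "(ex has_field_derivative ex z * (2 * of_real pi * \<i>)) (at z)"
    by (auto intro!: derivative_eq_intros)
  from DERIV_chain2[where f = F and g = ex and x = z, OF assms this] show ?thesis
    by (simp add: mult_ac)
qed

lemma qderiv_nome:
  assumes "(F has_field_derivative D) (at (nome \<tau>))"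
  shows "qderiv (\<lambda>\<tau>. F (nome \<tau>)) \<tau> = nome \<tau> * D"
proof -
  have "((\<lambda>z. F (ex z)) has_field_derivative (2 * of_real pi * \<i>) * (nome \<tau> * D)) (at (of_uhp \<tau>))"
    using DERIV_ex_compose[of F D "of_uhp \<tau>"] assms by (simp add: nome_def)
  hence "((\<lambda>z. F (nome (to_uhp z))) has_field_derivative (2 * of_real pi * \<i>) * (nome \<tau> * D))
      (at (of_uhp \<tau>))"
    by (rule has_field_derivative_transform_within_open[where S = "{z. Im z > 0}"])
       (auto simp: open_halfspace_Im_gt Im_of_uhp nome_to_uhp)
  thus ?thesis
    by (simp add: qderiv_def DERIV_imp_deriv)
qed

definition P_exp :: "complex \<Rightarrow> complex" where "P_exp w = 1 / 3 * (E2 w + 2 * E2 (w ^ 2))"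
definition \<Delta>_exp :: "complex \<Rightarrow> complex" where "\<Delta>_exp w = w * Euler_product w ^ 8 * Euler_product
    (w ^ 2) ^ 8"

lemma P2_nome: "P\<^sub>2 = (\<lambda>\<tau>. P_exp (nome \<tau>))"
  and Q2_nome: "Q\<^sub>2 = (\<lambda>\<tau>. Q_exp (nome \<tau>))"
  and R2_nome: "R\<^sub>2 = (\<lambda>\<tau>. R_exp (nome \<tau>))"
  by (simp_all add: fun_eq_iff P\<^sub>2_def P_exp_def Q\<^sub>2_def Q_exp_def R\<^sub>2_def R_exp_def)

lemma \<Delta>_exp_eq_mult:
  assumes "w \<in> ball 0 1"
  shows "\<Delta>_exp w = A_exp w * B_exp w"
  using assms by (simp add: \<Delta>_exp_def A_exp_def B_exp_def Euler_product_nonzero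
      norm_square_less_one field_simps flip: power_add)

lemma level2_\<Delta>: "level2 4 \<Delta>_exp (\<lambda>w. B_exp w / 256 * (16 * A_exp w))"
proof -
  have l: "level2 4 (\<lambda>w. A_exp w * B_exp w) (\<lambda>w. B_exp w / 256 * (16 * A_exp w))"
    using level2_mult[OF level2_A level2_B] by simp
  have "\<Delta>_exp holomorphic_on ball 0 1"
    by (rule holomorphic_transform[OF level2D(1)[OF l]]) (simp add: \<Delta>_exp_eq_mult)
  moreover have eq: "\<Delta>_exp (ex z) = A_exp (ex z) * B_exp (ex z)" if "Im z > 0" for z
    using norm_ex_less[OF that] by (intro \<Delta>_exp_eq_mult) (simp only: mem_ball_0)
  ultimately show ?thesis
    unfolding level2_def using level2D(2)[OF l]
  proof (intro conjI allI impI)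
    fix \<tau> :: complex assume \<tau>: "Im \<tau> > 0"
    show "\<Delta>_exp (ex (- 1 / \<tau>)) = (\<tau> ^ 2) powi 4 * (B_exp (ex (\<tau> / 2))
        / 256 * (16 * A_exp (ex (\<tau> / 2))))"
      unfolding eq[OF Im_inversion[OF \<tau>]] by (rule level2D(3)[OF l \<tau>])
  qed
qed

lemma \<Delta>2_nome: "\<Delta>\<^sub>2 = (\<lambda>\<tau>. \<Delta>_exp (nome \<tau>))"
proof
  fix \<tau>
  show "\<Delta>\<^sub>2 \<tau> = \<Delta>_exp (nome \<tau>)"
    unfolding \<Delta>_exp_eq_mult[OF nome_in_ball] unfolding nome_def A_exp_ex[OF Im_of_uhp]
        B_exp_ex[OF Im_of_uhp] \<Delta>\<^sub>2_def
  proof -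
    have gen: "a * b = b ^ 2 / a * (a ^ 2 / b)" if "a \<noteq> 0" "b \<noteq> 0" for a b :: complex
      using that by (simp add: power2_eq_square)
    show "eta (of_uhp \<tau>) ^ 8 * eta (2 * of_uhp \<tau>) ^ 8 = (eta (2 * of_uhp \<tau>) ^ 8)\<^sup>2 / eta (of_uhp
        \<tau>) ^ 8 *
        ((eta (of_uhp \<tau>) ^ 8)\<^sup>2 / eta (2 * of_uhp \<tau>) ^ 8)"
      by (rule gen) (use eta_nonzero[OF Im_of_uhp, of \<tau>] eta_nonzero[of "2 * of_uhp \<tau>"]
          Im_of_uhp[of \<tau>] in auto)
  qed
qed

text \<open>With R2 = Q2^2 - 128 A the difference of squares factors as 128 A (2 Q2^2 - 128 A) = 256
  A B.\<close>

lemma \<Delta>2_eq: "\<Delta>\<^sub>2 \<tau> = 1 / 256 * (Q\<^sub>2 \<tau> ^ 4 - R\<^sub>2 \<tau> ^ 2)"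
  unfolding \<Delta>2_nome Q2_nome R2_nome \<Delta>_exp_eq_mult[OF nome_in_ball] B_exp_eq[OF nome_in_ball]
      R_exp_eq[OF nome_in_ball]
  by (simp add: power2_eq_square power4_eq_xxxx algebra_simps)

lemma DERIV_square_compose:
  assumes "(f has_field_derivative D) (at (w ^ 2))"
  shows "((\<lambda>w. f (w ^ 2)) has_field_derivative D * (2 * w)) (at (w::complex))"
proof -
  have "((\<lambda>w. w ^ 2) has_field_derivative 2 * w) (at w)"
    by (auto intro!: derivative_eq_intros)
  from DERIV_chain2[where f = f and g = "\<lambda>w. w ^ 2" and x = w, OF assms this] show ?thesis .
qed

text \<open>The Euler product has logarithmic derivative (E2 - 1)/24 under w d/dw, with a factor 2
  more for the argument w^2. In A and in Delta2 the constants so arising cancel against the leading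
  factor w, and only combinations of E2 remain.\<close>

lemma logarithmic_derivatives:
  assumes w: "w \<in> ball 0 1"
  obtains DA D where "(A_exp has_field_derivative DA) (at w)" "w * DA =
      1 / 3 * (4 * E2 (w ^ 2) - E2 w) * A_exp w"
    "(\<Delta>_exp has_field_derivative D) (at w)" "w * D = P_exp w * \<Delta>_exp w"
proof -
  have w2: "w ^ 2 \<in> ball 0 1" using w by (simp add: norm_square_less_one)
  define e e' d d' where "e = Euler_product w" and "e' = Euler_product (w ^ 2)"
    and "d = deriv Euler_product w" and "d' = deriv Euler_product (w ^ 2)"
  have D1: "(Euler_product has_field_derivative d) (at w)"
    unfolding d_def by (rule holomorphic_derivI[OF Euler_product_holomorphic _ w]) auto
  have "(Euler_product has_field_derivative d') (at (w ^ 2))"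
    unfolding d'_def by (rule holomorphic_derivI[OF Euler_product_holomorphic _ w2]) auto
  hence D2: "((\<lambda>w. Euler_product (w ^ 2)) has_field_derivative d' * (2 * w)) (at w)"
    by (rule DERIV_square_compose)
  have nz: "e \<noteq> 0" "e' \<noteq> 0"
    using w w2 by (simp_all add: e_def e'_def Euler_product_nonzero)
  have x: "w * d = e * ((E2 w - 1) / 24)" "w ^ 2 * d' = e' * ((E2 (w ^ 2) - 1) / 24)"
    using Euler_product_deriv[of w] Euler_product_deriv[of "w ^ 2"] E2_conv_qser[of w]
        E2_conv_qser[of "w ^ 2"] w w2
    by (simp_all add: e_def e'_def d_def d'_def)
  have 1: "((\<lambda>w. Euler_product w ^ 8) has_field_derivative 8 * (d * e ^ 7)) (at w)"
    using DERIV_power[OF D1, of 8] by (simp add: e_def)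
  have 2: "((\<lambda>w. Euler_product (w ^ 2) ^ 8) has_field_derivative 8 * (d' * (2 * w) * e' ^ 7)) (at w)"
    using DERIV_power[OF D2, of 8] by (simp add: e'_def)
  have 3: "((\<lambda>w. Euler_product (w ^ 2) ^ 16) has_field_derivative 16 * (d' * (2 * w) * e' ^ 15))
      (at w)"
    using DERIV_power[OF D2, of 16] by (simp add: e'_def)
  show ?thesis
  proof (rule that)
    show "(A_exp has_field_derivative ((1 * e' ^ 16 + 16 * (d' * (2 * w) * e' ^ 15) * w) * e ^ 8 -
        w * e' ^ 16 * (8 * (d * e ^ 7))) / (e ^ 8 * e ^ 8)) (at w)"
      unfolding A_exp_def[abs_def] using nz
      by (intro DERIV_cong[OF DERIV_divide[OF DERIV_mult[OF DERIV_ident 3]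
          1]]) (simp_all add: e_def e'_def)
    have "w * (((1 * e' ^ 16 + 16 * (d' * (2 * w) * e' ^ 15) * w) * e ^ 8 - w * e' ^ 16 * (8 * (d
        * e ^ 7))) / (e ^ 8 * e ^ 8)) =
       (w * e' ^ 16 + 32 * w * (w ^ 2 * d') * e' ^ 15) / e ^ 8 - 8 * w * e' ^ 16 * (w * d) / (e *
           e ^ 8)"
      using nz by (simp add: field_simps eval_nat_numeral)
    also have "\<dots> = 1 / 3 * (4 * E2 (w ^ 2) - E2 w) * (w * e' ^ 16 / e ^ 8)"
      unfolding x using nz by (simp add: field_simps) (simp add: field_simps eval_nat_numeral)
    finally show "w * (((1 * e' ^ 16 + 16 * (d' * (2 * w) * e' ^ 15) * w) * e ^ 8 - w * e' ^ 16 *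
        (8 * (d * e ^ 7))) / (e ^ 8 * e ^ 8)) = 
       1 / 3 * (4 * E2 (w ^ 2) - E2 w) * A_exp w"
      by (simp add: A_exp_def e_def e'_def)
    show "(\<Delta>_exp has_field_derivative ((1 * e ^ 8 + 8 * (d * e ^ 7) * w) * e' ^ 8 +
        8 * (d' * (2 * w) * e' ^ 7) * (w * e ^ 8))) (at w)"
      unfolding \<Delta>_exp_def[abs_def]
      by (intro DERIV_cong[OF DERIV_mult[OF DERIV_mult[OF DERIV_ident 1] 2]]) (simp add: e_def e'_def)
    have "w * ((1 * e ^ 8 + 8 * (d * e ^ 7) * w) * e' ^ 8 + 8 * (d' * (2 * w) * e' ^ 7) * (w * e ^
        8)) =
       w * e ^ 8 * e' ^ 8 + 8 * w * (w * d) * e ^ 7 * e' ^ 8 + 16 * w * (w ^ 2 * d') * e' ^ 7 * e ^ 8"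
      by (simp add: algebra_simps power2_eq_square)
    also have "\<dots> = 1 / 3 * (E2 w + 2 * E2 (w ^ 2)) * (w * e ^ 8 * e' ^ 8)"
      unfolding x by (simp add: field_simps) (simp add: field_simps eval_nat_numeral)
    finally show "w * ((1 * e ^ 8 + 8 * (d * e ^ 7) * w) * e' ^ 8 +
        8 * (d' * (2 * w) * e' ^ 7) * (w * e ^ 8)) = P_exp w * \<Delta>_exp w"
      by (simp add: P_exp_def \<Delta>_exp_def e_def e'_def)
  qed
qed

lemma qderiv_\<Delta>2: "qderiv \<Delta>\<^sub>2 \<tau> = P\<^sub>2 \<tau> * \<Delta>\<^sub>2 \<tau>"
proof -
  obtain D where "(\<Delta>_exp has_field_derivative D) (at (nome \<tau>))" "nome \<tau> * D =
      P_exp (nome \<tau>) * \<Delta>_exp (nome \<tau>)"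
    using logarithmic_derivatives[OF nome_in_ball] by metis
  thus ?thesis unfolding \<Delta>2_nome P2_nome by (simp add: qderiv_nome)
qed

lemma P_exp_holomorphic: "P_exp holomorphic_on ball 0 1"
  unfolding P_exp_def by (intro holomorphic_intros E2_holomorphic holomorphic_on_ball_square)

text \<open>The equation for P2 combines Ramanujan's with 5 Q2^2 = E4(q) + 4 E4(q^2); the equation
  for Q2 is Ramanujan's at q and q^2. For R2 the relation R2 = Q2^2 - 128 A is differentiated, since
  differentiating E4 would bring in E6.\<close>

theorem solves_system_PQR: "solves_system P\<^sub>2 Q\<^sub>2 R\<^sub>2"
  unfolding solves_system_def
proof (intro conjI allI)
  show "hol_uhp P\<^sub>2" "hol_uhp Q\<^sub>2" "hol_uhp R\<^sub>2"
    unfolding P2_nome Q2_nome R2_nome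
    by (intro hol_uhp_nome P_exp_holomorphic level2D(1)[OF level2_Q] level2D(1)[OF level2_R])+
  fix \<tau>
  define w where "w = nome \<tau>"
  have w: "w \<in> ball 0 1" by (simp only: w_def nome_in_ball)
  have w2: "w ^ 2 \<in> ball 0 1" using w by (simp add: norm_square_less_one)
  define x y u v where "x = E2 w" and "y = E2 (w ^ 2)" and "u = E4 w" and "v = E4 (w ^ 2)"
  define D D' where "D = deriv E2 w" and "D' = deriv E2 (w ^ 2)"
  have wD: "12 * (w * D) = x ^ 2 - u" "12 * (w ^ 2 * D') = y ^ 2 - v"
    using Ramanujan_E2[OF w] Ramanujan_E2[OF w2] by (simp_all add: D_def D'_def x_def y_def u_def
        v_def)
  have 1: "(E2 has_field_derivative D) (at w)"
    unfolding D_def by (rule holomorphic_derivI[OF E2_holomorphic _ w]) auto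
  have "(E2 has_field_derivative D') (at (w ^ 2))"
    unfolding D'_def by (rule holomorphic_derivI[OF E2_holomorphic _ w2]) auto
  hence 2: "((\<lambda>w. E2 (w ^ 2)) has_field_derivative D' * (2 * w)) (at w)"
    by (rule DERIV_square_compose)
  have PQR_eq: "P\<^sub>2 \<tau> = 1 / 3 * (x + 2 * y)" "Q\<^sub>2 \<tau> = 2 * y - x" "R\<^sub>2 \<tau> = 1 / 3 * (4 * v - u)"
    by (simp_all add: P2_nome Q2_nome R2_nome P_exp_def Q_exp_def R_exp_def x_def y_def u_def
        v_def w_def)
  have QQ: "5 * (2 * y - x) ^ 2 = u + 4 * v"
    using Q_exp_square_eq[OF w] by (simp add: Q_exp_def x_def y_def u_def v_def)
  have "(P_exp has_field_derivative 1 / 3 * (D + 2 * (D' * (2 * w)))) (at w)"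
    unfolding P_exp_def[abs_def] by (intro DERIV_cmult DERIV_add 1 2)
  hence "qderiv P\<^sub>2 \<tau> = w * (1 / 3 * (D + 2 * (D' * (2 * w))))"
    unfolding P2_nome w_def by (rule qderiv_nome)
  also have "\<dots> = 1 / 36 * (12 * (w * D)) + 1 / 9 * (12 * (w ^ 2 * D'))"
    by (simp add: algebra_simps power2_eq_square)
  also have "\<dots> = 1 / 36 * (x ^ 2 + 4 * y ^ 2 - (u + 4 * v))"
    unfolding wD by (simp add: field_simps)
  also have "\<dots> = 1 / 8 * ((P\<^sub>2 \<tau>)\<^sup>2 - (Q\<^sub>2 \<tau>)\<^sup>2)"
    unfolding PQR_eq QQ[symmetric] by (simp add: field_simps power2_eq_square)
  finally show "qderiv P\<^sub>2 \<tau> = 1 / 8 * ((P\<^sub>2 \<tau>)\<^sup>2 - (Q\<^sub>2 \<tau>)\<^sup>2)" .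
  have dQ: "(Q_exp has_field_derivative (2 * (D' * (2 * w)) - D)) (at w)"
    unfolding Q_exp_def[abs_def] by (intro DERIV_cmult DERIV_diff 1 2)
  hence "qderiv Q\<^sub>2 \<tau> = w * (2 * (D' * (2 * w)) - D)"
    unfolding Q2_nome w_def by (rule qderiv_nome)
  also have "\<dots> = 1 / 3 * (12 * (w ^ 2 * D')) - 1 / 12 * (12 * (w * D))"
    by (simp add: algebra_simps power2_eq_square)
  also have Q': "\<dots> = 1 / 4 * (P\<^sub>2 \<tau> * Q\<^sub>2 \<tau> - R\<^sub>2 \<tau>)"
    unfolding wD PQR_eq by (simp add: field_simps power2_eq_square)
  finally show Q': "qderiv Q\<^sub>2 \<tau> = 1 / 4 * (P\<^sub>2 \<tau> * Q\<^sub>2 \<tau> - R\<^sub>2 \<tau>)" .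
  hence wQ: "w * (2 * (D' * (2 * w)) - D) = 1 / 4 * (P\<^sub>2 \<tau> * Q\<^sub>2 \<tau> - R\<^sub>2 \<tau>)"
    using qderiv_nome[of Q_exp _ \<tau>] dQ unfolding Q2_nome w_def by simp
  obtain DA where DA: "(A_exp has_field_derivative DA) (at w)" "w * DA =
      1 / 3 * (4 * y - x) * A_exp w"
    using logarithmic_derivatives[OF w] unfolding x_def y_def by metis
  have "((\<lambda>z. Q_exp z ^ 2 - 128 * A_exp z) has_field_derivative 2 * ((2 * (D' * (2 * w))
      - D) * Q_exp w) - 128 * DA) (at w)"
    using DERIV_diff[OF DERIV_power[OF dQ, of 2] DERIV_cmult[OF DA(1), of 128]] by simp
  hence "(R_exp has_field_derivative 2 * ((2 * (D' * (2 * w)) - D) * Q_exp w) - 128 * DA) (at w)"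
    by (rule has_field_derivative_transform_within_open[where S =
        "ball 0 1"]) (use w R_exp_eq in auto)
  hence "qderiv R\<^sub>2 \<tau> = w * (2 * ((2 * (D' * (2 * w)) - D) * Q_exp w) - 128 * DA)"
    unfolding R2_nome w_def by (rule qderiv_nome)
  also have "\<dots> = 2 * (w * (2 * (D' * (2 * w)) - D)) * Q_exp w - 128 * (w * DA)"
    by (simp add: algebra_simps)
  also have "\<dots> = 1 / 2 * (P\<^sub>2 \<tau> * Q\<^sub>2 \<tau> - R\<^sub>2 \<tau>) * Q\<^sub>2 \<tau> - 1 / 3 * (4 * y - x) * (128 * A_exp w)"
    unfolding wQ DA(2) by (simp add: Q2_nome w_def field_simps)
  also have "128 * A_exp w = Q\<^sub>2 \<tau> ^ 2 - R\<^sub>2 \<tau>"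
    using R_exp_eq[OF w] by (simp add: R2_nome Q2_nome w_def)
  \<comment> \<open>The logarithmic derivative of A is (P2 + Q2)/2; with this the right-hand side is
    a polynomial in P2, Q2 and R2.\<close>
  also have "1 / 3 * (4 * y - x) = 1 / 2 * (P\<^sub>2 \<tau> + Q\<^sub>2 \<tau>)"
    unfolding PQR_eq by (simp add: field_simps)
  also have "1 / 2 * (P\<^sub>2 \<tau> * Q\<^sub>2 \<tau> - R\<^sub>2 \<tau>) * Q\<^sub>2 \<tau> - 1 / 2 * (P\<^sub>2 \<tau> + Q\<^sub>2 \<tau>) * (Q\<^sub>2 \<tau> ^ 2 - R\<^sub>2 \<tau>) =
      1 / 2 * (P\<^sub>2 \<tau> * R\<^sub>2 \<tau> - (Q\<^sub>2 \<tau>) ^ 3)"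
    by (simp add: field_simps power2_eq_square power3_eq_cube)
  finally show "qderiv R\<^sub>2 \<tau> = 1 / 2 * (P\<^sub>2 \<tau> * R\<^sub>2 \<tau> - (Q\<^sub>2 \<tau>) ^ 3)" .
qed

section \<open>Modular forms and growth\<close>

definition mat2 :: "int \<Rightarrow> int \<Rightarrow> int \<Rightarrow> int \<Rightarrow> int^2^2" where
  "mat2 a b c d = vector [vector [a, b], vector [c, d]]"

lemma mat2_nth [simp]:
  "mat2 a b c d $ 1 $ 1 = a" "mat2 a b c d $ 1 $ 2 = b" "mat2 a b c d $ 2 $ 1 = c"
      "mat2 a b c d $ 2 $ 2 = d"
  by (simp_all add: mat2_def)

lemma in_SL2Z_iff: "A \<in> SL2Z \<longleftrightarrow> A $ 1 $ 1 * A $ 2 $ 2 - A $ 1 $ 2 * A $ 2 $ 1 = 1"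
  by (simp add: SL2Z_def det_2)

lemma in_Gamma0_2_iff: "A \<in> Gamma0 2 \<longleftrightarrow> A \<in> SL2Z \<and> even (A $ 2 $ 1)"
  by (simp add: Gamma0_def)

lemma autfactor_nonzero: "A \<in> SL2Z \<Longrightarrow> autfactor A \<tau> \<noteq> 0"
  unfolding autfactor_def using Im_SL2(2)[OF Im_of_uhp] by (simp add: in_SL2Z_iff)

lemma of_uhp_moebius:
  assumes "A \<in> SL2Z"
  shows "of_uhp (moebius A \<tau>) = (of_int (A $ 1 $ 1) * of_uhp \<tau> + of_int (A $ 1 $ 2)) / autfactor A \<tau>"
proof -
  have "Im ((of_int (A $ 1 $ 1) * of_uhp \<tau> + of_int (A $ 1 $ 2)) / autfactor A \<tau>) > 0"
    unfolding autfactor_def using assms Im_SL2[OF Im_of_uhp[of \<tau>], of "A $ 1 $ 1" "A $ 2 $ 2"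
        "A $ 1 $ 2" "A $ 2 $ 1"] Im_of_uhp[of \<tau>]
    by (simp add: in_SL2Z_iff)
  thus ?thesis by (simp add: moebius_def of_uhp_to_uhp)
qed

lemma slash_eq_iff:
  assumes "A \<in> SL2Z"
  shows "slash k A f \<tau> = x \<longleftrightarrow> f (moebius A \<tau>) = autfactor A \<tau> ^ k * x"
  using autfactor_nonzero[OF assms, of \<tau>] by (auto simp: slash_def power_int_minus field_simps)

lemma slash_level2:
  assumes "level2 (int n) F G" "A \<in> SL2Z"
  shows "slash (2 * n) A (\<lambda>\<tau>. F (nome \<tau>)) \<tau> = conjugate F G (A $ 2 $ 1) (A $ 2 $ 2) (ex (of_uhp \<tau>
      / 2))"
proof -
  have "F (nome (moebius A \<tau>)) = ((of_int (A $ 2 $ 1) * of_uhp \<tau> + of_int (A $ 2 $ 2))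
      ^ 2) powi (int n) *
     conjugate F G (A $ 2 $ 1) (A $ 2 $ 2) (ex (of_uhp \<tau> / 2))"
    unfolding nome_def of_uhp_moebius[OF assms(2)] autfactor_def
    using assms(2) by (intro level2_conjugate[OF assms(1) Im_of_uhp]) (simp add: in_SL2Z_iff)
  thus ?thesis
    unfolding slash_eq_iff[OF assms(2)] by (simp add: autfactor_def power_mult)
qed

lemma conjugate_holomorphic:
  assumes "F holomorphic_on ball 0 1" "G holomorphic_on ball 0 1"
  shows "conjugate F G c d holomorphic_on ball 0 1"
proof -
  have "(\<lambda>w. G (- w)) holomorphic_on ball 0 1"
    by (rule holomorphic_on_compose_gen[OF _ assms(2), unfolded o_def]) (auto intro!:
        holomorphic_intros)
  thus ?thesis
    unfolding conjugate_def[abs_def] using assms holomorphic_on_ball_square[OF assms(1)]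
    by (cases "even c"; cases "even d") simp_all
qed

text \<open>The parameter q^(1/2) serves all matrices at once: the cusp 0 has width 2, and a series
  in q is also one in q^(1/2).\<close>

lemma slash_level2_expands:
  assumes "level2 (int n) F G" "A \<in> SL2Z"
  shows "expands_at_infinity (slash (2 * n) A (\<lambda>\<tau>. F (nome \<tau>)))
      2 (conjugate F G (A $ 2 $ 1) (A $ 2 $ 2))"
  unfolding expands_at_infinity_def
  using slash_level2[OF assms] conjugate_holomorphic[OF level2D(1,2)[OF assms(1)]] by simp

lemma level2_modular_forms:
  assumes l: "level2 (int n) F G"
  shows "(\<lambda>\<tau>. F (nome \<tau>)) \<in> modular_forms (Gamma0 2) (2 * n)"
  unfolding modular_forms_def
proof (intro CollectI conjI ballI)
  show "hol_uhp (\<lambda>\<tau>. F (nome \<tau>))" by (rule hol_uhp_nome[OF level2D(1)[OF l]])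
  show "holomorphic_at_infinity (slash (2 * n) A (\<lambda>\<tau>. F (nome \<tau>)))" if "A \<in> SL2Z" for A
    using slash_level2_expands[OF l that] by (auto simp: holomorphic_at_infinity_def)
  show "slash (2 * n) A (\<lambda>\<tau>. F (nome \<tau>)) = (\<lambda>\<tau>. F (nome \<tau>))" if "A \<in> Gamma0 2" for A
  proof
    fix \<tau>
    have "slash (2 * n) A (\<lambda>\<tau>. F (nome \<tau>)) \<tau> = F (ex (of_uhp \<tau> / 2) ^ 2)"
      using that by (simp add: slash_level2[OF l] in_Gamma0_2_iff conjugate_def)
    thus "slash (2 * n) A (\<lambda>\<tau>. F (nome \<tau>)) \<tau> = F (nome \<tau>)"
      by (simp only: ex_half_square nome_def)
  qed
qed

lemma level2_cusp_forms:
  assumes l: "level2 (int n) F G" and "F 0 = 0" "G 0 = 0"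
  shows "(\<lambda>\<tau>. F (nome \<tau>)) \<in> cusp_forms (Gamma0 2) (2 * n)"
proof -
  have "conjugate F G c d 0 = 0" for c d
    using assms(2,3) by (simp add: conjugate_def)
  hence "vanishes_at_infinity (slash (2 * n) A (\<lambda>\<tau>. F (nome \<tau>)))" if "A \<in> SL2Z" for A
    using slash_level2_expands[OF l that] unfolding vanishes_at_infinity_def by blast
  thus ?thesis
    using level2_modular_forms[OF l] by (simp add: cusp_forms_def)
qed

lemma holomorphic_at_infinity_bounded:
  assumes "holomorphic_at_infinity f"
  shows "\<exists>C. \<forall>\<tau>. Im (of_uhp \<tau>) \<ge> 1 \<longrightarrow> norm (f \<tau>) \<le> C"
proof -
  obtain h g where h: "h > 0" and g: "g holomorphic_on ball 0 1" 
    and f: "\<And>\<tau>. f \<tau> = g (exp (2 * of_real pi * \<i> * of_uhp \<tau> / of_nat h))"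
    using assms by (auto simp: holomorphic_at_infinity_def expands_at_infinity_def)
  define r where "r = exp (- 2 * pi / h)"
  have r: "r < 1" using h by (simp add: r_def)
  have "compact (g ` cball 0 r)"
    using r by (intro compact_continuous_image holomorphic_on_imp_continuous_on
        holomorphic_on_subset[OF g]) auto
  hence "\<exists>C. \<forall>w\<in>cball 0 r. norm (g w) \<le> C"
    using compact_imp_bounded[of "g ` cball 0 r"] by (simp add: bounded_iff)
  then obtain C where C: "\<And>w. w \<in> cball 0 r \<Longrightarrow> norm (g w) \<le> C"
    by blast
  have "norm (f \<tau>) \<le> C" if "Im (of_uhp \<tau>) \<ge> 1" for \<tau>
  proof -
    have "2 * pi * 1 / h \<le> 2 * pi * Im (of_uhp \<tau>) / h"
      using that by (intro divide_right_mono mult_left_mono) auto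
    thus ?thesis unfolding f by (intro C) (simp add: r_def Im_divide_of_nat)
  qed
  thus ?thesis by blast
qed

lemma moebius_mat2_to_uhp: "Im z > 0 \<Longrightarrow> moebius (mat2 a b c d) (to_uhp z) = to_uhp ((of_int a * z +
    of_int b) / (of_int c * z + of_int d))"
  by (simp add: moebius_def autfactor_def of_uhp_to_uhp)

lemma autfactor_mat2_to_uhp: "Im z > 0 \<Longrightarrow> autfactor (mat2 a b c d) (to_uhp z) = of_int c * z +
    of_int d"
  by (simp add: autfactor_def of_uhp_to_uhp)

text \<open>The identity and S represent the two cusps of Gamma0(2). Holomorphy there gives
  boundedness on Im z \<ge> 1, that is, growth exponent 0 in the criterion above.\<close>

theorem modular_forms_level2:
  assumes f: "f \<in> modular_forms (Gamma0 2) (2 * n)"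
  obtains F G where "level2 (int n) F G" "f = (\<lambda>\<tau>. F (nome \<tau>))"
proof -
  have hol: "hol_uhp f" and inv: "\<And>A. A \<in> Gamma0 2 \<Longrightarrow> slash (2 * n) A f = f"
    and inf: "\<And>A. A \<in> SL2Z \<Longrightarrow> holomorphic_at_infinity (slash (2 * n) A f)"
    using f by (auto simp: modular_forms_def)
  define I S where "I = mat2 1 0 0 1" and "S = mat2 0 (- 1) 1 0"
  have IS: "I \<in> SL2Z" "S \<in> SL2Z" by (simp_all add: in_SL2Z_iff I_def S_def)
  have I: "slash (2 * n) I f = f"
    by (rule inv) (use IS in \<open>simp add: in_Gamma0_2_iff I_def\<close>)
  obtain C where C: "\<And>\<tau>. Im (of_uhp \<tau>) \<ge> 1 \<Longrightarrow> norm (f \<tau>) \<le> C"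
    using holomorphic_at_infinity_bounded[OF inf[OF IS(1)]] unfolding I by blast
  obtain C' where C': "\<And>\<tau>. Im (of_uhp \<tau>) \<ge> 1 \<Longrightarrow> norm (slash (2 * n) S f \<tau>) \<le> C'"
    using holomorphic_at_infinity_bounded[OF inf[OF IS(2)]] by blast
  have "\<exists>F G. level2 (int n) F G \<and> (\<forall>z. Im z > 0 \<longrightarrow> f (to_uhp z) = F (ex z))"
  proof (rule level2_from_invariance)
    show "(\<lambda>z. f (to_uhp z)) holomorphic_on {z. 0 < Im z}"
      using hol by (simp add: hol_uhp_def)
    fix a b c d z assume abcd: "a * d - b * c = (1 :: int)" "even c" "Im z > 0"
    define A where "A = mat2 a b c d"
    have A: "A \<in> SL2Z" "A \<in> Gamma0 2" using abcd by (simp_all add: in_Gamma0_2_iff in_SL2Z_iff A_def)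
    have "slash (2 * n) A f (to_uhp z) = f (to_uhp z)" by (simp only: inv[OF A(2)])
    thus "f (to_uhp ((of_int a * z + of_int b) / (of_int c * z + of_int d))) = ((of_int c * z +
        of_int d) ^ 2) powi int n * f (to_uhp z)"
      unfolding slash_eq_iff[OF A(1)] unfolding A_def moebius_mat2_to_uhp[OF abcd(3)]
          autfactor_mat2_to_uhp[OF abcd(3)]
      by (simp add: power_mult)
  next
    fix z :: complex assume z: "Im z \<ge> 1" "\<bar>Re z\<bar> \<le> 2"
    show "norm (f (to_uhp z)) \<le> C * Im z ^ 0"
      using C[of "to_uhp z"] z by (simp add: of_uhp_to_uhp)
    have "z \<noteq> 0" using z by auto
    have "slash (2 * n) S f (to_uhp z) = f (to_uhp (- 1 / z)) / (z ^ 2) powi int n"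
      unfolding slash_eq_iff[OF IS(2)] unfolding S_def
      using z \<open>z \<noteq> 0\<close> by (simp add: moebius_mat2_to_uhp autfactor_mat2_to_uhp power_mult)
    thus "norm (f (to_uhp (- 1 / z)) / (z ^ 2) powi int n) \<le> C' * Im z ^ 0"
      using C'[of "to_uhp z"] z by (simp add: of_uhp_to_uhp)
  qed
  then obtain F G where FG: "level2 (int n) F G" "\<And>z. Im z > 0 \<Longrightarrow> f (to_uhp z) = F (ex z)"
    by blast
  have "f \<tau> = F (nome \<tau>)" for \<tau>
    using FG(2)[OF Im_of_uhp[of \<tau>]] by (simp add: of_uhp_inverse nome_def)
  thus ?thesis using that FG(1) by blast
qed

lemma minus_one_in_Gamma0_2: "mat2 (- 1) 0 0 (- 1) \<in> Gamma0 2"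
  by (simp add: in_Gamma0_2_iff in_SL2Z_iff)

lemma slash_minus_one: "odd k \<Longrightarrow> slash k (mat2 (- 1) 0 0 (- 1)) f \<tau> = - f \<tau>"
  by (simp add: slash_def autfactor_def moebius_def of_uhp_inverse power_int_minus)

text \<open>The matrix -1 lies in Gamma0(2) and acts by (-1)^k.\<close>

lemma modular_forms_odd:
  assumes "f \<in> modular_forms (Gamma0 2) k" "odd k"
  shows "f = (\<lambda>_. 0)"
proof
  fix \<tau>
  have "slash k (mat2 (- 1) 0 0 (- 1)) f \<tau> = f \<tau>"
    using assms minus_one_in_Gamma0_2 by (simp add: modular_forms_def)
  thus "f \<tau> = 0" using slash_minus_one[OF assms(2), of f \<tau>] by simp
qed

lemma zero_modular_forms: "(\<lambda>_. 0) \<in> modular_forms (Gamma0 2) k"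
proof -
  have "slash k A (\<lambda>_. 0) = (\<lambda>_. 0)" for A by (simp add: slash_def fun_eq_iff)
  moreover have "holomorphic_at_infinity (\<lambda>_. 0)"
    unfolding holomorphic_at_infinity_def expands_at_infinity_def
    by (intro exI[of _ 1] exI[of _ "\<lambda>_. 0"]) auto
  ultimately show ?thesis by (simp add: modular_forms_def hol_uhp_def)
qed

text \<open>The sum is formed between expansions in the common parameters q and q^(1/2), because
  holomorphy at infinity of the summands may be witnessed by different widths h.\<close>

lemma modular_forms_add:
  assumes "f \<in> modular_forms (Gamma0 2) k" "g \<in> modular_forms (Gamma0 2) k"
  shows "(\<lambda>\<tau>. f \<tau> + g \<tau>) \<in> modular_forms (Gamma0 2) k"
proof (cases "even k")
  case False
  thus ?thesis
    using assms modular_forms_odd[of f k] modular_forms_odd[of g k] zero_modular_forms by simp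
next
  case True
  then obtain n where k: "k = 2 * n" by (elim evenE)
  obtain F G where "level2 (int n) F G" "f = (\<lambda>\<tau>. F (nome \<tau>))"
    using modular_forms_level2 assms(1) unfolding k by metis
  moreover obtain F' G' where "level2 (int n) F' G'" "g = (\<lambda>\<tau>. F' (nome \<tau>))"
    using modular_forms_level2 assms(2) unfolding k by metis
  ultimately show ?thesis
    using level2_modular_forms[OF level2_add] unfolding k by simp
qed

section \<open>Moderate growth\<close>

definition growth :: "complex \<Rightarrow> real" where
  "growth z = (1 + norm z ^ 2) / Im z"

lemma growth_bounds:
  assumes "Im z > 0"
  shows "growth z \<ge> 1" "growth z \<ge> 1 / Im z" "growth z \<ge> norm z" "growth z \<ge> 1 / norm z"
proof -
  have n: "Im z \<le> norm z" "norm z > 0" using assms abs_Im_le_cmod[of z] by auto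
  have sq: "1 + norm z ^ 2 \<ge> norm z"
    using zero_le_power2[of "norm z - 1 / 2"] by (simp add: power2_eq_square algebra_simps)
  show "growth z \<ge> 1" unfolding growth_def using assms n sq by (simp add: field_simps)
  show "growth z \<ge> 1 / Im z" unfolding growth_def using assms by (intro divide_right_mono) auto
  have "norm z * Im z \<le> norm z * norm z" using n by (intro mult_left_mono) auto
  thus "growth z \<ge> norm z"
    unfolding growth_def using assms by (simp add: field_simps power2_eq_square)
  have "1 / norm z \<le> 1 / Im z" using n assms by (intro divide_left_mono) auto
  thus "growth z \<ge> 1 / norm z" using \<open>growth z \<ge> 1 / Im z\<close> by linarith
qed

lemma moderate_growth_iff:
  "moderate_growth f \<longleftrightarrow> (\<exists>C m. C \<ge> 0 \<and> (\<forall>\<tau>. norm (f \<tau>) \<le> C * growth (of_uhp \<tau>) ^ m))"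
proof
  assume "moderate_growth f"
  then obtain C m where *: "\<And>\<tau>. norm (f \<tau>) \<le> C * growth (of_uhp \<tau>) ^ m"
    by (auto simp: moderate_growth_def growth_def)
  have "norm (f \<tau>) \<le> max C 0 * growth (of_uhp \<tau>) ^ m" for \<tau>
    using growth_bounds(1)[OF Im_of_uhp, of \<tau>] by (intro order.trans[OF *] mult_right_mono) auto
  thus "\<exists>C m. C \<ge> 0 \<and> (\<forall>\<tau>. norm (f \<tau>) \<le> C * growth (of_uhp \<tau>) ^ m)"
    by (intro exI[of _ "max C 0"] exI[of _ m]) auto
qed (auto simp: moderate_growth_def growth_def)

lemma moderate_growth_const: "moderate_growth (\<lambda>_. c)"
  unfolding moderate_growth_iff by (intro exI[of _ "norm c"] exI[of _ 0]) auto

lemma moderate_growth_add: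
  assumes "moderate_growth f" "moderate_growth g"
  shows "moderate_growth (\<lambda>\<tau>. f \<tau> + g \<tau>)"
proof -
  obtain C m where f: "C \<ge> 0" "\<And>\<tau>. norm (f \<tau>) \<le> C * growth (of_uhp \<tau>) ^ m"
    using assms(1) by (auto simp: moderate_growth_iff)
  obtain D n where g: "D \<ge> 0" "\<And>\<tau>. norm (g \<tau>) \<le> D * growth (of_uhp \<tau>) ^ n"
    using assms(2) by (auto simp: moderate_growth_iff)
  have "norm (f \<tau> + g \<tau>) \<le> (C + D) * growth (of_uhp \<tau>) ^ (m + n)" for \<tau>
  proof -
    have 1: "growth (of_uhp \<tau>) \<ge> 1" by (rule growth_bounds(1)[OF Im_of_uhp])
    have "C * growth (of_uhp \<tau>) ^ m \<le> C * growth (of_uhp \<tau>) ^ (m + n)"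
      using f(1) 1 by (intro mult_left_mono power_increasing) auto
    moreover have "D * growth (of_uhp \<tau>) ^ n \<le> D * growth (of_uhp \<tau>) ^ (m + n)"
      using g(1) 1 by (intro mult_left_mono power_increasing) auto
    ultimately show ?thesis
      using norm_triangle_ineq[of "f \<tau>" "g \<tau>"] f(2)[of \<tau>] g(2)[of \<tau>] by (simp add: distrib_right)
  qed
  thus ?thesis unfolding moderate_growth_iff using f(1) g(1) by (intro exI[of _ "C + D"]
      exI[of _ "m + n"]) auto
qed

lemma moderate_growth_mult:
  assumes "moderate_growth f" "moderate_growth g"
  shows "moderate_growth (\<lambda>\<tau>. f \<tau> * g \<tau>)"
proof -
  obtain C m where f: "C \<ge> 0" "\<And>\<tau>. norm (f \<tau>) \<le> C * growth (of_uhp \<tau>) ^ m"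
    using assms(1) by (auto simp: moderate_growth_iff)
  obtain D n where g: "D \<ge> 0" "\<And>\<tau>. norm (g \<tau>) \<le> D * growth (of_uhp \<tau>) ^ n"
    using assms(2) by (auto simp: moderate_growth_iff)
  have "norm (f \<tau> * g \<tau>) \<le> (C * D) * growth (of_uhp \<tau>) ^ (m + n)" for \<tau>
  proof -
    have "norm (f \<tau>) * norm (g \<tau>) \<le> (C * growth (of_uhp \<tau>) ^ m) * (D * growth (of_uhp \<tau>) ^ n)"
      using f g growth_bounds(1)[OF Im_of_uhp, of \<tau>] by (intro mult_mono) auto
    thus ?thesis by (simp add: norm_mult power_add mult_ac)
  qed
  thus ?thesis unfolding moderate_growth_iff using f(1) g(1) by (intro exI[of _ "C * D"]
      exI[of _ "m + n"]) auto
qed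

lemma moderate_growth_power: "moderate_growth f \<Longrightarrow> moderate_growth (\<lambda>\<tau>. f \<tau> ^ n)"
  by (induction n) (auto intro: moderate_growth_const moderate_growth_mult)

lemma power_le_fact_exp: "x \<ge> 0 \<Longrightarrow> x ^ k \<le> fact k * exp (x::real)"
proof -
  assume x: "x \<ge> 0"
  have "x ^ k /\<^sub>R fact k \<le> (\<Sum>n\<le>k. x ^ n /\<^sub>R fact n)"
    using x by (intro member_le_sum) auto
  also have "\<dots> \<le> exp x"
    unfolding exp_def using x by (intro sum_le_suminf summable_exp_generic) auto
  finally show ?thesis by (simp add: field_simps)
qed

text \<open>With t = n Im z, the estimate exp(-t) \<le> (m + 2)!/t^(m+2) turns a coefficient of size
  n^m into a summable n^-2, at the price of the power (Im z)^-(m+2).\<close>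

lemma qser_growth:
  assumes a: "polynomially_bounded a"
  obtains C k where "C \<ge> 0" "\<And>z. Im z > 0 \<Longrightarrow> norm (qser a (ex z)) \<le> C * (1 + 1 / Im z) ^ k"
proof -
  obtain m where m: "\<And>n. norm (a n) \<le> real n ^ m"
    using a by (auto simp: polynomially_bounded_def)
  define S where "S = suminf (\<lambda>n. 1 / (real n + 1) ^ 2)"
  have sums: "(\<lambda>n. 1 / (real n + 1) ^ 2) sums S"
    unfolding S_def using sums_summable[OF inverse_squares_sums]
        by (intro summable_sums) (simp add: add_ac)
  have S0: "S \<ge> 0" unfolding S_def by (rule suminf_nonneg[OF sums_summable[OF sums]]) auto
  define K where "K = fact (m + 2) * (1::real)"
  have "norm (qser a (ex z)) \<le> (1 + K * S) * (1 + 1 / Im z) ^ (m + 2)" if z: "Im z > 0" for z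
  proof -
    define y where "y = Im z"
    have y: "y > 0" using z by (simp add: y_def)
    define M where "M = (1 + 1 / y) ^ (m + 2)"
    have M: "M \<ge> 1"
      unfolding M_def using y by (intro one_le_power) simp
    have M': "1 / y ^ (m + 2) \<le> M"
      using y power_mono[of "1 / y" "1 + 1 / y" "m + 2"] by (simp add: M_def power_divide)
    have n: "norm (ex z) < 1" by (rule norm_ex_less[OF z])
    have term_bound: "norm (a (Suc n) * ex z ^ Suc n) \<le> K * M * (1 / (real n + 1) ^ 2)" for n
    proof -
      define t where "t = real (Suc n) * y"
      have t: "t > 0" using y by (simp add: t_def)
      have "norm (ex z ^ Suc n) = exp (- (2 * pi * t))"
        unfolding norm_power norm_ex exp_of_nat_mult[symmetric]
            by (simp add: t_def y_def algebra_simps)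
      also have "\<dots> \<le> exp (- t)"
        using t pi_gt3 mult_right_mono[of 1 "2 * pi" t] by simp
      finally have 1: "norm (ex z ^ Suc n) \<le> exp (- t)" .
      have "t ^ (m + 2) \<le> K * exp t"
        using power_le_fact_exp[of t "m + 2"] t by (simp add: K_def)
      hence "exp (- t) \<le> K / t ^ (m + 2)"
        using t by (simp add: exp_minus field_simps)
      with 1 have "norm (a (Suc n)) * norm (ex z ^ Suc n) \<le> real (Suc n) ^ m * (K / t ^ (m + 2))"
        using m[of "Suc n"] by (intro mult_mono) auto
      also have "\<dots> = K * (1 / y ^ (m + 2)) * (1 / (real n + 1) ^ 2)"
        using y by (simp add: t_def power_mult_distrib power_add add_ac power2_eq_square)
      also have "\<dots> \<le> K * M * (1 / (real n + 1) ^ 2)"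
        using M' by (intro mult_left_mono mult_right_mono) (auto simp: K_def)
      finally show ?thesis by (simp add: norm_mult)
    qed
    have summ: "summable (\<lambda>n. norm (a (Suc n) * ex z ^ Suc n))"
      using qser_norm_summable[OF a n] by (subst summable_Suc_iff)
    have "qser a (ex z) = a 0 + suminf (\<lambda>n. a (Suc n) * ex z ^ Suc n)"
      unfolding qser_def using suminf_split_head[OF summable_norm_cancel[OF qser_norm_summable[OF
          a n]]] by simp
    hence "norm (qser a (ex z)) \<le> norm (a 0) + norm (suminf (\<lambda>n. a (Suc n) * ex z ^ Suc n))"
      by (simp only: norm_triangle_ineq)
    also have "norm (suminf (\<lambda>n. a (Suc n) * ex z ^ Suc n)) \<le>
        suminf (\<lambda>n. norm (a (Suc n) * ex z ^ Suc n))"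
      by (rule summable_norm[OF summ])
    also have "\<dots> \<le> suminf (\<lambda>n. K * M * (1 / (real n + 1) ^ 2))"
      by (rule suminf_le[OF term_bound summ sums_summable[OF sums_mult[OF sums]]])
    also have "\<dots> = K * M * S"
      by (rule sums_unique[OF sums_mult[OF sums], symmetric])
    also have "norm (a 0) \<le> 1" using m[of 0] by (cases m) (auto intro: order.trans)
    also have "1 + K * M * S \<le> (1 + K * S) * M" using M by (simp add: algebra_simps)
    finally show ?thesis by (simp add: M_def y_def)
  qed
  moreover have "1 + K * S \<ge> 0" using S0 by (simp add: K_def)
  ultimately show ?thesis using that by blast
qed

lemma moderate_growth_qser:
  assumes a: "polynomially_bounded a" and N: "N > 0"
  shows "moderate_growth (\<lambda>\<tau>. qser a (nome \<tau> ^ N))"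
proof -
  obtain C k where C: "C \<ge> 0" "\<And>z. Im z > 0 \<Longrightarrow> norm (qser a (ex z)) \<le> C * (1 + 1 / Im z) ^ k"
    using qser_growth[OF a] by blast
  have "norm (qser a (nome \<tau> ^ N)) \<le> (C * 2 ^ k) * growth (of_uhp \<tau>) ^ k" for \<tau>
  proof -
    define z where "z = of_uhp \<tau>"
    have z: "Im z > 0" by (simp add: z_def Im_of_uhp)
    have Nz: "Im (of_nat N * z) > 0" using z N by simp
    have "qser a (nome \<tau> ^ N) = qser a (ex (of_nat N * z))"
      by (simp only: ex_mult_nat nome_def z_def)
    hence "norm (qser a (nome \<tau> ^ N)) \<le> C * (1 + 1 / Im (of_nat N * z)) ^ k"
      using C(2)[OF Nz] by (simp only:)
    also have "1 / Im (of_nat N * z) \<le> 1 / Im z"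
      using z N by (intro divide_left_mono) auto
    hence "1 + 1 / Im (of_nat N * z) \<le> 2 * growth z"
      using growth_bounds(1,2)[OF z] by linarith
    hence "C * (1 + 1 / Im (of_nat N * z)) ^ k \<le> C * (2 * growth z) ^ k"
      using C(1) Nz by (intro mult_left_mono power_mono) auto
    finally show ?thesis by (simp add: z_def power_mult_distrib mult_ac)
  qed
  thus ?thesis unfolding moderate_growth_iff using C(1) by (intro exI[of _ "C * 2 ^ k"]
      exI[of _ k]) auto
qed

lemma moderate_growth_PQR: "moderate_growth P\<^sub>2" "moderate_growth Q\<^sub>2" "moderate_growth R\<^sub>2"
proof -
  have 2: "norm (nome \<tau> ^ 2) < 1" for \<tau> by (rule norm_square_less_one[OF norm_nome_less])
  have q: "moderate_growth (\<lambda>\<tau>. c + d * sigma_series j (nome \<tau> ^ N))" if "N > 0" for c d j N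
    by (intro moderate_growth_add moderate_growth_mult moderate_growth_const moderate_growth_qser
        polynomially_bounded_sigma that)
  have E: "moderate_growth (\<lambda>\<tau>. E2 (nome \<tau>))" "moderate_growth (\<lambda>\<tau>. E2 ((nome \<tau>)\<^sup>2))"
    "moderate_growth (\<lambda>\<tau>. E4 (nome \<tau>))" "moderate_growth (\<lambda>\<tau>. E4 ((nome \<tau>)\<^sup>2))"
    using q[of 1 1 "- 24" 1] q[of 2 1 "- 24" 1] q[of 1 1 240 3] q[of 2 1 240 3]
    by (simp_all add: E2_conv_qser[OF norm_nome_less] E2_conv_qser[OF 2]
        E4_conv_qser[OF norm_nome_less] E4_conv_qser[OF 2])
  have diff: "moderate_growth (\<lambda>\<tau>. f \<tau> - g \<tau>)" if "moderate_growth f" "moderate_growth g" for f g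
    using moderate_growth_add[OF that(1) moderate_growth_mult[OF moderate_growth_const[of "- 1"]
        that(2)]] by simp
  show "moderate_growth P\<^sub>2" "moderate_growth Q\<^sub>2" "moderate_growth R\<^sub>2"
    unfolding P\<^sub>2_def[abs_def] Q\<^sub>2_def[abs_def] R\<^sub>2_def[abs_def]
    by (intro moderate_growth_add moderate_growth_mult moderate_growth_const diff E)+
qed

section \<open>Quasi-modular forms\<close>

text \<open>The witnesses p and F are kept visible because the induction runs on the depth bound p
  and removes the coefficient \<open>F p\<close> in each step.\<close>

definition quasi_data :: "nat \<Rightarrow> nat \<Rightarrow> (nat \<Rightarrow> uhp \<Rightarrow> complex) \<Rightarrow> bool" where
  "quasi_data k p F \<longleftrightarrow> (\<forall>j\<le>p. hol_uhp (F j) \<and> moderate_growth (F j)) \<and>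
     (\<forall>A\<in>Gamma0 2. \<forall>\<tau>. slash k A (F 0) \<tau> =
        (\<Sum>j\<le>p. F j \<tau> * (of_int (A $ 2 $ 1) / autfactor A \<tau>) ^ j))"

lemma quasi_modular_forms_iff:
  "f \<in> quasi_modular_forms (Gamma0 2) k \<longleftrightarrow> (\<exists>p F. F 0 = f \<and> quasi_data k p F)"
  unfolding quasi_modular_forms_def quasi_data_def by auto

lemma poly_linear_power_coeff:
  fixes x b :: complex
  shows "degree ([:x, b:] ^ j) \<le> j" "coeff ([:x, b:] ^ j) j = b ^ j"
proof -
  show deg: "degree ([:x, b:] ^ j) \<le> j" for j
    using degree_power_le[of "[:x, b:]" j] degree_pCons_le[of x "[:b:]"] by (auto intro: order.trans)
  show "coeff ([:x, b:] ^ j) j = b ^ j"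
  proof (induction j)
    case (Suc j)
    have "coeff ([:x, b:] ^ j) (Suc j) = 0"
      using deg[of j] by (intro coeff_eq_0) auto
    thus ?case using Suc by simp
  qed simp
qed

lemma poly_eqI_infinite:
  fixes p q :: "complex poly"
  assumes "infinite X" "\<And>x. x \<in> X \<Longrightarrow> poly p x = poly q x"
  shows "p = q"
proof (rule ccontr)
  assume "p \<noteq> q"
  hence "finite {x. poly (p - q) x = 0}"
    by (intro poly_roots_finite) auto
  moreover have "X \<subseteq> {x. poly (p - q) x = 0}" using assms by auto
  ultimately show False using assms(1) finite_subset by blast
qed

text \<open>These are the values of c/(c \<tau> + d) on the matrices (1, 0; 2N, 1) of Gamma0(2).
  There are infinitely many, so identities holding for all matrices become identities of
  polynomials.\<close>

lemma infinite_unipotent_points: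
  fixes \<tau> :: complex
  assumes "Im \<tau> > 0"
  shows "infinite (range (\<lambda>N. of_int (2 * int N) / (of_int (2 * int N) * \<tau> + 1)))"
proof (rule range_inj_infinite, rule injI)
  fix M N :: nat
  assume eq: "of_int (2 * int M) / (of_int (2 * int M) * \<tau> + 1) =
      of_int (2 * int N) / (of_int (2 * int N) * \<tau> + 1)"
  have nz: "of_int (2 * int K) * \<tau> + 1 \<noteq> 0" for K
    using Im_SL2(2)[OF assms, of 1 1 0 "2 * int K"] by simp
  have "of_int (2 * int M) * (of_int (2 * int N) * \<tau> + 1) = of_int (2 * int N) * (of_int (2 * int
      M) * \<tau> + 1)"
    by (rule iffD1[OF frac_eq_eq[OF nz nz] eq])
  hence "of_int (2 * int M) = (of_int (2 * int N) :: complex)" by (simp add: algebra_simps)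
  thus "M = N" by simp
qed

text \<open>Writing out $f|AB = (f|A)|B$ for $A$ ranging over the lower unipotent elements of
  $\Gamma_0(2)$ gives an identity of polynomials; compare leading coefficients.\<close>

lemma quasi_top_coefficient:
  assumes F: "quasi_data k p F" and B: "B \<in> Gamma0 2"
  shows "F p (moebius B \<tau>) * (autfactor B \<tau> ^ 2) ^ p = autfactor B \<tau> ^ k * F p \<tau>"
proof -
  have slash_eq: "slash k A (F 0) \<sigma> = (\<Sum>j\<le>p. F j \<sigma> * (of_int (A $ 2 $ 1) / autfactor A \<sigma>) ^ j)"
      if "A \<in> Gamma0 2" for A \<sigma>
    using F that by (simp add: quasi_data_def)
  have B': "B \<in> SL2Z" using B by (simp add: in_Gamma0_2_iff)
  define a b c d where "a = B $ 1 $ 1" and "b = B $ 1 $ 2" and "c = B $ 2 $ 1" and "d = B $ 2 $ 2"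
  have det: "a * d - b * c = 1" and c: "even c"
    using B by (simp_all add: in_Gamma0_2_iff in_SL2Z_iff a_def b_def c_def d_def)
  define z where "z = of_uhp \<tau>"
  define j where "j = autfactor B \<tau>"
  have j: "j = of_int c * z + of_int d" by (simp add: j_def autfactor_def c_def d_def z_def)
  have j0: "j \<noteq> 0" unfolding j_def by (rule autfactor_nonzero[OF B'])
  define \<tau>' where "\<tau>' = moebius B \<tau>"
  define z' where "z' = of_uhp \<tau>'"
  have z': "z' = (of_int a * z + of_int b) / j"
    by (simp add: z'_def \<tau>'_def of_uhp_moebius[OF B'] a_def b_def z_def j_def)
  have Im_z': "Im z' > 0" by (simp add: z'_def Im_of_uhp)
  define xb where "xb = of_int c / j"
  define \<beta> where "\<beta> = inverse (j ^ 2)"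
  \<comment> \<open>Both sides of f|AB = (f|A)|B as polynomials in x = n/(n z' + 1): the quotient of
    lower left entry by automorphy factor is c/j + x/j^2 for AB and x for A.\<close>
  define p1 where "p1 = (\<Sum>i\<le>p. smult (F i \<tau>) ([:xb, \<beta>:] ^ i))"
  define p2 where "p2 = (\<Sum>i\<le>p. smult (inverse (j ^ k) * F i \<tau>') ([:0, 1:] ^ i))"
  have "p1 = p2"
  proof (rule poly_eqI_infinite)
    show "infinite (range (\<lambda>N. of_int (2 * int N) / (of_int (2 * int N) * z' + 1)))"
      by (rule infinite_unipotent_points[OF Im_z'])
    fix x assume "x \<in> range (\<lambda>N. of_int (2 * int N) / (of_int (2 * int N) * z' + 1))"
    then obtain N where x: "x = of_int (2 * int N) / (of_int (2 * int N) * z' + 1)" by blast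
    define n where "n = 2 * int N"
    define A where "A = mat2 1 0 n 1"
    define AB where "AB = mat2 a b (n * a + c) (n * b + d)"
    have A: "A \<in> Gamma0 2" by (simp add: A_def in_Gamma0_2_iff in_SL2Z_iff n_def)
    have AB: "AB \<in> Gamma0 2"
      using det c by (simp add: AB_def in_Gamma0_2_iff in_SL2Z_iff n_def algebra_simps)
    have SL: "A \<in> SL2Z" "AB \<in> SL2Z" using A AB by (simp_all add: in_Gamma0_2_iff)
    define jA where "jA = autfactor A \<tau>'"
    have jA: "jA = of_int n * z' + 1" by (simp add: jA_def autfactor_def A_def z'_def)
    have jA0: "jA \<noteq> 0" unfolding jA_def by (rule autfactor_nonzero[OF SL(1)])
    have jAB: "autfactor AB \<tau> = jA * j"
      using j0 by (simp add: autfactor_def AB_def jA z' j z_def field_simps)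
    have m: "moebius AB \<tau> = moebius A \<tau>'"
    proof -
      have "of_uhp (moebius AB \<tau>) = of_uhp (moebius A \<tau>')"
        unfolding of_uhp_moebius[OF SL(1)] of_uhp_moebius[OF SL(2)] jAB jA_def[symmetric]
        using j0 jA0 by (simp add: AB_def A_def z' flip: z_def z'_def)
      thus ?thesis by (simp add: of_uhp_inject)
    qed
    have "of_int (a * d - b * c) = (1::complex)" using det by simp
    hence det': "of_int a * of_int d - of_int b * of_int c = (1::complex)" by simp
    have num: "of_int (n * a + c) * j = of_int c * (jA * j) + of_int n * (1 :: complex)"
      using j0 unfolding det'[symmetric] by (simp add: jA z' field_simps j)
    have xAB: "of_int (AB $ 2 $ 1) / autfactor AB \<tau> = xb + \<beta> * x"
    proof -
      have "of_int (AB $ 2 $ 1) / autfactor AB \<tau> = (of_int (n * a + c) * j) / (jA * j ^ 2)"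
        using j0 unfolding jAB by (simp add: AB_def power2_eq_square)
      also have "\<dots> = xb + \<beta> * (of_int n / jA)"
        unfolding num using j0 jA0 by (simp add: xb_def \<beta>_def field_simps power2_eq_square)
      finally show ?thesis by (simp add: x jA n_def)
    qed
    have "poly p1 x = (\<Sum>i\<le>p. F i \<tau> * (xb + \<beta> * x) ^ i)"
      by (simp add: p1_def poly_sum algebra_simps)
    also have "\<dots> = slash k AB (F 0) \<tau>"
      unfolding slash_eq[OF AB] xAB ..
    also have "\<dots> = inverse (j ^ k) * slash k A (F 0) \<tau>'"
      unfolding slash_def m jAB jA_def[symmetric] by (simp add: power_int_minus power_mult_distrib)
    also have "slash k A (F 0) \<tau>' = (\<Sum>i\<le>p. F i \<tau>' * x ^ i)"
      unfolding slash_eq[OF A] jA_def[symmetric] by (simp add: A_def x jA n_def)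
    also have "inverse (j ^ k) * (\<Sum>i\<le>p. F i \<tau>' * x ^ i) = poly p2 x"
      by (simp add: p2_def poly_sum sum_distrib_left mult.assoc)
    finally show "poly p1 x = poly p2 x" .
  qed
  have coeff: "coeff (\<Sum>i\<le>p. smult (h i) ([:u, v:] ^ i)) p = h p * v ^ p" for h and u v :: complex
  proof -
    have "coeff ([:u, v:] ^ i) p = 0" if "i < p" for i
      using that poly_linear_power_coeff(1)[of u v i] by (intro coeff_eq_0) auto
    hence "coeff (\<Sum>i\<le>p. smult (h i) ([:u, v:] ^ i)) p = (\<Sum>i\<le>p. if i = p then h p * v ^ p else 0)"
      unfolding coeff_sum by (intro sum.cong) (auto simp: poly_linear_power_coeff)
    thus ?thesis by simp
  qed
  have "F p \<tau> * \<beta> ^ p = inverse (j ^ k) * F p \<tau>'"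
    using arg_cong[OF \<open>p1 = p2\<close>, of "\<lambda>q. coeff q p"] unfolding p1_def p2_def coeff by simp
  thus ?thesis
    using j0 by (simp add: \<beta>_def field_simps power_inverse flip: \<tau>'_def j_def)
qed

text \<open>The matrix -1 has lower left entry 0, so only the term j = 0 survives and f =
  -f.\<close>

lemma quasi_even:
  assumes "f \<in> quasi_modular_forms (Gamma0 2) k" "odd k"
  shows "f = (\<lambda>_. 0)"
proof
  fix \<tau>
  obtain p F where F: "F 0 = f" "quasi_data k p F" using assms(1) by (auto simp:
      quasi_modular_forms_iff)
  have "slash k A (F 0) \<tau> = (\<Sum>j\<le>p. F j \<tau> * (of_int (A $ 2 $ 1) / autfactor A \<tau>) ^ j)"
      if "A \<in> Gamma0 2" for A
    using F(2) that by (simp add: quasi_data_def)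
  from this[OF minus_one_in_Gamma0_2]
  have "slash k (mat2 (- 1) 0 0 (- 1)) f \<tau> = (\<Sum>j\<le>p. F j \<tau> * (of_int 0 / autfactor (mat2 (- 1) 0 0
      (- 1)) \<tau>) ^ j)"
    by (simp only: F(1) mat2_nth)
  also have "\<dots> = (\<Sum>j\<le>p. if j = 0 then f \<tau> else 0)"
    by (intro sum.cong) (auto simp: F(1) power_0_left)
  finally show "f \<tau> = 0" using slash_minus_one[OF assms(2), of f \<tau>] by simp
qed

text \<open>The top coefficient transforms with weight 2n - 2p, possibly negative. Moderate growth
  gives the bounds at both cusps, since the growth quantity is invariant under z -> -1/z.\<close>

lemma quasi_top_level2:
  assumes F: "quasi_data (2 * n) p F"
  obtains H G where "level2 (int n - int p) H G" "F p = (\<lambda>\<tau>. H (nome \<tau>))"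
proof -
  define h where "h = F p"
  have hol: "hol_uhp h" and mod: "moderate_growth h"
    using F by (auto simp: quasi_data_def h_def)
  obtain C m where C: "C \<ge> 0" "\<And>\<tau>. norm (h \<tau>) \<le> C * growth (of_uhp \<tau>) ^ m"
    using mod by (auto simp: moderate_growth_iff)
  have C': "norm (h (to_uhp z)) \<le> C * growth z ^ m" if "Im z > 0" for z
    using C(2)[of "to_uhp z"] that by (simp add: of_uhp_to_uhp)
  \<comment> \<open>A bound for the exponent n - p of either sign: on the half strip |z| \<ge> 1 and
    |z| \<le> 3 Im z, so the automorphy factor costs at most (3 Im z)^(2N).\<close>
  define N where "N = nat \<bar>int n - int p\<bar>"
  have growth_le: "growth z \<le> 6 * Im z" "norm z \<le> 3 * Im z" "1 \<le> norm z" if z: "Im z \<ge> 1"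
      "\<bar>Re z\<bar> \<le> 2" for z
  proof -
    have "norm z ^ 2 \<le> 2 ^ 2 + Im z ^ 2"
      using z(2) abs_le_square_iff[of "Re z" 2] by (simp add: cmod_power2)
    hence "1 + norm z ^ 2 \<le> 5 + Im z ^ 2" by simp
    also have "\<dots> \<le> 6 * Im z * Im z" using z(1) mult_mono[of 1 "Im z" 1 "Im z"]
        by (simp add: power2_eq_square)
    finally show "growth z \<le> 6 * Im z" using z(1) by (simp add: growth_def field_simps)
    show "norm z \<le> 3 * Im z" using cmod_le[of z] z by linarith
    show "1 \<le> norm z" using abs_Im_le_cmod[of z] z by linarith
  qed
  have "\<exists>H G. level2 (int n - int p) H G \<and> (\<forall>z. Im z > 0 \<longrightarrow> h (to_uhp z) = H (ex z))"
  proof (rule level2_from_invariance)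
    show "(\<lambda>z. h (to_uhp z)) holomorphic_on {z. 0 < Im z}"
      using hol by (simp add: hol_uhp_def)
    fix a b c d z assume abcd: "a * d - b * c = (1 :: int)" "even c" "Im z > 0"
    define A where "A = mat2 a b c d"
    have A: "A \<in> SL2Z" "A \<in> Gamma0 2" using abcd by (simp_all add: in_Gamma0_2_iff in_SL2Z_iff A_def)
    define j where "j = of_int c * z + of_int d"
    have j: "autfactor A (to_uhp z) = j" using abcd by (simp add: A_def autfactor_mat2_to_uhp j_def)
    have j0: "j \<noteq> 0" using autfactor_nonzero[OF A(1), of "to_uhp z"] by (simp add: j)
    have "h (moebius A (to_uhp z)) * (j ^ 2) ^ p = (j ^ 2) ^ n * h (to_uhp z)"
      using quasi_top_coefficient[OF F A(2), of "to_uhp z"] unfolding power_mult by (simp only: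
          h_def j)
    hence "h (moebius A (to_uhp z)) = (j ^ 2) powi (int n - int p) * h (to_uhp z)"
      using j0 by (subst power_int_diff) (simp_all add: field_simps)
    thus "h (to_uhp ((of_int a * z + of_int b) / (of_int c * z + of_int d))) = ((of_int c * z +
        of_int d) ^ 2) powi (int n - int p) * h (to_uhp z)"
      unfolding A_def moebius_mat2_to_uhp[OF abcd(3)] j_def .
  next
    fix z :: complex assume z: "Im z \<ge> 1" "\<bar>Re z\<bar> \<le> 2"
    hence Im: "Im z > 0" by simp
    have g: "C * growth z ^ m \<le> C * (6 * Im z) ^ m"
      using C(1) growth_le(1)[OF z] growth_bounds(1)[OF Im] by (intro mult_left_mono power_mono) auto
    show "norm (h (to_uhp z)) \<le> (C * 6 ^ m) * Im z ^ m"
      using order.trans[OF C'[OF Im] g] by (simp add: power_mult_distrib mult_ac)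
    have z0: "z \<noteq> 0" using Im by auto
    have "growth (- 1 / z) = growth z"
      using Im z0 by (simp add: growth_def norm_divide Im_divide' power_divide field_simps)
    hence 1: "norm (h (to_uhp (- 1 / z))) \<le> C * (6 * Im z) ^ m"
      using order.trans[OF C'[OF Im_inversion[OF Im]]] g by simp
    have "norm (1 / (z ^ 2) powi (int n - int p)) = (norm z ^ 2) powi (int p - int n)"
      using z0 by (simp add: norm_divide norm_power_int norm_power power_int_diff)
    also have "\<dots> \<le> (norm z ^ 2) powi (int N)"
      using growth_le(3)[OF z] by (intro power_int_increasing) (auto simp: N_def)
    also have "\<dots> = norm z ^ (2 * N)" by (simp add: power_mult)
    also have "\<dots> \<le> (3 * Im z) ^ (2 * N)"
      using growth_le(2)[OF z] by (intro power_mono) auto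
    finally have "norm (h (to_uhp (- 1 / z))) * norm (1 / (z ^ 2) powi (int n - int p)) \<le>
        (C * (6 * Im z) ^ m) * (3 * Im z) ^ (2 * N)"
      using 1 C(1) Im by (intro mult_mono) auto
    thus "norm (h (to_uhp (- 1 / z)) / (z ^ 2) powi (int n - int p)) \<le> (C * 6 ^ m * 3 ^ (2 * N))
        * Im z ^ (m + 2 * N)"
      by (simp add: norm_mult norm_divide power_mult_distrib power_add mult_ac)
  qed
  then obtain H G where HG: "level2 (int n - int p) H G" "\<And>z. Im z > 0 \<Longrightarrow> h (to_uhp z) = H (ex z)"
    by blast
  have "F p \<tau> = H (nome \<tau>)" for \<tau>
    using HG(2)[OF Im_of_uhp[of \<tau>]] by (simp add: of_uhp_inverse nome_def h_def)
  thus ?thesis using that HG(1) by blast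
qed

text \<open>The constant 8/(2 pi i): 8 is the weight of Delta2, whose logarithmic derivative is P2,
  and 2 pi i comes from the normalisation of the derivative.\<close>

definition kappa :: complex where "kappa = 4 / (of_real pi * \<i>)"

lemma kappa_nonzero: "kappa \<noteq> 0"
  by (simp add: kappa_def)

lemma \<Delta>2_nonzero: "\<Delta>\<^sub>2 \<tau> \<noteq> 0"
  using eta_nonzero[OF Im_of_uhp, of \<tau>] eta_nonzero[of "2 * of_uhp \<tau>"] Im_of_uhp[of \<tau>]
  by (simp add: \<Delta>\<^sub>2_def)

text \<open>Logarithmic differentiation of $\Delta_2(A\tau) = (c\tau + d)^8 \Delta_2(\tau)$.\<close>

theorem P2_moebius:
  assumes A: "A \<in> Gamma0 2"
  shows "P\<^sub>2 (moebius A \<tau>) = autfactor A \<tau> ^ 2 * (P\<^sub>2 \<tau> + kappa * (of_int (A $ 2 $ 1) / autfactor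
      A \<tau>))"
proof -
  have A': "A \<in> SL2Z" using A by (simp add: in_Gamma0_2_iff)
  define a b c d where "a = A $ 1 $ 1" and "b = A $ 1 $ 2" and "c = A $ 2 $ 1" and "d = A $ 2 $ 2"
  have det: "a * d - b * c = 1" and c: "even c"
    using A by (simp_all add: in_Gamma0_2_iff in_SL2Z_iff a_def b_def c_def d_def)
  define z where "z = of_uhp \<tau>"
  have z: "Im z > 0" by (simp add: z_def Im_of_uhp)
  define j where "j = of_int c * z + of_int d"
  have j: "autfactor A \<tau> = j" by (simp add: j_def autfactor_def c_def d_def z_def)
  have j0: "j \<noteq> 0" using autfactor_nonzero[OF A', of \<tau>] by (simp add: j)
  define M where "M = (\<lambda>u::complex. (of_int a * u + of_int b) / (of_int c * u + of_int d))"
  have M: "of_uhp (moebius A \<tau>) = M z"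
    using of_uhp_moebius[OF A', of \<tau>] by (simp add: M_def j j_def a_def b_def z_def)
  have ImM: "Im (M z) > 0" using Im_of_uhp[of "moebius A \<tau>"] by (simp add: M)
  define D where "D = (\<lambda>u. \<Delta>_exp (ex u))"
  have D: "(D has_field_derivative 2 * of_real pi * \<i> * (P_exp (ex u) * D u)) (at u)"
      if "Im u > 0" for u
  proof -
    have "ex u \<in> ball 0 1" using norm_ex_less[OF that] by (simp only: mem_ball_0)
    then obtain D' where "(\<Delta>_exp has_field_derivative D') (at (ex u))" "ex u * D' =
        P_exp (ex u) * \<Delta>_exp (ex u)"
      using logarithmic_derivatives by metis
    thus ?thesis unfolding D_def using DERIV_ex_compose[of \<Delta>_exp D' u] by simp
  qed
  have inv: "D (M u) = (of_int c * u + of_int d) ^ 8 * D u" if "Im u > 0" for u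
    using level2_conjugate[OF level2_\<Delta> that det] c
    by (simp only: D_def M_def conjugate_def ex_half_square if_True) (simp flip: power_mult)
  have "of_int (a * d - b * c) = (1::complex)" using det by simp
  hence det': "of_int a * of_int d - of_int b * of_int c = (1::complex)" by simp
  have "(M has_field_derivative (of_int a * (of_int c * z + of_int d) - (of_int a * z +
      of_int b) * of_int c) / ((of_int c * z + of_int d) * (of_int c * z + of_int d))) (at z)"
    unfolding M_def using j0 by (auto intro!: derivative_eq_intros simp: j_def)
  also have "of_int a * (of_int c * z + of_int d) - (of_int a * z + of_int b) * of_int c =
      (1::complex)"
    using det' by (simp add: algebra_simps)
  finally have M': "(M has_field_derivative 1 / j ^ 2) (at z)" by (simp add: j_def power2_eq_square)
  have "((\<lambda>u. D (M u)) has_field_derivative 2 * of_real pi * \<i> * (P_exp (ex (M z)) * D (M z))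
      * (1 / j ^ 2)) (at z)"
    by (rule DERIV_chain2[OF D[OF ImM] M'])
  moreover have "((\<lambda>u. (of_int c * u + of_int d) ^ 8 * D u) has_field_derivative
      (8 * (of_int c * j ^ 7) * D z + 2 * of_real pi * \<i> * (P_exp (ex z) * D z) * j ^ 8)) (at z)"
  proof -
    have "((\<lambda>u. of_int c * u + of_int d) has_field_derivative of_int c) (at z)"
      by (auto intro!: derivative_eq_intros)
    from DERIV_mult[OF DERIV_power[OF this, of 8] D[OF z]] show ?thesis by (simp add: j_def)
  qed
  hence "((\<lambda>u. D (M u)) has_field_derivative
      (8 * (of_int c * j ^ 7) * D z + 2 * of_real pi * \<i> * (P_exp (ex z) * D z) * j ^ 8)) (at z)"
    by (rule has_field_derivative_transform_within_open[where S = "{u. Im u > 0}"])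
       (use z inv in \<open>auto simp: open_halfspace_Im_gt\<close>)
  ultimately have "2 * of_real pi * \<i> * (P_exp (ex (M z)) * D (M z)) * (1 / j ^ 2) =
     8 * (of_int c * j ^ 7) * D z + 2 * of_real pi * \<i> * (P_exp (ex z) * D z) * j ^ 8"
    by (rule DERIV_unique)
  moreover have "D (M z) = j ^ 8 * D z" using inv[OF z] by (simp add: j_def)
  moreover have "D z \<noteq> 0" using \<Delta>2_nonzero[of \<tau>] unfolding \<Delta>2_nome nome_def by (simp add: D_def z_def)
  moreover have "P\<^sub>2 (moebius A \<tau>) = P_exp (ex (M z))" "P\<^sub>2 \<tau> = P_exp (ex z)"
    by (simp_all add: P2_nome nome_def M z_def)
  ultimately have eq: "2 * of_real pi * \<i> * (P\<^sub>2 (moebius A \<tau>) * (j ^ 8 * D z)) * (1 / j ^ 2) =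
     8 * (of_int c * j ^ 7) * D z + 2 * of_real pi * \<i> * (P\<^sub>2 \<tau> * D z) * j ^ 8" and D0: "D z \<noteq> 0"
    by simp_all
  have "P\<^sub>2 (moebius A \<tau>) = j ^ 2 / (2 * of_real pi * \<i> * j ^ 8 * D z) * (2 * of_real pi * \<i> *
      (P\<^sub>2 (moebius A \<tau>) * (j ^ 8 * D z)) * (1 / j ^ 2))"
    using j0 D0 by (simp add: field_simps)
  also have "\<dots> = j ^ 2 * (P\<^sub>2 \<tau> + kappa * (of_int c / j))"
    unfolding eq using j0 D0 by (simp add: kappa_def field_simps eval_nat_numeral)
  finally show ?thesis unfolding j c_def .
qed

lemma level2_moebius:
  assumes "level2 n F G" "A \<in> Gamma0 2"
  shows "F (nome (moebius A \<tau>)) = (autfactor A \<tau> ^ 2) powi n * F (nome \<tau>)"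
proof -
  have A': "A \<in> SL2Z" using assms by (simp add: in_Gamma0_2_iff)
  have "F (ex (of_uhp (moebius A \<tau>))) = (autfactor A \<tau> ^ 2) powi n * conjugate F G (A $ 2 $ 1) (A
      $ 2 $ 2) (ex (of_uhp \<tau> / 2))"
    unfolding of_uhp_moebius[OF A'] autfactor_def
    using A' by (intro level2_conjugate[OF assms(1) Im_of_uhp]) (simp add: in_SL2Z_iff)
  moreover have "conjugate F G (A $ 2 $ 1) (A $ 2 $ 2) (ex (of_uhp \<tau> / 2)) =
      F (ex (of_uhp \<tau> / 2) ^ 2)"
    using assms(2) by (simp add: in_Gamma0_2_iff conjugate_def)
  ultimately show ?thesis by (simp only: ex_half_square nome_def)
qed

lemma level2_P_power_slash:
  assumes H: "level2 (int m) H G" and A: "A \<in> Gamma0 2"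
  shows "slash (2 * (m + p)) A (\<lambda>\<tau>. H (nome \<tau>) * P\<^sub>2 \<tau> ^ p) \<tau> =
    (\<Sum>j\<le>p. (of_nat (p choose j) * kappa ^ j * H (nome \<tau>) * P\<^sub>2 \<tau> ^ (p - j))
        * (of_int (A $ 2 $ 1) / autfactor A \<tau>) ^ j)"
proof -
  have A': "A \<in> SL2Z" using A by (simp add: in_Gamma0_2_iff)
  define x where "x = of_int (A $ 2 $ 1) / autfactor A \<tau>"
  have "(kappa * x + P\<^sub>2 \<tau>) ^ p = (\<Sum>j\<le>p. of_nat (p choose j) * (kappa * x) ^ j * P\<^sub>2 \<tau> ^ (p - j))"
    by (rule binomial_ring)
  hence "(\<Sum>j\<le>p. (of_nat (p choose j) * kappa ^ j * H (nome \<tau>) * P\<^sub>2 \<tau> ^ (p - j)) * x ^ j) =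
      H (nome \<tau>) * (P\<^sub>2 \<tau> + kappa * x) ^ p"
    by (simp add: sum_distrib_left power_mult_distrib mult_ac add.commute)
  thus ?thesis
    unfolding slash_eq_iff[OF A'] x_def[symmetric] level2_moebius[OF H A] P2_moebius[OF A]
        power_mult[of _ 2]
    by (simp add: power_mult_distrib power_add mult_ac)
qed

text \<open>The coefficients come from the binomial expansion of (P2 + kappa x)^p. The top one, j =
  p, is kappa^p H without P2, so a prescribed top coefficient is realised by choosing H.\<close>

lemma quasi_data_P_power:
  assumes H: "level2 (int m) H G" and mod: "moderate_growth (\<lambda>\<tau>. H (nome \<tau>))"
  shows "quasi_data (2 * (m + p)) p (\<lambda>j \<tau>. of_nat (p choose j) * kappa ^ j * H (nome \<tau>) * P\<^sub>2 \<tau> ^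
      (p - j))"
proof -
  have "hol_uhp (\<lambda>\<tau>. of_nat (p choose j) * kappa ^ j * H (nome \<tau>) * P_exp (nome \<tau>) ^ (p - j))" for j
    by (intro hol_uhp_nome[of "\<lambda>w. of_nat (p choose j) * kappa ^ j * H w * P_exp w ^ (p - j)"]
          holomorphic_intros level2D(1)[OF H] P_exp_holomorphic)
  moreover have "moderate_growth (\<lambda>\<tau>. of_nat (p choose j) * kappa ^ j * H (nome \<tau>) * P\<^sub>2 \<tau> ^ (p -
      j))" for j
    by (intro moderate_growth_mult moderate_growth_const moderate_growth_power moderate_growth_PQR
        mod)
  ultimately show ?thesis
    unfolding quasi_data_def using level2_P_power_slash[OF H] by (simp add: P2_nome)
qed

lemma quasi_modular_forms_P_power:
  assumes "level2 (int m) H G" "moderate_growth (\<lambda>\<tau>. H (nome \<tau>))"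
  shows "(\<lambda>\<tau>. H (nome \<tau>) * P\<^sub>2 \<tau> ^ p) \<in> quasi_modular_forms (Gamma0 2) (2 * (m + p))"
  unfolding quasi_modular_forms_iff
  by (intro exI[of _ p] exI[of _ "\<lambda>j \<tau>. of_nat (p choose j) * kappa ^ j * H (nome \<tau>) * P\<^sub>2 \<tau> ^ (p
      - j)"]
        conjI quasi_data_P_power[OF assms]) simp

lemma hol_uhp_add: "hol_uhp f \<Longrightarrow> hol_uhp g \<Longrightarrow> hol_uhp (\<lambda>\<tau>. f \<tau> + g \<tau>)"
  and hol_uhp_diff: "hol_uhp f \<Longrightarrow> hol_uhp g \<Longrightarrow> hol_uhp (\<lambda>\<tau>. f \<tau> - g \<tau>)"
  and hol_uhp_const: "hol_uhp (\<lambda>_. c)"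
  unfolding hol_uhp_def by (auto intro: holomorphic_intros)

lemma slash_add: "slash k A (\<lambda>\<tau>. f \<tau> + g \<tau>) \<tau> = slash k A f \<tau> + slash k A g \<tau>"
  by (simp add: slash_def algebra_simps)

lemma quasi_data_pad:
  assumes "quasi_data k p F" "p \<le> q"
  shows "quasi_data k q (\<lambda>j. if j \<le> p then F j else (\<lambda>_. 0))"
proof -
  have "(\<Sum>j\<le>q. (if j \<le> p then F j else (\<lambda>_. 0)) \<tau> * x ^ j) = (\<Sum>j\<le>p. F j \<tau> * x ^ j)" for \<tau> x
    using assms(2) by (intro sum.mono_neutral_cong_right) auto
  thus ?thesis
    using assms(1) unfolding quasi_data_def
    by (auto simp: hol_uhp_const moderate_growth_const)
qed

lemma quasi_modular_forms_add:
  assumes "f \<in> quasi_modular_forms (Gamma0 2) k" "g \<in> quasi_modular_forms (Gamma0 2) k"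
  shows "(\<lambda>\<tau>. f \<tau> + g \<tau>) \<in> quasi_modular_forms (Gamma0 2) k"
proof -
  obtain p F where F: "F 0 = f" "quasi_data k p F" using assms(1) by (auto simp:
      quasi_modular_forms_iff)
  obtain q G where G: "G 0 = g" "quasi_data k q G" using assms(2) by (auto simp:
      quasi_modular_forms_iff)
  define F' where "F' = (\<lambda>j. if j \<le> p then F j else (\<lambda>_. 0))"
  define G' where "G' = (\<lambda>j. if j \<le> q then G j else (\<lambda>_. 0))"
  have *: "quasi_data k (max p q) F'" "quasi_data k (max p q) G'"
    unfolding F'_def G'_def using F G by (auto intro: quasi_data_pad)
  have "quasi_data k (max p q) (\<lambda>j \<tau>. F' j \<tau> + G' j \<tau>)"
    using * unfolding quasi_data_def
    by (auto intro: hol_uhp_add moderate_growth_add simp: slash_add sum.distrib distrib_right)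
  moreover have "F' 0 = f" "G' 0 = g" using F G by (auto simp: F'_def G'_def)
  ultimately show ?thesis
    unfolding quasi_modular_forms_iff by (intro exI[of _ "max p q"] exI[of _ "\<lambda>j \<tau>. F' j \<tau> +
        G' j \<tau>"]) auto
qed

lemma zero_quasi_modular_forms: "(\<lambda>_. 0) \<in> quasi_modular_forms (Gamma0 2) k"
  unfolding quasi_modular_forms_iff quasi_data_def
  by (intro exI[of _ 0] exI[of _ "\<lambda>_ _. 0"]) (auto simp: hol_uhp_const moderate_growth_const
      slash_def)

text \<open>If p exceeds n, the top coefficient has negative weight and vanishes; otherwise a form
  H' P2^p with the same top coefficient is subtracted. Either way p drops by one. The result is an
  induction rule so that the property shown can refer to the graded algebra.\<close>

theorem quasi_induct:
  assumes F: "quasi_data (2 * n) p F"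
    and monomial: "\<And>q H G. q \<le> n \<Longrightarrow> level2 (int (n - q)) H G \<Longrightarrow> \<Phi> (\<lambda>\<tau>. H (nome \<tau>) * P\<^sub>2 \<tau> ^ q)"
    and add: "\<And>f g. \<Phi> f \<Longrightarrow> \<Phi> g \<Longrightarrow> \<Phi> (\<lambda>\<tau>. f \<tau> + g \<tau>)"
    and zero: "\<Phi> (\<lambda>_. 0)"
  shows "\<Phi> (F 0)"
  using F
proof (induction p arbitrary: F)
  case 0
  obtain H G where HG: "level2 (int n - int 0) H G" "F 0 = (\<lambda>\<tau>. H (nome \<tau>))"
    using quasi_top_level2[OF 0] by blast
  thus ?case using monomial[of 0 H G] by simp
next
  case (Suc p)
  obtain H G where HG: "level2 (int n - int (Suc p)) H G" "F (Suc p) = (\<lambda>\<tau>. H (nome \<tau>))"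
    using quasi_top_level2[OF Suc.prems] by blast
  show ?case
  proof (cases "Suc p \<le> n")
    case False
    have "F (Suc p) \<tau> = 0" for \<tau>
      unfolding HG(2) by (rule level2_negative_weight[OF HG(1) _ nome_in_ball]) (use False in auto)
    hence "quasi_data (2 * n) p F"
      using Suc.prems by (simp add: quasi_data_def)
    thus ?thesis by (rule Suc.IH)
  next
    case True
    define m where "m = n - Suc p"
    have n: "n = m + Suc p" using True by (simp add: m_def)
    define H' where "H' = (\<lambda>w. inverse (kappa ^ Suc p) * H w)"
    define G' where "G' = (\<lambda>w. inverse (kappa ^ Suc p) * G w)"
    have H': "level2 (int m) H' G'"
      unfolding H'_def G'_def using HG(1) n by (intro level2_cmult) simp
    have "moderate_growth (\<lambda>\<tau>. H (nome \<tau>))"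
      using Suc.prems HG(2) unfolding quasi_data_def by (metis order_refl)
    hence mod: "moderate_growth (\<lambda>\<tau>. H' (nome \<tau>))"
      unfolding H'_def by (intro moderate_growth_mult moderate_growth_const)
    define K where "K = (\<lambda>j \<tau>. of_nat (Suc p choose j) * kappa ^ j * H' (nome \<tau>) * P\<^sub>2 \<tau> ^ (Suc p
        - j))"
    have K: "quasi_data (2 * n) (Suc p) K"
      unfolding n K_def by (rule quasi_data_P_power[OF H' mod])
    have top: "K (Suc p) = F (Suc p)"
    proof -
      have "kappa ^ Suc p * inverse (kappa ^ Suc p) = 1"
        using kappa_nonzero by (simp del: power_Suc)
      thus ?thesis
        unfolding HG(2) K_def H'_def by (simp add: fun_eq_iff mult.assoc [symmetric] del: power_Suc)
    qed
    have diff: "moderate_growth (\<lambda>\<tau>. f \<tau> - g \<tau>)" if "moderate_growth f" "moderate_growth g" for f g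
      using moderate_growth_add[OF that(1) moderate_growth_mult[OF moderate_growth_const[of "- 1"]
          that(2)]] by simp
    have slash_diff: "slash k A (\<lambda>\<tau>. f \<tau> - g \<tau>) \<tau> = slash k A f \<tau> - slash k A g \<tau>" for k A f g \<tau>
      by (simp add: slash_def algebra_simps)
    have "quasi_data (2 * n) p (\<lambda>j \<tau>. F j \<tau> - K j \<tau>)"
      using Suc.prems K top unfolding quasi_data_def
      by (auto intro!: hol_uhp_diff diff simp: slash_diff sum_subtractf left_diff_distrib)
    hence "\<Phi> (\<lambda>\<tau>. F 0 \<tau> - K 0 \<tau>)" by (rule Suc.IH)
    moreover have "\<Phi> (K 0)"
      using monomial[OF True, of H' G'] H' by (simp add: K_def m_def)
    ultimately have "\<Phi> (\<lambda>\<tau>. (F 0 \<tau> - K 0 \<tau>) + K 0 \<tau>)" by (rule add)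
    thus ?thesis by simp
  qed
qed

section \<open>Graded algebras\<close>

lemma power_fun_apply: "(f ^ n) x = (f x :: 'b :: monoid_mult) ^ n"
  by (induction n) auto

abbreviation (input) lookup where "lookup \<equiv> Poly_Mapping.lookup"
abbreviation (input) keys where "keys \<equiv> Poly_Mapping.keys"
abbreviation (input) single where "single \<equiv> Poly_Mapping.single"

lemma sum_fun_apply: "(sum f A) x = (\<Sum>i\<in>A. f i x :: 'b :: comm_monoid_add)"
  by (induction A rule: infinite_finite_induct) auto

lemma prod_fun_apply: "(prod f A) x = (\<Prod>i\<in>A. f i x :: 'b :: comm_monoid_mult)"
  by (induction A rule: infinite_finite_induct) auto

lemma single_power_graded:
  "single k (f :: uhp \<Rightarrow> complex) ^ n = single (k * n :: nat) (f ^ n)"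
proof (induction n)
  case 0
  show ?case by (simp only: power_0 mult_0_right single_one)
next
  case (Suc n)
  show ?case by (simp only: power_Suc Suc.IH mult_single mult_Suc_right)
qed

lemma prod_single_graded:
  "(\<Prod>i\<in>A. single (w i) (f i :: uhp \<Rightarrow> complex)) = single (\<Sum>i\<in>A. w i :: nat) (\<Prod>i\<in>A. f i)"
proof (induction A rule: infinite_finite_induct)
  case (insert i A)
  thus ?case by (simp only: prod.insert sum.insert mult_single not_False_eq_True)
qed (simp_all only: prod.infinite sum.infinite prod.empty sum.empty single_one not_False_eq_True)

definition weight :: "('v::finite \<Rightarrow> nat) \<Rightarrow> ('v \<Rightarrow>\<^sub>0 nat) \<Rightarrow> nat" where
  "weight w m = (\<Sum>i\<in>UNIV. w i * lookup m i)"

definition monomial :: "('v::finite \<Rightarrow> uhp \<Rightarrow> complex) \<Rightarrow> ('v \<Rightarrow>\<^sub>0 nat) \<Rightarrow> uhp \<Rightarrow> complex" where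
  "monomial f m \<tau> = (\<Prod>i\<in>UNIV. f i \<tau> ^ lookup m i)"

context
  fixes x :: "graded ^ 'v::finite" and w :: "'v \<Rightarrow> nat" and f :: "'v \<Rightarrow> uhp \<Rightarrow> complex"
  assumes x: "\<And>i. x $ i = single (w i) (f i)"
begin

text \<open>An arbitrary finite S containing the keys allows p, q and p + q to be compared over one
  index set.\<close>

lemma lookup_mpoly_eval:
  assumes "finite S" "keys p \<subseteq> S"
  shows "lookup (mpoly_eval x p) k \<tau> =
    (\<Sum>m\<in>S. if weight w m = k then lookup p m * monomial f m \<tau> else 0)"
proof -
  have "single 0 (\<lambda>_. lookup p m) * (\<Prod>i\<in>UNIV. x $ i ^ lookup m i) =
     single (weight w m) (\<lambda>\<tau>. lookup p m * monomial f m \<tau>)" for m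
    by (simp add: x single_power_graded prod_single_graded mult_single weight_def monomial_def
        fun_eq_iff
          prod_fun_apply power_fun_apply)
       (simp add: times_fun_def prod_fun_apply power_fun_apply)
  hence "lookup (mpoly_eval x p) k \<tau> =
     (\<Sum>m\<in>keys p. if weight w m = k then lookup p m * monomial f m \<tau> else 0)"
    unfolding mpoly_eval_def lookup_sum sum_fun_apply
    by (intro sum.cong refl) (simp add: lookup_single when_def)
  also have "\<dots> = (\<Sum>m\<in>S. if weight w m = k then lookup p m * monomial f m \<tau> else 0)"
    using assms by (intro sum.mono_neutral_left) (auto simp: in_keys_iff)
  finally show ?thesis .
qed

lemma graded_eqI: "(\<And>k \<tau>. lookup F k \<tau> = lookup G k \<tau>) \<Longrightarrow> F = (G :: graded)"
  by (intro poly_mapping_eqI ext)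

lemma mpoly_eval_add: "mpoly_eval x (p + q) = mpoly_eval x p + mpoly_eval x q"
proof (rule graded_eqI)
  fix k \<tau>
  define S where "S = keys p \<union> keys q \<union> keys (p + q)"
  have S: "finite S" "keys p \<subseteq> S" "keys q \<subseteq> S" "keys (p + q) \<subseteq> S"
    by (auto simp: S_def)
  show "lookup (mpoly_eval x (p + q)) k \<tau> = lookup (mpoly_eval x p + mpoly_eval x q) k \<tau>"
    unfolding lookup_add plus_fun_def lookup_mpoly_eval[OF S(1,2)] lookup_mpoly_eval[OF S(1,3)]
        lookup_mpoly_eval[OF S(1,4)]
    by (simp add: sum.distrib [symmetric]) (auto intro!: sum.cong simp: lookup_add distrib_right)
qed

lemma mpoly_eval_single: "mpoly_eval x (single m c) = single (weight w m) (\<lambda>\<tau>. c * monomial f m \<tau>)"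
proof (rule graded_eqI)
  fix k \<tau>
  show "lookup (mpoly_eval x (single m c)) k \<tau> = 
     lookup (single (weight w m) (\<lambda>\<tau>. c * monomial f m \<tau>)) k \<tau>"
    by (subst lookup_mpoly_eval[of "{m}"]) (auto simp: lookup_single when_def)
qed

lemma generated_algebra_add:
  "F \<in> generated_algebra x \<Longrightarrow> G \<in> generated_algebra x \<Longrightarrow> F + G \<in> generated_algebra x"
  unfolding generated_algebra_def by (auto simp: mpoly_eval_add [symmetric])

lemma generated_algebra_zero: "0 \<in> generated_algebra x"
  unfolding generated_algebra_def by (rule range_eqI[of _ _ 0]) (simp add: mpoly_eval_def)

lemma generated_algebra_monomial: "single (weight w m) (\<lambda>\<tau>. c * monomial f m \<tau>) \<in> generated_algebra x"
  unfolding generated_algebra_def mpoly_eval_single[symmetric] by blast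

lemma generated_algebra_single_add:
  assumes "single k g \<in> generated_algebra x" "single k h \<in> generated_algebra x"
  shows "single k (\<lambda>\<tau>. g \<tau> + h \<tau>) \<in> generated_algebra x"
proof -
  have "single k (\<lambda>\<tau>. g \<tau> + h \<tau>) = single k g + single k h"
    by (simp add: single_add [symmetric] plus_fun_def)
  thus ?thesis using generated_algebra_add[OF assms] by simp
qed

lemma direct_sum_subset_generated:
  assumes "\<And>k g. g \<in> V k \<Longrightarrow> single k g \<in> generated_algebra x"
  shows "direct_sum V \<subseteq> generated_algebra x"
proof
  fix F :: graded assume F: "F \<in> direct_sum V"
  have "F = (\<Sum>k\<in>keys F. single k (lookup F k))"
  proof (rule poly_mapping_eqI)
    fix k
    show "lookup F k = lookup (\<Sum>k\<in>keys F. single k (lookup F k)) k"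
      by (simp add: lookup_sum lookup_single when_def in_keys_iff)
  qed
  also have "\<dots> \<in> generated_algebra x"
  proof -
    have "(\<Sum>k\<in>K. single k (lookup F k)) \<in> generated_algebra x" if "finite K" for K
      using that F by induction (auto simp: direct_sum_def intro!: generated_algebra_zero
          generated_algebra_add assms)
    thus ?thesis by simp
  qed
  finally show "F \<in> generated_algebra x" .
qed

lemma generated_subset_direct_sum:
  assumes "\<And>m c. (\<lambda>\<tau>. c * monomial f m \<tau>) \<in> V (weight w m)"
    and "\<And>k. (\<lambda>_. 0) \<in> V k" "\<And>k g h. g \<in> V k \<Longrightarrow> h \<in> V k \<Longrightarrow> (\<lambda>\<tau>. g \<tau> + h \<tau>) \<in> V k"
  shows "generated_algebra x \<subseteq> direct_sum V"
proof
  fix F assume "F \<in> generated_algebra x"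
  then obtain p where F: "F = mpoly_eval x p" by (auto simp: generated_algebra_def)
  have "(\<lambda>\<tau>. \<Sum>m\<in>S. if weight w m = k then lookup p m * monomial f m \<tau> else 0) \<in> V k" if "finite S"
      for S k
    using that
  proof induction
    case (insert m S)
    have "(\<lambda>\<tau>. if weight w m = k then lookup p m * monomial f m \<tau> else 0) \<in> V k"
      using assms(1)[of "lookup p m" m] assms(2) by (cases "weight w m = k") auto
    from assms(3)[OF this insert.IH] show ?case using insert.hyps by simp
  qed (use assms in simp)
  moreover have "lookup F k = (\<lambda>\<tau>. \<Sum>m\<in>keys p. if weight w m =
      k then lookup p m * monomial f m \<tau> else 0)" for k
    unfolding F by (intro ext lookup_mpoly_eval) auto
  ultimately show "F \<in> direct_sum V" by (simp add: direct_sum_def)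
qed

text \<open>An element of the graded algebra is zero when each homogeneous component is, so
  independence may be tested one weight at a time.\<close>

lemma algebraically_independentI:
  assumes "\<And>p m. (\<And>k \<tau>. (\<Sum>m | m \<in> keys p \<and> weight w m = k. lookup p m * monomial f m \<tau>) = 0) \<Longrightarrow>
      lookup p m = 0"
  shows "algebraically_independent x"
  unfolding algebraically_independent_def
proof (rule injI)
  fix p q assume eq: "mpoly_eval x p = mpoly_eval x q"
  have "mpoly_eval x (p - q) + mpoly_eval x q = mpoly_eval x p"
    by (simp add: mpoly_eval_add [symmetric])
  hence "mpoly_eval x (p - q) = 0" using eq by simp
  hence "(\<Sum>m\<in>keys (p - q). if weight w m = k then lookup (p - q) m * monomial f m \<tau> else 0) = 0"
      for k \<tau>
    using lookup_mpoly_eval[of "keys (p - q)" "p - q" k \<tau>] by simp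
  hence "(\<Sum>m | m \<in> keys (p - q) \<and> weight w m = k. lookup (p - q) m * monomial f m \<tau>) = 0" for k \<tau>
    by (simp add: sum.inter_filter [symmetric])
  hence "lookup (p - q) m = 0" for m by (rule assms)
  thus "p = q" by (intro poly_mapping_eqI) (simp add: lookup_minus)
qed

end

text \<open>The isobaric polynomials of weight 2n in Q2 and R2; the zero function arises from c =
  0.\<close>

inductive_set QR_span :: "nat \<Rightarrow> (uhp \<Rightarrow> complex) set" for n where
  QR_span_monomial: "b + 2 * d = n \<Longrightarrow> (\<lambda>\<tau>. c * Q\<^sub>2 \<tau> ^ b * R\<^sub>2 \<tau> ^ d) \<in> QR_span n"
| QR_span_add: "f \<in> QR_span n \<Longrightarrow> g \<in> QR_span n \<Longrightarrow> (\<lambda>\<tau>. f \<tau> + g \<tau>) \<in> QR_span n"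

lemma QR_span_mult_Q: "f \<in> QR_span n \<Longrightarrow> (\<lambda>\<tau>. a * Q\<^sub>2 \<tau> ^ 2 * f \<tau>) \<in> QR_span (n + 2)"
proof (induction rule: QR_span.induct)
  case (QR_span_monomial b d c)
  thus ?case using QR_span.QR_span_monomial[of "b + 2" d "n + 2" "a * c"]
      by (simp add: power_add power2_eq_square mult_ac)
next
  case (QR_span_add f g)
  thus ?case using QR_span.QR_span_add[OF QR_span_add.IH] by (simp add: distrib_left)
qed

lemma QR_span_mult_R: "f \<in> QR_span n \<Longrightarrow> (\<lambda>\<tau>. a * R\<^sub>2 \<tau> * f \<tau>) \<in> QR_span (n + 2)"
proof (induction rule: QR_span.induct)
  case (QR_span_monomial b d c)
  thus ?case using QR_span.QR_span_monomial[of b "d + 1" "n + 2" "a * c"] by (simp add: mult_ac)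
next
  case (QR_span_add f g)
  thus ?case using QR_span.QR_span_add[OF QR_span_add.IH] by (simp add: distrib_left)
qed

text \<open>Since A = (Q2^2 - R2)/128, each descent step contributes a polynomial in Q2 and
  R2.\<close>

theorem level2_in_QR_span: "level2 (int n) F G \<Longrightarrow> (\<lambda>\<tau>. F (nome \<tau>)) \<in> QR_span n"
proof (induction n arbitrary: F G rule: less_induct)
  case (less n)
  from less.prems show ?case
  proof (cases rule: level2_decompose)
    case (0 c)
    thus ?thesis using QR_span_monomial[of 0 0 n c] by (simp add: norm_nome_less)
  next
    case (1 c)
    thus ?thesis using QR_span_monomial[of 1 0 n c] by (simp add: norm_nome_less Q2_nome)
  next
    case (2 m c F' G')
    have A: "A_exp (nome \<tau>) = 1 / 128 * Q\<^sub>2 \<tau> ^ 2 + - 1 / 128 * R\<^sub>2 \<tau>" for \<tau>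
      using R_exp_eq[OF nome_in_ball, of \<tau>] by (simp add: Q2_nome R2_nome field_simps)
    have F': "(\<lambda>\<tau>. F' (nome \<tau>)) \<in> QR_span m" using 2 by (intro less.IH) auto
    have "(\<lambda>\<tau>. c * Q\<^sub>2 \<tau> ^ n * R\<^sub>2 \<tau> ^ 0 + (1 / 128 * Q\<^sub>2 \<tau> ^ 2 * F' (nome \<tau>) +
        - 1 / 128 * R\<^sub>2 \<tau> * F' (nome \<tau>))) \<in> QR_span (m + 2)"
      using 2(1) by (intro QR_span_add QR_span_mult_Q QR_span_mult_R F' QR_span_monomial) auto
    moreover have "F (nome \<tau>) = c * Q\<^sub>2 \<tau> ^ n * R\<^sub>2 \<tau> ^ 0 + (1 / 128 * Q\<^sub>2 \<tau> ^ 2 * F' (nome \<tau>) +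
        - 1 / 128 * R\<^sub>2 \<tau> * F' (nome \<tau>))" for \<tau>
      unfolding 2(3)[OF nome_in_ball] A by (simp add: Q2_nome algebra_simps)
    ultimately show ?thesis using 2(1) by simp
  qed
qed

text \<open>R2/Q2^2 = 1 - 128 A/Q2^2 has derivative -128 in q at the cusp, hence is injective near
  it.\<close>

lemma infinite_quotient_values:
  "infinite ((\<lambda>\<tau>. R\<^sub>2 \<tau> / Q\<^sub>2 \<tau> ^ 2) ` {\<tau>. Q\<^sub>2 \<tau> \<noteq> 0})"
proof -
  define S where "S = ball 0 1 \<inter> {w. Q_exp w \<noteq> 0}"
  have Qhol: "Q_exp holomorphic_on ball 0 1" by (rule level2D(1)[OF level2_Q])
  have "open (ball 0 1 \<inter> Q_exp -` (- {0}))"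
    by (intro continuous_open_preimage holomorphic_on_imp_continuous_on Qhol) auto
  hence S: "open S" "0 \<in> S" by (auto simp: S_def vimage_def Int_def Q_exp_0)
  define X where "X = (\<lambda>w. 1 - 128 * A_exp w / Q_exp w ^ 2)"
  have "X holomorphic_on S"
    unfolding X_def by (intro holomorphic_intros holomorphic_on_subset[OF A_exp_holomorphic]
        holomorphic_on_subset[OF Qhol]) (auto simp: S_def)
  moreover have "(X has_field_derivative - 128) (at 0)"
    unfolding X_def by (rule derivative_eq_intros A_exp_DERIV_0 Q_exp_DERIV_0 refl | simp add:
        Q_exp_0 A_exp_0)+
  hence "deriv X 0 \<noteq> 0" by (simp add: DERIV_imp_deriv)
  ultimately obtain r where r: "r > 0" "ball 0 r \<subseteq> S" "inj_on X (ball 0 r)"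
    using has_complex_derivative_locally_injective[OF _ S(2,1)] by blast
  have "infinite (ball 0 r - {0 :: complex})"
    using uncountable_infinite[OF uncountable_ball[OF r(1), of "0::complex"]]
        by (simp add: infinite_remove)
  moreover have "inj_on X (ball 0 r - {0})" using r(3) by (rule inj_on_subset) auto
  ultimately have "infinite (X ` (ball 0 r - {0}))" by (simp add: finite_image_iff)
  moreover have "X ` (ball 0 r - {0}) \<subseteq> (\<lambda>\<tau>. R\<^sub>2 \<tau> / Q\<^sub>2 \<tau> ^ 2) ` {\<tau>. Q\<^sub>2 \<tau> \<noteq> 0}"
  proof
    fix u assume "u \<in> X ` (ball 0 r - {0})"
    then obtain w where w: "w \<in> S" "w \<noteq> 0" "u = X w" using r(2) by auto
    have "w \<in> ball 0 1" using w by (simp add: S_def)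
    then obtain z where z: "Im z > 0" "ex z = w" using w(2) ex_onto_punctured_ball by metis
    hence n: "nome (to_uhp z) = w" by (simp add: nome_to_uhp)
    have "Q_exp w \<noteq> 0" using w by (simp add: S_def)
    hence "u = R\<^sub>2 (to_uhp z) / Q\<^sub>2 (to_uhp z) ^ 2" "Q\<^sub>2 (to_uhp z) \<noteq> 0"
      using R_exp_eq[OF \<open>w \<in> ball 0 1\<close>] w(3) by (simp_all add: R2_nome Q2_nome n X_def
          diff_divide_distrib)
    thus "u \<in> (\<lambda>\<tau>. R\<^sub>2 \<tau> / Q\<^sub>2 \<tau> ^ 2) ` {\<tau>. Q\<^sub>2 \<tau> \<noteq> 0}" by blast
  qed
  ultimately show ?thesis using finite_subset by blast
qed

text \<open>Dividing a relation of weight 2n by Q2^n leaves a polynomial in the single quantity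
  R2/Q2^2, which takes infinitely many values.\<close>

theorem QR_independent:
  assumes "\<And>\<tau>. (\<Sum>i | 2 * i \<le> n. e i * Q\<^sub>2 \<tau> ^ (n - 2 * i) * R\<^sub>2 \<tau> ^ i) = 0" "2 * i \<le> n"
  shows "e i = 0"
proof -
  have fin: "finite {i. 2 * i \<le> n}" by (rule finite_subset[of _ "{..n}"]) auto
  define p where "p = (\<Sum>i | 2 * i \<le> n. monom (e i) i)"
  have "p = 0"
  proof (rule poly_eqI_infinite[OF infinite_quotient_values])
    fix u assume "u \<in> (\<lambda>\<tau>. R\<^sub>2 \<tau> / Q\<^sub>2 \<tau> ^ 2) ` {\<tau>. Q\<^sub>2 \<tau> \<noteq> 0}"
    then obtain \<tau> where \<tau>: "u = R\<^sub>2 \<tau> / Q\<^sub>2 \<tau> ^ 2" "Q\<^sub>2 \<tau> \<noteq> 0" by auto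
    have "Q\<^sub>2 \<tau> ^ n * poly p u = (\<Sum>i | 2 * i \<le> n. e i * Q\<^sub>2 \<tau> ^ (n - 2 * i) * R\<^sub>2 \<tau> ^ i)"
      unfolding p_def poly_sum sum_distrib_left
    proof (intro sum.cong refl)
      fix i assume "i \<in> {i. 2 * i \<le> n}"
      hence "Q\<^sub>2 \<tau> ^ n = Q\<^sub>2 \<tau> ^ (n - 2 * i) * (Q\<^sub>2 \<tau> ^ 2) ^ i"
        by (simp add: power_mult [symmetric] power_add [symmetric])
      thus "Q\<^sub>2 \<tau> ^ n * poly (monom (e i) i) u = e i * Q\<^sub>2 \<tau> ^ (n - 2 * i) * R\<^sub>2 \<tau> ^ i"
        using \<tau> by (simp add: poly_monom power_divide)
    qed
    thus "poly p u = poly 0 u" using assms(1)[of \<tau>] \<tau>(2) by simp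
  qed
  hence "coeff p i = 0" by simp
  thus ?thesis using assms(2) fin by (simp add: p_def coeff_sum)
qed

section \<open>Generation and independence in the graded algebras\<close>

definition QR_vec :: "graded ^ 2" where
  "QR_vec = vector [single 2 Q\<^sub>2, single 4 R\<^sub>2]"

definition PQR_vec :: "graded ^ 3" where
  "PQR_vec = vector [single 2 P\<^sub>2, single 2 Q\<^sub>2, single 4 R\<^sub>2]"

definition w2 :: "2 \<Rightarrow> nat" where "w2 i = (if i = 1 then 2 else 4)"
definition f2 :: "2 \<Rightarrow> uhp \<Rightarrow> complex" where "f2 i = (if i = 1 then Q\<^sub>2 else R\<^sub>2)"
definition w3 :: "3 \<Rightarrow> nat" where "w3 i = (if i = 3 then 4 else 2)"
definition f3 :: "3 \<Rightarrow> uhp \<Rightarrow> complex" where "f3 i = (if i = 1 then P\<^sub>2 else if i =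
    2 then Q\<^sub>2 else R\<^sub>2)"

lemma QR_vec_nth: "QR_vec $ i = single (w2 i) (f2 i)"
  using exhaust_2[of i] by (auto simp: QR_vec_def w2_def f2_def)

lemma PQR_vec_nth: "PQR_vec $ i = single (w3 i) (f3 i)"
  using exhaust_3[of i] by (auto simp: PQR_vec_def w3_def f3_def)

lemma weight_w2: "weight w2 m = 2 * lookup m 1 + 4 * lookup m 2"
  by (simp add: weight_def w2_def sum_2)

lemma monomial_f2: "monomial f2 m \<tau> = Q\<^sub>2 \<tau> ^ lookup m 1 * R\<^sub>2 \<tau> ^ lookup m 2"
  by (simp add: monomial_def f2_def UNIV_2)

lemma weight_w3: "weight w3 m = 2 * lookup m 1 + 2 * lookup m 2 + 4 * lookup m 3"
  by (simp add: weight_def w3_def sum_3)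

lemma monomial_f3: "monomial f3 m \<tau> = P\<^sub>2 \<tau> ^ lookup m 1 * Q\<^sub>2 \<tau> ^ lookup m 2 * R\<^sub>2 \<tau> ^ lookup m 3"
  unfolding monomial_def UNIV_3 by (simp add: f3_def mult.assoc)

definition exponents2 :: "nat \<Rightarrow> nat \<Rightarrow> 2 \<Rightarrow>\<^sub>0 nat" where
  "exponents2 b d = single 1 b + single 2 d"

definition exponents3 :: "nat \<Rightarrow> nat \<Rightarrow> nat \<Rightarrow> 3 \<Rightarrow>\<^sub>0 nat" where
  "exponents3 a b d = single 1 a + single 2 b + single 3 d"

lemma lookup_exponents2 [simp]:
  "lookup (exponents2 b d) 1 = b" "lookup (exponents2 b d) 2 = d"
  by (simp_all add: exponents2_def lookup_add lookup_single)

lemma lookup_exponents3 [simp]: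
  "lookup (exponents3 a b d) 1 = a" "lookup (exponents3 a b d) 2 = b"
  "lookup (exponents3 a b d) 3 = d"
  by (simp_all add: exponents3_def lookup_add lookup_single)

lemma exponents2_eta: "exponents2 (lookup m 1) (lookup m 2) = m"
proof (rule poly_mapping_eqI)
  fix i :: 2
  show "lookup (exponents2 (lookup m 1) (lookup m 2)) i = lookup m i"
    using exhaust_2[of i] by auto
qed

lemma exponents3_eta: "exponents3 (lookup m 1) (lookup m 2) (lookup m 3) = m"
proof (rule poly_mapping_eqI)
  fix i :: 3
  show "lookup (exponents3 (lookup m 1) (lookup m 2) (lookup m 3)) i = lookup m i"
    using exhaust_3[of i] by auto
qed

lemma level2_QR_monomial:
  "level2 (int (b + 2 * d)) (\<lambda>w. c * (Q_exp w ^ b * R_exp w ^ d))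
      (\<lambda>w. c * (Q_exp0 w ^ b * R_exp0 w ^ d))"
proof -
  have "int (b + 2 * d) = int b * 1 + int d * 2" by simp
  thus ?thesis
    using level2_cmult[OF level2_mult[OF level2_power[OF level2_Q, of b]
        level2_power[OF level2_R, of d]], of c] by (simp only:)
qed

theorem modular_algebra_generated: "modular_algebra (Gamma0 2) = generated_algebra QR_vec"
  unfolding modular_algebra_def
proof (rule antisym)
  show "direct_sum (modular_forms (Gamma0 2)) \<subseteq> generated_algebra QR_vec"
  proof (rule direct_sum_subset_generated[OF QR_vec_nth])
    fix k g assume g: "g \<in> modular_forms (Gamma0 2) k"
    show "single k g \<in> generated_algebra QR_vec"
    proof (cases "even k")
      case False
      hence "g = 0" using modular_forms_odd[OF g] by (simp add: fun_eq_iff)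
      thus ?thesis using generated_algebra_zero[OF QR_vec_nth] by simp
    next
      case True
      then obtain n where k: "k = 2 * n" by (elim evenE)
      obtain F G where "level2 (int n) F G" "g = (\<lambda>\<tau>. F (nome \<tau>))"
        using modular_forms_level2 g unfolding k by metis
      hence "g \<in> QR_span n" using level2_in_QR_span by simp
      thus ?thesis
      proof induction
        case (QR_span_monomial b d c)
        hence "weight w2 (exponents2 b d) = k" by (simp add: weight_w2 k)
        thus ?case using generated_algebra_monomial[OF QR_vec_nth, of "exponents2 b d" c]
          by (simp add: monomial_f2 mult_ac)
      next
        case (QR_span_add f g)
        thus ?case by (intro generated_algebra_single_add[OF QR_vec_nth])
      qed
    qed
  qed
  show "generated_algebra QR_vec \<subseteq> direct_sum (modular_forms (Gamma0 2))"
  proof (rule generated_subset_direct_sum[OF QR_vec_nth])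
    fix m :: "2 \<Rightarrow>\<^sub>0 nat" and c
    show "(\<lambda>\<tau>. c * monomial f2 m \<tau>) \<in> modular_forms (Gamma0 2) (weight w2 m)"
      using level2_modular_forms[OF level2_QR_monomial[of "lookup m 1" "lookup m 2" c]]
      by (simp add: monomial_f2 weight_w2 Q2_nome R2_nome)
  qed (intro zero_modular_forms modular_forms_add; assumption)+
qed

theorem quasi_modular_algebra_generated: "quasi_modular_algebra (Gamma0 2) =
    generated_algebra PQR_vec"
  unfolding quasi_modular_algebra_def
proof (rule antisym)
  show "direct_sum (quasi_modular_forms (Gamma0 2)) \<subseteq> generated_algebra PQR_vec"
  proof (rule direct_sum_subset_generated[OF PQR_vec_nth])
    fix k g assume g: "g \<in> quasi_modular_forms (Gamma0 2) k"
    show "single k g \<in> generated_algebra PQR_vec"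
    proof (cases "even k")
      case False
      hence "g = 0" using quasi_even[OF g] by (simp add: fun_eq_iff)
      thus ?thesis using generated_algebra_zero[OF PQR_vec_nth] by simp
    next
      case True
      then obtain n where k: "k = 2 * n" by (elim evenE)
      obtain p F where F: "F 0 = g" "quasi_data (2 * n) p F"
        using g unfolding k quasi_modular_forms_iff by blast
      have "single k (F 0) \<in> generated_algebra PQR_vec"
      proof (rule quasi_induct[OF F(2)])
        fix q H G assume q: "q \<le> n" and "level2 (int (n - q)) H G"
        hence "(\<lambda>\<tau>. H (nome \<tau>)) \<in> QR_span (n - q)" by (intro level2_in_QR_span)
        thus "single k (\<lambda>\<tau>. H (nome \<tau>) * P\<^sub>2 \<tau> ^ q) \<in> generated_algebra PQR_vec"
        proof induction
          case (QR_span_monomial b d c)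
          hence "weight w3 (exponents3 q b d) = k" using q by (simp add: weight_w3 k)
          thus ?case using generated_algebra_monomial[OF PQR_vec_nth, of "exponents3 q b d" c]
            by (simp add: monomial_f3 mult_ac)
        next
          case (QR_span_add f g)
          thus ?case using generated_algebra_single_add[OF PQR_vec_nth QR_span_add.IH]
              by (simp add: distrib_right)
        qed
      next
        show "single k (\<lambda>_. 0) \<in> generated_algebra PQR_vec"
          using generated_algebra_zero[OF PQR_vec_nth] by (simp flip: zero_fun_def)
      qed (rule generated_algebra_single_add[OF PQR_vec_nth])
      thus ?thesis by (simp add: F(1))
    qed
  qed
  show "generated_algebra PQR_vec \<subseteq> direct_sum (quasi_modular_forms (Gamma0 2))"
  proof (rule generated_subset_direct_sum[OF PQR_vec_nth])
    fix m :: "3 \<Rightarrow>\<^sub>0 nat" and c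
    define a b d :: nat where "a = lookup m 1" and "b = lookup m 2" and "d = lookup m 3"
    have "moderate_growth (\<lambda>\<tau>. c * (Q\<^sub>2 \<tau> ^ b * R\<^sub>2 \<tau> ^ d))"
      by (intro moderate_growth_mult moderate_growth_const moderate_growth_power moderate_growth_PQR)
    with quasi_modular_forms_P_power[OF level2_QR_monomial[of b d c], of a]
    show "(\<lambda>\<tau>. c * monomial f3 m \<tau>) \<in> quasi_modular_forms (Gamma0 2) (weight w3 m)"
      by (simp add: monomial_f3 weight_w3 Q2_nome R2_nome a_def b_def d_def mult_ac add_ac
          distrib_left)
  qed (intro zero_quasi_modular_forms quasi_modular_forms_add; assumption)+
qed

text \<open>Monomials of a fixed weight, and of a fixed exponent of P2 if present, are determined by
  the exponent i of R2; \<iota> is this parametrisation, and it makes \<open>QR_independent\<close>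
  applicable.\<close>

lemma sum_QR_coefficients:
  assumes "finite K" "inj_on \<iota> {i. 2 * i \<le> n}" "K \<subseteq> \<iota> ` {i. 2 * i \<le> n}" "\<And>i. 2 * i \<le> n \<Longrightarrow> \<iota> i \<notin> K \<Longrightarrow>
      c (\<iota> i) = 0"
    "\<And>i. 2 * i \<le> n \<Longrightarrow> g (\<iota> i) = Q\<^sub>2 \<tau> ^ (n - 2 * i) * R\<^sub>2 \<tau> ^ i"
  shows "(\<Sum>m\<in>K. c m * g m) = (\<Sum>i | 2 * i \<le> n. c (\<iota> i) * Q\<^sub>2 \<tau> ^ (n - 2 * i) * R\<^sub>2 \<tau> ^ i)"
proof -
  have "finite {i. 2 * i \<le> n}" by (rule finite_subset[of _ "{..n}"]) auto
  hence "(\<Sum>m\<in>K. c m * g m) = (\<Sum>m\<in>\<iota> ` {i. 2 * i \<le> n}. c m * g m)"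
    using assms by (intro sum.mono_neutral_left) auto
  also have "\<dots> = (\<Sum>i | 2 * i \<le> n. c (\<iota> i) * g (\<iota> i))"
    using assms(2) by (simp add: sum.reindex)
  also have "\<dots> = (\<Sum>i | 2 * i \<le> n. c (\<iota> i) * Q\<^sub>2 \<tau> ^ (n - 2 * i) * R\<^sub>2 \<tau> ^ i)"
    using assms(5) by (intro sum.cong) auto
  finally show ?thesis .
qed

theorem QR_algebraically_independent: "algebraically_independent QR_vec"
proof (rule algebraically_independentI[OF QR_vec_nth])
  fix p :: "(2 \<Rightarrow>\<^sub>0 nat) \<Rightarrow>\<^sub>0 complex" and m0 :: "2 \<Rightarrow>\<^sub>0 nat"
  assume zero: "\<And>k \<tau>. (\<Sum>m | m \<in> keys p \<and> weight w2 m = k. lookup p m * monomial f2 m \<tau>) = 0"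
  define n :: nat where "n = lookup m0 1 + 2 * lookup m0 2"
  define \<iota> where "\<iota> = (\<lambda>i. exponents2 (n - 2 * i) i)"
  define K where "K = {m. m \<in> keys p \<and> weight w2 m = 2 * n}"
  have \<iota>_I: "m = \<iota> (lookup m 2)" "2 * lookup m 2 \<le> n" if "weight w2 m = 2 * n" for m
  proof -
    have n: "n = lookup m 1 + 2 * lookup m 2" using that by (simp add: weight_w2)
    thus "m = \<iota> (lookup m 2)" using exponents2_eta[of m] by (simp add: \<iota>_def)
    show "2 * lookup m 2 \<le> n" using n by simp
  qed
  have sum_zero: "(\<Sum>i | 2 * i \<le> n. lookup p (\<iota> i) * Q\<^sub>2 \<tau> ^ (n - 2 * i) * R\<^sub>2 \<tau> ^ i) = 0" for \<tau>
  proof -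
    have "(\<Sum>m\<in>K. lookup p m * monomial f2 m \<tau>) = (\<Sum>i | 2 * i \<le>
        n. lookup p (\<iota> i) * Q\<^sub>2 \<tau> ^ (n - 2 * i) * R\<^sub>2 \<tau> ^ i)"
    proof (rule sum_QR_coefficients)
      show "inj_on \<iota> {i. 2 * i \<le> n}"
        by (rule inj_onI) (metis \<iota>_def lookup_exponents2(2))
      show "K \<subseteq> \<iota> ` {i. 2 * i \<le> n}" using \<iota>_I by (auto simp: K_def)
      show "finite K" by (rule finite_subset[of _ "keys p"]) (auto simp: K_def)
    qed (auto simp: K_def \<iota>_def monomial_f2 weight_w2 in_keys_iff)
    thus ?thesis using zero[where k = "2 * n" and \<tau> = \<tau>] by (simp add: K_def)
  qed
  have m0: "weight w2 m0 = 2 * n"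
    by (simp add: weight_w2 n_def)
  have "lookup p (\<iota> (lookup m0 2)) = 0"
    by (rule QR_independent[where e = "\<lambda>i. lookup p (\<iota> i)", OF sum_zero \<iota>_I(2)[OF m0]])
  thus "lookup p m0 = 0"
    by (simp only: \<iota>_I(1)[OF m0, symmetric])
qed

text \<open>Fix \<tau> and evaluate a relation at its images under (1, 0; 2N, 1). Q2 and R2 are
  merely rescaled, while P2 becomes, after the same rescaling, P2 + kappa x for infinitely many x.
  So the relation vanishes as a polynomial in its first variable, and each coefficient is a relation
  between Q2 and R2.\<close>

theorem PQR_algebraically_independent: "algebraically_independent PQR_vec"
proof (rule algebraically_independentI[OF PQR_vec_nth])
  fix p :: "(3 \<Rightarrow>\<^sub>0 nat) \<Rightarrow>\<^sub>0 complex" and m0 :: "3 \<Rightarrow>\<^sub>0 nat"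
  assume zero: "\<And>k \<tau>. (\<Sum>m | m \<in> keys p \<and> weight w3 m = k. lookup p m * monomial f3 m \<tau>) = 0"
  define a :: nat where "a = lookup m0 1"
  define n :: nat where "n = lookup m0 2 + 2 * lookup m0 3"
  define k where "k = a + n"
  define \<iota> where "\<iota> = (\<lambda>i. exponents3 a (n - 2 * i) i)"
  define K where "K = {m. m \<in> keys p \<and> weight w3 m = 2 * k}"
  define Ka where "Ka = {m \<in> K. lookup m 1 = a}"
  have fin: "finite K" "finite Ka"
    by (rule finite_subset[of _ "keys p"], auto simp: K_def Ka_def)+
  define g where "g = (\<lambda>m \<tau>. Q\<^sub>2 \<tau> ^ lookup m 2 * R\<^sub>2 \<tau> ^ lookup m (3 :: 3))"
  have coefficient: "(\<Sum>m\<in>Ka. lookup p m * g m \<tau>) = 0" for \<tau>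
  proof -
    define r where "r = (\<Sum>m\<in>K. monom (lookup p m * g m \<tau>) (lookup m 1))"
    have "r = 0"
    proof (rule poly_eqI_infinite)
      define X where "X = (\<lambda>N. of_int (2 * int N) / (of_int (2 * int N) * of_uhp \<tau> + 1))"
      have "infinite ((\<lambda>u. P\<^sub>2 \<tau> + kappa * u) ` range X)"
        using infinite_unipotent_points[OF Im_of_uhp[of \<tau>]] kappa_nonzero
        by (subst finite_image_iff) (auto simp: X_def inj_on_def)
      thus "infinite ((\<lambda>u. P\<^sub>2 \<tau> + kappa * u) ` range X)" .
      fix y assume "y \<in> (\<lambda>u. P\<^sub>2 \<tau> + kappa * u) ` range X"
      then obtain N where y: "y = P\<^sub>2 \<tau> + kappa * X N" by auto
      define A where "A = mat2 1 0 (2 * int N) 1"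
      have A: "A \<in> Gamma0 2" by (simp add: A_def in_Gamma0_2_iff in_SL2Z_iff)
      define j where "j = autfactor A \<tau>"
      have j0: "j \<noteq> 0" unfolding j_def using A by (intro autfactor_nonzero) (simp add:
          in_Gamma0_2_iff)
      have P: "P\<^sub>2 (moebius A \<tau>) = j ^ 2 * y"
        unfolding P2_moebius[OF A] j_def[symmetric] y X_def by (simp add: j_def autfactor_def A_def)
      have Q: "Q\<^sub>2 (moebius A \<tau>) = j ^ 2 * Q\<^sub>2 \<tau>" "R\<^sub>2 (moebius A \<tau>) = (j ^ 2) ^ 2 * R\<^sub>2 \<tau>"
        using level2_moebius[OF level2_Q A, of \<tau>] level2_moebius[OF level2_R A, of \<tau>]
        by (simp_all add: Q2_nome R2_nome j_def)
      have "(j ^ 2) ^ k * poly r y = (\<Sum>m\<in>K. lookup p m * monomial f3 m (moebius A \<tau>))"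
        unfolding r_def poly_sum sum_distrib_left
      proof (intro sum.cong refl)
        fix m assume "m \<in> K"
        hence k: "k = lookup m 1 + lookup m 2 + 2 * lookup m 3"
          by (simp add: K_def weight_w3)
        show "(j ^ 2) ^ k * poly (monom (lookup p m * g m \<tau>) (lookup m 1)) y =
            lookup p m * monomial f3 m (moebius A \<tau>)"
          unfolding k monomial_f3 P Q g_def power_mult_distrib power_add power_mult poly_monom by
              (simp only: mult_ac)
      qed
      also have "\<dots> = 0" using zero[where k = "2 * k" and \<tau> = "moebius A \<tau>"] by (simp add: K_def)
      finally show "poly r y = poly 0 y" using j0 by simp
    qed
    hence "coeff r a = 0" by simp
    moreover have "coeff r a = (\<Sum>m\<in>Ka. lookup p m * g m \<tau>)"
      unfolding r_def coeff_sum coeff_monom Ka_def using fin(1) by (simp add: sum.inter_filter)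
    ultimately show ?thesis by simp
  qed
  have \<iota>_I: "m = \<iota> (lookup m 3)" "2 * lookup m 3 \<le> n"
    if "weight w3 m = 2 * k" "lookup m 1 = a" for m
  proof -
    have n: "n = lookup m 2 + 2 * lookup m 3" using that by (simp add: weight_w3 k_def)
    thus "m = \<iota> (lookup m 3)" using exponents3_eta[of m] that by (simp add: \<iota>_def)
    show "2 * lookup m 3 \<le> n" using n by simp
  qed
  have sum_zero: "(\<Sum>i | 2 * i \<le> n. lookup p (\<iota> i) * Q\<^sub>2 \<tau> ^ (n - 2 * i) * R\<^sub>2 \<tau> ^ i) = 0" for \<tau>
  proof -
    have "(\<Sum>m\<in>Ka. lookup p m * g m \<tau>) = (\<Sum>i | 2 * i \<le> n. lookup p (\<iota> i) * Q\<^sub>2 \<tau> ^ (n - 2 * i) *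
        R\<^sub>2 \<tau> ^ i)"
    proof (rule sum_QR_coefficients)
      show "inj_on \<iota> {i. 2 * i \<le> n}"
        by (rule inj_onI) (metis \<iota>_def lookup_exponents3(3))
      show "Ka \<subseteq> \<iota> ` {i. 2 * i \<le> n}" using \<iota>_I by (auto simp: Ka_def K_def)
      show "finite Ka" by (rule fin)
      fix i assume i: "2 * i \<le> n"
      have "weight w3 (\<iota> i) = 2 * k" "lookup (\<iota> i) 1 = a"
        using i by (simp_all add: weight_w3 \<iota>_def k_def)
      thus "lookup p (\<iota> i) = 0" if "\<iota> i \<notin> Ka"
        using that by (simp add: Ka_def K_def in_keys_iff)
      show "g (\<iota> i) \<tau> = Q\<^sub>2 \<tau> ^ (n - 2 * i) * R\<^sub>2 \<tau> ^ i"
        by (simp add: g_def \<iota>_def)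
    qed
    thus ?thesis using coefficient by simp
  qed
  have m0: "weight w3 m0 = 2 * k" "lookup m0 1 = a"
    by (simp_all add: weight_w3 n_def k_def a_def)
  have "lookup p (\<iota> (lookup m0 3)) = 0"
    by (rule QR_independent[where e = "\<lambda>i. lookup p (\<iota> i)", OF sum_zero \<iota>_I(2)[OF m0]])
  thus "lookup p m0 = 0"
    by (simp only: \<iota>_I(1)[OF m0, symmetric])
qed

section \<open>The Lie algebra\<close>

text \<open>The combination a R2 + b H2 + c F2 of the three vector fields, whose span turns out to
  be closed under the bracket.\<close>

definition vf_comb :: "complex \<Rightarrow> complex \<Rightarrow> complex \<Rightarrow> vfield" where
  "vf_comb a b c t = vector
     [a / 8 * ((t $ 1)\<^sup>2 - (t $ 2)\<^sup>2) + 2 * b * t $ 1 - 8 * c,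
      a / 4 * (t $ 1 * t $ 2 - t $ 3) + 2 * b * t $ 2,
      a / 2 * (t $ 1 * t $ 3 - (t $ 2) ^ 3) + 4 * b * t $ 3]"

lemma vec3_eqI: "x $ 1 = y $ 1 \<Longrightarrow> x $ 2 = y $ 2 \<Longrightarrow> x $ 3 = y $ 3 \<Longrightarrow> x = (y :: 'a ^ 3)"
  by (simp add: vec_eq_iff forall_3)

lemma partial_deriv_vf_comb:
  "partial_deriv 1 (\<lambda>s. vf_comb a b c s $ 1) t = a / 4 * t $ 1 + 2 * b"
  "partial_deriv 2 (\<lambda>s. vf_comb a b c s $ 1) t = - a / 4 * t $ 2"
  "partial_deriv 3 (\<lambda>s. vf_comb a b c s $ 1) t = 0"
  "partial_deriv 1 (\<lambda>s. vf_comb a b c s $ 2) t = a / 4 * t $ 2"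
  "partial_deriv 2 (\<lambda>s. vf_comb a b c s $ 2) t = a / 4 * t $ 1 + 2 * b"
  "partial_deriv 3 (\<lambda>s. vf_comb a b c s $ 2) t = - a / 4"
  "partial_deriv 1 (\<lambda>s. vf_comb a b c s $ 3) t = a / 2 * t $ 3"
  "partial_deriv 2 (\<lambda>s. vf_comb a b c s $ 3) t = - 3 * a / 2 * (t $ 2) ^ 2"
  "partial_deriv 3 (\<lambda>s. vf_comb a b c s $ 3) t = a / 2 * t $ 1 + 4 * b"
  unfolding partial_deriv_def vf_comb_def
  by (rule DERIV_imp_deriv; auto intro!: derivative_eq_intros simp: field_simps)+

text \<open>In coordinates this says [H2, R2] = 2 R2, [H2, F2] = -2 F2 and [R2, F2] = H2.\<close>

lemma vf_bracket_comb:
  "vf_bracket (vf_comb a b c) (vf_comb a' b' c') =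
     vf_comb (2 * (b * a' - a * b')) (a * c' - c * a') (2 * (c * b' - b * c'))"
proof
  fix t
  show "vf_bracket (vf_comb a b c) (vf_comb a' b' c') t =
     vf_comb (2 * (b * a' - a * b')) (a * c' - c * a') (2 * (c * b' - b * c')) t"
    unfolding vf_bracket_def vf_apply_def sum_3
    by (rule vec3_eqI; simp only: vec_lambda_beta partial_deriv_vf_comb; simp add: vf_comb_def
        field_simps power2_eq_square power3_eq_cube)
qed

lemma vf_generators_comb: "vf_R\<^sub>2 = vf_comb 1 0 0" "vf_H\<^sub>2 = vf_comb 0 1 0" "vf_F\<^sub>2 = vf_comb 0 0 1"
  by (rule ext, rule vec3_eqI; simp add: vf_comb_def vf_R\<^sub>2_def vf_H\<^sub>2_def vf_F\<^sub>2_def)+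

lemma vf_comb_add: "(\<lambda>t. vf_comb a b c t + vf_comb a' b' c' t) = vf_comb (a + a') (b + b') (c + c')"
  by (rule ext, rule vec3_eqI; simp add: vf_comb_def algebra_simps add_divide_distrib)

lemma vf_comb_scale: "(\<lambda>t. k *s vf_comb a b c t) = vf_comb (k * a) (k * b) (k * c)"
  by (rule ext, rule vec3_eqI; simp add: vf_comb_def algebra_simps)

lemma vf_comb_zero: "vf_comb 0 0 0 = (\<lambda>t. 0)"
  by (rule ext, rule vec3_eqI; simp add: vf_comb_def)

lemma lie_generated_RHF: "lie_generated {vf_R\<^sub>2, vf_H\<^sub>2, vf_F\<^sub>2} = {X. \<exists>a b c. X = vf_comb a b c}"
    (is "?L = ?V")
proof (intro equalityI subsetI)
  fix X assume "X \<in> ?L"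
  thus "X \<in> ?V"
  proof induction
    case (base X)
    thus ?case by (auto simp: vf_generators_comb)
  next
    case zero
    show ?case using vf_comb_zero[symmetric] by blast
  next
    case (add X Y)
    then obtain a b c a' b' c' where XY: "X = vf_comb a b c" "Y = vf_comb a' b' c'"
      by auto
    show ?case unfolding XY vf_comb_add by blast
  next
    case (scale X k)
    then obtain a b c where X: "X = vf_comb a b c"
      by auto
    show ?case unfolding X vf_comb_scale by blast
  next
    case (bracket X Y)
    then obtain a b c a' b' c' where XY: "X = vf_comb a b c" "Y = vf_comb a' b' c'"
      by auto
    show ?case unfolding XY vf_bracket_comb by blast
  qed
next
  fix X assume "X \<in> ?V"
  then obtain a b c where X: "X = vf_comb a b c" by auto
  have gen: "vf_comb 1 0 0 \<in> ?L" "vf_comb 0 1 0 \<in> ?L" "vf_comb 0 0 1 \<in> ?L"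
    by (auto intro: lie_generated.base simp flip: vf_generators_comb)
  have "vf_comb a 0 0 \<in> ?L" "vf_comb 0 b 0 \<in> ?L" "vf_comb 0 0 c \<in> ?L"
    using lie_generated.scale[OF gen(1), of a] lie_generated.scale[OF gen(2), of b]
        lie_generated.scale[OF gen(3), of c]
    by (simp_all add: vf_comb_scale)
  hence "vf_comb a b 0 \<in> ?L" "vf_comb 0 0 c \<in> ?L"
    using lie_generated.add[of "vf_comb a 0 0" _ "vf_comb 0 b 0"] by (simp_all add: vf_comb_add)
  from lie_generated.add[OF this] show "X \<in> ?L"
    by (simp add: vf_comb_add X)
qed

text \<open>$R_2, H_2, F_2$ correspond to the standard generators $e, h, f$; their coefficients are
  read off from the values at $0$ and $(0, 1, 0)$.\<close>

definition sl2_of_vf :: "vfield \<Rightarrow> complex ^ 2 ^ 2" where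
  "sl2_of_vf X = (let u = X (vector [0, 1, 0]) in
     vector [vector [u $ 2 / 2, - 2 * u $ 3], vector [- X 0 $ 1 / 8, - u $ 2 / 2]])"

lemma sl2_of_vf_comb: "sl2_of_vf (vf_comb a b c) = vector [vector [b, a], vector [c, - b]]"
  by (simp add: sl2_of_vf_def vf_comb_def)

theorem lie_generated_isomorphic_to_sl2: "isomorphic_to_sl2 (lie_generated {vf_R\<^sub>2, vf_H\<^sub>2, vf_F\<^sub>2})"
  unfolding isomorphic_to_sl2_def lie_generated_RHF
proof (intro exI[of _ sl2_of_vf] conjI)
  show "bij_betw sl2_of_vf {X. \<exists>a b c. X = vf_comb a b c} sl2"
  proof (rule bij_betw_imageI)
    show "inj_on sl2_of_vf {X. \<exists>a b c. X = vf_comb a b c}"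
      by (auto simp: inj_on_def sl2_of_vf_comb vec_eq_iff forall_2)
    show "sl2_of_vf ` {X. \<exists>a b c. X = vf_comb a b c} = sl2"
    proof (intro equalityI subsetI)
      fix A assume "A \<in> sl2"
      hence "A $ 2 $ 2 = - A $ 1 $ 1"
        by (simp add: sl2_def trace_def sum_2 add_eq_0_iff2)
      hence "A = sl2_of_vf (vf_comb (A $ 1 $ 2) (A $ 1 $ 1) (A $ 2 $ 1))"
        by (simp add: sl2_of_vf_comb vec_eq_iff forall_2)
      thus "A \<in> sl2_of_vf ` {X. \<exists>a b c. X = vf_comb a b c}" by blast
    qed (auto simp: sl2_of_vf_comb sl2_def trace_def sum_2)
  qed
qed (auto simp: vf_comb_add vf_comb_scale vf_bracket_comb sl2_of_vf_comb vec_eq_iff forall_2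
    matrix_matrix_mult_def sum_2 algebra_simps)

theorem theorem1p1:
  shows
    "(solves_system P\<^sub>2 Q\<^sub>2 R\<^sub>2 \<and>
      Q\<^sub>2 \<in> modular_forms (Gamma0 2) 2 \<and>
      R\<^sub>2 \<in> modular_forms (Gamma0 2) 4 \<and>
      P\<^sub>2 \<in> quasi_modular_forms (Gamma0 2) 2 \<and>
      \<Delta>\<^sub>2 \<in> cusp_forms (Gamma0 2) 8 \<and>
      (\<forall>\<tau>. \<Delta>\<^sub>2 \<tau> = 1 / 256 * (Q\<^sub>2 \<tau> ^ 4 - R\<^sub>2 \<tau> ^ 2)) \<and>
      (\<forall>\<tau>. qderiv \<Delta>\<^sub>2 \<tau> = P\<^sub>2 \<tau> * \<Delta>\<^sub>2 \<tau>)) \<and>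
     (let QR = vector [Poly_Mapping.single 2 Q\<^sub>2, Poly_Mapping.single 4 R\<^sub>2] :: graded^2;
          PQR = vector [Poly_Mapping.single 2 P\<^sub>2, Poly_Mapping.single 2 Q\<^sub>2,
                        Poly_Mapping.single 4 R\<^sub>2] :: graded^3
      in modular_algebra (Gamma0 2) = generated_algebra QR \<and>
         algebraically_independent QR \<and>
         quasi_modular_algebra (Gamma0 2) = generated_algebra PQR \<and>
         algebraically_independent PQR) \<and>
     isomorphic_to_sl2 (lie_generated {vf_R\<^sub>2, vf_H\<^sub>2, vf_F\<^sub>2})"
proof -
  have Q: "Q\<^sub>2 \<in> modular_forms (Gamma0 2) 2"
    using level2_modular_forms[of 1, OF _] level2_Q unfolding Q2_nome by simp
  have R: "R\<^sub>2 \<in> modular_forms (Gamma0 2) 4"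
    using level2_modular_forms[of 2] level2_R unfolding R2_nome by simp
  \<comment> \<open>P2 is the case H = 1, p = 1 of the products H P2^p.\<close>
  have P: "P\<^sub>2 \<in> quasi_modular_forms (Gamma0 2) 2"
    using quasi_modular_forms_P_power[of 0 "\<lambda>_. 1" "\<lambda>_. 1" 1]
        level2_const moderate_growth_const by simp
  \<comment> \<open>The factor A, whose expansion vanishes at 0, occurs in the expansion of Delta2 =
    A B at infinity and, since inversion exchanges A and B, also at the cusp 0.\<close>
  have \<Delta>: "\<Delta>\<^sub>2 \<in> cusp_forms (Gamma0 2) 8"
    using level2_cusp_forms[of 4 \<Delta>_exp] level2_\<Delta> unfolding \<Delta>2_nome by (simp add: \<Delta>_exp_def A_exp_0)
  show ?thesis
    unfolding Let_def QR_vec_def[symmetric] PQR_vec_def[symmetric]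
    by (intro conjI allI solves_system_PQR Q R P \<Delta> \<Delta>2_eq qderiv_\<Delta>2 modular_algebra_generated
          QR_algebraically_independent quasi_modular_algebra_generated PQR_algebraically_independent
          lie_generated_isomorphic_to_sl2)
qed

end
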